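(* Let $p$ be a prime and let $G_0$, $G_1$ and $G_2$ be pro-$p$ groups such that $\mathcal{R}_p(G_i)=0$ for $i=0,1,2$. If $G$ is one of the following groups, then $\mathcal{R}_p(G)=0$, and hence $G$ satisfies the $p$-Kijima--Nishi property: (i) $G$ is a proper amalgamated free pro-$p$ product $G=G_1\amalg_H G_2$ over a common subgroup $H$ of $G_1$ and $G_2$ such that the restriction maps $\mathrm{res}^1_{G_i,H}:\mathrm{H}^1(G_i,\mathbb{F}_p)\to \mathrm{H}^1(H,\mathbb{F}_p)$ are surjective for both $i=1,2$; (ii) $G$ is a proper pro-$p$ HNN-extension $G=\mathrm{HNN}(G_0,H,f)$ for a subgroup $H$ of $G_0$ and a monomorphism $f:H\to G_0$ such that the two maps $$f^\ast\circ\mathrm{res}^1_{G_0,f(H)},\ \mathrm{res}^1_{G_0,H}:\ \mathrm{H}^1(G_0,\mathbb{F}_p)\longrightarrow \mathrm{H}^1(H,\mathbb{F}_p)$$ are equal, where $f^\ast:\mathrm{H}^1(f(H),\mathbb{F}_p)\to \mathrm{H}^1(H,\mathbb{F}_p)$ is induced by $f$, and $\mathrm{res}^1_{G_0,H}$ is surjective.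
   Context: All subgroups of profinite groups are closed and all homomorphisms between them are continuous. For a profinite group $G$, $\mathrm{H}^n(G,\mathbb{F}_p)$ is continuous cohomology with trivial coefficients and $$\mathcal{R}_p(G)=\{\alpha\in \mathrm{H}^1(G,\mathbb{F}_p) : \alpha\smile\beta=0 \text{ for all }\beta\in \mathrm{H}^1(G,\mathbb{F}_p)\}.$$ For an open subgroup $U\le G$, corestriction maps $\mathcal{R}_p(U)$ into $\mathcal{R}_p(G)$, inducing $c_{U,G}:\mathcal{R}_p(U)\to\mathcal{R}_p(G)$. $G$ has the $p$-Kijima--Nishi property if $c_{U,G}$ is surjective for every open normal subgroup $U$ of index $p$. Amalgamated free pro-$p$ product: for pro-$p$ groups $G_1=\langle V_1\mid R_1\rangle$, $G_2=\langle V_2\mid R_2\rangle$ and injective continuous homomorphisms $f_i:H\to G_i$ from a pro-$p$ group $H$, $G_1\amalg_H G_2$ is the pro-$p$ group with pro-$p$ presentation $\langle V_1\cup V_2\mid R_1\cup R_2,\ f_1(h)=f_2(h)\ (h\in H)\rangle$. It is proper if the canonical maps $G_i\to G_1\amalg_H G_2$ are injective. Pro-$p$ HNN-extension: for a pro-$p$ group $G_0=\langle V\mid R\rangle$, a closed subgroup $H\subseteq G_0$ and an injective continuous homomorphism $f:H\to G_0$, $\mathrm{HNN}(G_0,H,f)$ is the pro-$p$ group with pro-$p$ presentation $\langle V,t\mid R,\ tht^{-1}=f(h)\ (h\in H)\rangle$. It is proper if the canonical map $G_0\to \mathrm{HNN}(G_0,H,f)$ is injective.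
   Formalization: In case (ii) the subgroup H is assumed nontrivial; for H = 1 the claim is false (e.g. G_0 = 1 gives G = Z_p with R_p(G) = F_p, and in general the class dual to the stable letter t always lies in R_p(G)). *)

theory Defs
  imports "HOL-Analysis.Analysis" "HOL-Algebra.Product_Groups"
begin

section \<open>Profinite and pro-p groups\<close>

text \<open>A topological group is a group together with an abstract topology on its carrier.
  A closed subgroup \<open>H\<close> of \<open>(G, T)\<close> is itself regarded as the topological group
  \<open>(G\<lparr>carrier := H\<rparr>, subtopology T H)\<close>.\<close>

definition topological_group :: "'a monoid \<Rightarrow> 'a topology \<Rightarrow> bool" where
  "topological_group G T \<longleftrightarrow>
     group G \<and> topspace T = carrier G \<and>
     continuous_map (prod_topology T T) T (\<lambda>(x, y). x \<otimes>\<^bsub>G\<^esub> y) \<and>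
     continuous_map T T (\<lambda>x. inv\<^bsub>G\<^esub> x)"

definition profinite_group :: "'a monoid \<Rightarrow> 'a topology \<Rightarrow> bool" where
  "profinite_group G T \<longleftrightarrow>
     topological_group G T \<and> compact_space T \<and> Hausdorff_space T \<and>
     (\<forall>W. openin T W \<and> \<one>\<^bsub>G\<^esub> \<in> W \<longrightarrow> (\<exists>U. subgroup U G \<and> openin T U \<and> U \<subseteq> W))"

definition pro_p_group :: "nat \<Rightarrow> 'a monoid \<Rightarrow> 'a topology \<Rightarrow> bool" where
  "pro_p_group p G T \<longleftrightarrow>
     profinite_group G T \<and>
     (\<forall>U. U \<lhd> G \<and> openin T U \<longrightarrow> (\<exists>n. card (rcosets\<^bsub>G\<^esub> U) = p ^ n))"

definition continuous_hom ::
  "'a monoid \<Rightarrow> 'a topology \<Rightarrow> 'b monoid \<Rightarrow> 'b topology \<Rightarrow> ('a \<Rightarrow> 'b) set" where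
  "continuous_hom G T G' T' = {f \<in> hom G G'. continuous_map T T' f}"


section \<open>Continuous cohomology with coefficients in the trivial module \<open>F\<^sub>p\<close>\<close>

text \<open>Inhomogeneous cochains. The field with \<open>p\<close> elements is \<open>{0..<p}\<close> with arithmetic
  modulo \<open>p\<close>, and \<open>G\<^sup>n\<close> consists of the extensional functions on \<open>{..<n}\<close>.\<close>

definition power_top :: "'a topology \<Rightarrow> nat \<Rightarrow> (nat \<Rightarrow> 'a) topology" where
  "power_top T n = product_topology (\<lambda>_. T) {..<n}"

definition cochain_group :: "nat \<Rightarrow> 'a topology \<Rightarrow> nat \<Rightarrow> ((nat \<Rightarrow> 'a) \<Rightarrow> int) monoid" where
  "cochain_group p T n =
     \<lparr>carrier = {f \<in> extensional (topspace (power_top T n)).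
                  continuous_map (power_top T n) (discrete_topology {0..<int p}) f},
      mult = (\<lambda>f g. \<lambda>x\<in>topspace (power_top T n). (f x + g x) mod int p),
      one = (\<lambda>x\<in>topspace (power_top T n). 0)\<rparr>"

definition coboundary_map ::
  "nat \<Rightarrow> 'a monoid \<Rightarrow> 'a topology \<Rightarrow> nat \<Rightarrow> ((nat \<Rightarrow> 'a) \<Rightarrow> int) \<Rightarrow> (nat \<Rightarrow> 'a) \<Rightarrow> int" where
  "coboundary_map p G T n f =
     (\<lambda>x\<in>topspace (power_top T (Suc n)).
        (f (\<lambda>i\<in>{..<n}. x (Suc i))
         + (\<Sum>j<n. (- 1) ^ Suc j *
              f (\<lambda>i\<in>{..<n}. if i < j then x i
                            else if i = j then x j \<otimes>\<^bsub>G\<^esub> x (Suc j)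
                            else x (Suc i)))
         + (- 1) ^ Suc n * f (\<lambda>i\<in>{..<n}. x i)) mod int p)"

definition cocycles ::
  "nat \<Rightarrow> 'a monoid \<Rightarrow> 'a topology \<Rightarrow> nat \<Rightarrow> ((nat \<Rightarrow> 'a) \<Rightarrow> int) set" where
  "cocycles p G T n =
     kernel (cochain_group p T n) (cochain_group p T (Suc n)) (coboundary_map p G T n)"

definition coboundaries ::
  "nat \<Rightarrow> 'a monoid \<Rightarrow> 'a topology \<Rightarrow> nat \<Rightarrow> ((nat \<Rightarrow> 'a) \<Rightarrow> int) set" where
  "coboundaries p G T n =
     (case n of 0 \<Rightarrow> {\<one>\<^bsub>cochain_group p T 0\<^esub>}
      | Suc m \<Rightarrow> coboundary_map p G T m ` carrier (cochain_group p T m))"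

definition cohomology ::
  "nat \<Rightarrow> 'a monoid \<Rightarrow> 'a topology \<Rightarrow> nat \<Rightarrow> ((nat \<Rightarrow> 'a) \<Rightarrow> int) set monoid" where
  "cohomology p G T n =
     (cochain_group p T n)\<lparr>carrier := cocycles p G T n\<rparr> Mod coboundaries p G T n"

definition cohomology_class ::
  "nat \<Rightarrow> 'a monoid \<Rightarrow> 'a topology \<Rightarrow> nat \<Rightarrow> ((nat \<Rightarrow> 'a) \<Rightarrow> int) \<Rightarrow> ((nat \<Rightarrow> 'a) \<Rightarrow> int) set" where
  "cohomology_class p G T n f = coboundaries p G T n #>\<^bsub>cochain_group p T n\<^esub> f"

text \<open>Operations on cohomology classes are unions over representatives of the resulting
  classes, in the style of \<^const>\<open>set_mult\<close>; all these classes coincide.\<close>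

definition cochain_cup ::
  "nat \<Rightarrow> 'a topology \<Rightarrow> nat \<Rightarrow> nat \<Rightarrow> ((nat \<Rightarrow> 'a) \<Rightarrow> int) \<Rightarrow> ((nat \<Rightarrow> 'a) \<Rightarrow> int)
    \<Rightarrow> (nat \<Rightarrow> 'a) \<Rightarrow> int" where
  "cochain_cup p T m n f g =
     (\<lambda>x\<in>topspace (power_top T (m + n)).
        (f (\<lambda>i\<in>{..<m}. x i) * g (\<lambda>i\<in>{..<n}. x (m + i))) mod int p)"

definition cup ::
  "nat \<Rightarrow> 'a monoid \<Rightarrow> 'a topology \<Rightarrow> nat \<Rightarrow> nat \<Rightarrow> ((nat \<Rightarrow> 'a) \<Rightarrow> int) set
    \<Rightarrow> ((nat \<Rightarrow> 'a) \<Rightarrow> int) set \<Rightarrow> ((nat \<Rightarrow> 'a) \<Rightarrow> int) set" where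
  "cup p G T m n \<alpha> \<beta> =
     (\<Union>f\<in>\<alpha>. \<Union>g\<in>\<beta>. cohomology_class p G T (m + n) (cochain_cup p T m n f g))"

text \<open>The map \<open>H\<^sup>n(G', F\<^sub>p) \<rightarrow> H\<^sup>n(G, F\<^sub>p)\<close> induced by a continuous homomorphism
  \<open>\<phi> : G \<rightarrow> G'\<close>.\<close>

definition induced ::
  "nat \<Rightarrow> 'a monoid \<Rightarrow> 'a topology \<Rightarrow> nat \<Rightarrow> ('a \<Rightarrow> 'b) \<Rightarrow> ((nat \<Rightarrow> 'b) \<Rightarrow> int) set
    \<Rightarrow> ((nat \<Rightarrow> 'a) \<Rightarrow> int) set" where
  "induced p G T n \<phi> \<alpha> =
     (\<Union>f\<in>\<alpha>. cohomology_class p G T n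
        (\<lambda>x\<in>topspace (power_top T n). f (\<lambda>i\<in>{..<n}. \<phi> (x i))))"

definition restriction ::
  "nat \<Rightarrow> 'a monoid \<Rightarrow> 'a topology \<Rightarrow> 'a set \<Rightarrow> nat \<Rightarrow> ((nat \<Rightarrow> 'a) \<Rightarrow> int) set
    \<Rightarrow> ((nat \<Rightarrow> 'a) \<Rightarrow> int) set" where
  "restriction p G T H n = induced p (G\<lparr>carrier := H\<rparr>) (subtopology T H) n (\<lambda>x. x)"

text \<open>Corestriction from an open subgroup \<open>U\<close>. On homogeneous cochains it is
  \<open>(cor f)(s\<^sub>0, \<dots>, s\<^sub>n) = (\<Sum>c. f(r(c) s\<^sub>0 r(c s\<^sub>0)\<inverse>, \<dots>, r(c) s\<^sub>n r(c s\<^sub>n)\<inverse>))\<close>, where \<open>c\<close> runs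
  over the right cosets of \<open>U\<close> and \<open>r(c) \<in> c\<close> are chosen representatives. The formula
  below is its inhomogeneous form, obtained with \<open>s\<^sub>i = x\<^sub>0 \<cdots> x\<^sub>i\<^sub>-\<^sub>1\<close>; on classes it does not
  depend on the representatives.\<close>

primrec partial_prod :: "'a monoid \<Rightarrow> (nat \<Rightarrow> 'a) \<Rightarrow> nat \<Rightarrow> 'a" where
  "partial_prod G x 0 = \<one>\<^bsub>G\<^esub>"
| "partial_prod G x (Suc i) = partial_prod G x i \<otimes>\<^bsub>G\<^esub> x i"

definition coset_rep :: "'a set \<Rightarrow> 'a" where
  "coset_rep c = (SOME y. y \<in> c)"

definition cochain_cor ::
  "nat \<Rightarrow> 'a monoid \<Rightarrow> 'a topology \<Rightarrow> 'a set \<Rightarrow> nat \<Rightarrow> ((nat \<Rightarrow> 'a) \<Rightarrow> int) \<Rightarrow> (nat \<Rightarrow> 'a) \<Rightarrow> int" where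
  "cochain_cor p G T U n f =
     (\<lambda>x\<in>topspace (power_top T n).
        (\<Sum>c\<in>rcosets\<^bsub>G\<^esub> U.
           f (\<lambda>i\<in>{..<n}. coset_rep (c #>\<^bsub>G\<^esub> partial_prod G x i) \<otimes>\<^bsub>G\<^esub> x i
                \<otimes>\<^bsub>G\<^esub> inv\<^bsub>G\<^esub> coset_rep (c #>\<^bsub>G\<^esub> partial_prod G x (Suc i)))) mod int p)"

definition corestriction ::
  "nat \<Rightarrow> 'a monoid \<Rightarrow> 'a topology \<Rightarrow> 'a set \<Rightarrow> nat \<Rightarrow> ((nat \<Rightarrow> 'a) \<Rightarrow> int) set
    \<Rightarrow> ((nat \<Rightarrow> 'a) \<Rightarrow> int) set" where
  "corestriction p G T U n \<alpha> = (\<Union>f\<in>\<alpha>. cohomology_class p G T n (cochain_cor p G T U n f))"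

definition cup_radical ::
  "nat \<Rightarrow> 'a monoid \<Rightarrow> 'a topology \<Rightarrow> ((nat \<Rightarrow> 'a) \<Rightarrow> int) set set" where
  "cup_radical p G T =
     {\<alpha> \<in> carrier (cohomology p G T 1).
        \<forall>\<beta>\<in>carrier (cohomology p G T 1). cup p G T 1 1 \<alpha> \<beta> = \<one>\<^bsub>cohomology p G T 2\<^esub>}"

text \<open>Corestriction maps the radical of \<open>U\<close> into the radical of \<open>G\<close> by the projection
  formula, so surjectivity is the only condition to be stated.\<close>

definition Kijima_Nishi :: "nat \<Rightarrow> 'a monoid \<Rightarrow> 'a topology \<Rightarrow> bool" where
  "Kijima_Nishi p G T \<longleftrightarrow>
     (\<forall>U. U \<lhd> G \<and> openin T U \<and> card (rcosets\<^bsub>G\<^esub> U) = p \<longrightarrow>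
        (\<forall>\<alpha>\<in>cup_radical p G T.
           \<exists>\<beta>\<in>cup_radical p (G\<lparr>carrier := U\<rparr>) (subtopology T U).
             corestriction p G T U 1 \<beta> = \<alpha>))"


section \<open>Free pro-p groups and pro-p presentations\<close>

text \<open>The free pro-p group on a set \<open>V\<close> (converging to 1). Take all pairs of a finite p-group
  \<open>K\<close> and a map \<open>\<phi> : V \<rightarrow> K\<close> with \<open>\<phi> v = 1\<close> for almost all \<open>v\<close>; up to isomorphism all finite
  p-groups have their carrier in \<^typ>\<open>nat\<close>. The free pro-p group is the closed subgroup of the
  product of all these \<open>K\<close> topologically generated by the tuples \<open>(\<phi> v)\<close> for \<open>v \<in> V\<close>.
  Projection to the factor \<open>(K, \<phi>)\<close> is the homomorphism extending \<open>\<phi>\<close>.\<close>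

type_synonym 'v free_elem = "nat monoid \<times> ('v \<Rightarrow> nat) \<Rightarrow> nat"

definition finite_p_maps :: "nat \<Rightarrow> 'v set \<Rightarrow> (nat monoid \<times> ('v \<Rightarrow> nat)) set" where
  "finite_p_maps p V =
     {(K, \<phi>). group K \<and> finite (carrier K) \<and> (\<exists>n. order K = p ^ n) \<and>
        \<phi> \<in> V \<rightarrow>\<^sub>E carrier K \<and> finite {v \<in> V. \<phi> v \<noteq> \<one>\<^bsub>K\<^esub>}}"

definition free_gen :: "nat \<Rightarrow> 'v set \<Rightarrow> 'v \<Rightarrow> 'v free_elem" where
  "free_gen p V v = (\<lambda>k\<in>finite_p_maps p V. snd k v)"

definition ambient_group :: "nat \<Rightarrow> 'v set \<Rightarrow> 'v free_elem monoid" where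
  "ambient_group p V = product_group (finite_p_maps p V) fst"

definition ambient_top :: "nat \<Rightarrow> 'v set \<Rightarrow> 'v free_elem topology" where
  "ambient_top p V =
     product_topology (\<lambda>k. discrete_topology (carrier (fst k))) (finite_p_maps p V)"

definition free_pro_p :: "nat \<Rightarrow> 'v set \<Rightarrow> 'v free_elem monoid" where
  "free_pro_p p V =
     (ambient_group p V)
       \<lparr>carrier := ambient_top p V closure_of generate (ambient_group p V) (free_gen p V ` V)\<rparr>"

definition free_pro_p_top :: "nat \<Rightarrow> 'v set \<Rightarrow> 'v free_elem topology" where
  "free_pro_p_top p V = subtopology (ambient_top p V) (carrier (free_pro_p p V))"

text \<open>The homomorphism of free pro-p groups extending a map \<open>e : V \<rightarrow> W\<close> that is injective
  on \<open>V\<close>.\<close>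

definition free_map :: "nat \<Rightarrow> 'v set \<Rightarrow> 'w set \<Rightarrow> ('v \<Rightarrow> 'w) \<Rightarrow> 'v free_elem \<Rightarrow> 'w free_elem" where
  "free_map p V W e x = (\<lambda>k\<in>finite_p_maps p W. x (fst k, restrict (snd k \<circ> e) V))"

definition closed_normal_closure :: "'a monoid \<Rightarrow> 'a topology \<Rightarrow> 'a set \<Rightarrow> 'a set" where
  "closed_normal_closure G T R = \<Inter>{N. N \<lhd> G \<and> closedin T N \<and> R \<subseteq> N}"

text \<open>\<open>(G, T)\<close> has the pro-p presentation \<open>\<langle>V | R\<rangle>\<close> via the projection \<open>\<pi>\<close> from the free
  pro-p group on \<open>V\<close>; the relators may be arbitrary elements of that free pro-p group. By
  compactness \<open>\<pi>\<close> induces an isomorphism of topological groups from the quotient by the closed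
  normal closure of \<open>R\<close> to \<open>G\<close>.\<close>

definition pro_p_presentation ::
  "nat \<Rightarrow> 'v set \<Rightarrow> 'v free_elem set \<Rightarrow> 'a monoid \<Rightarrow> 'a topology \<Rightarrow> ('v free_elem \<Rightarrow> 'a) \<Rightarrow> bool" where
  "pro_p_presentation p V R G T \<pi> \<longleftrightarrow>
     pro_p_group p G T \<and> R \<subseteq> carrier (free_pro_p p V) \<and>
     \<pi> \<in> continuous_hom (free_pro_p p V) (free_pro_p_top p V) G T \<and>
     \<pi> ` carrier (free_pro_p p V) = carrier G \<and>
     kernel (free_pro_p p V) G \<pi> =
       closed_normal_closure (free_pro_p p V) (free_pro_p_top p V) R"

text \<open>If \<open>G\<^sub>0\<close> is presented on \<open>V\<close> via \<open>\<pi>\<^sub>0\<close> and \<open>G\<close> on \<open>W\<close> via \<open>\<pi>\<close>, where \<open>e : V \<rightarrow> W\<close>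
  carries the relators of \<open>G\<^sub>0\<close> to relators of \<open>G\<close>, this is the canonical map \<open>G\<^sub>0 \<rightarrow> G\<close>.\<close>

definition canonical_map ::
  "nat \<Rightarrow> 'v set \<Rightarrow> ('v free_elem \<Rightarrow> 'a) \<Rightarrow> 'w set \<Rightarrow> ('w free_elem \<Rightarrow> 'g) \<Rightarrow> ('v \<Rightarrow> 'w) \<Rightarrow> 'a \<Rightarrow> 'g" where
  "canonical_map p V \<pi>\<^sub>0 W \<pi> e g =
     \<pi> (free_map p V W e (inv_into (carrier (free_pro_p p V)) \<pi>\<^sub>0 g))"


section \<open>Amalgamated free pro-p products\<close>

text \<open>The relation \<open>f\<^sub>1(h) = f\<^sub>2(h)\<close> is imposed for all elements of the free groups representing
  \<open>f\<^sub>1(h)\<close> and \<open>f\<^sub>2(h)\<close>; modulo the relators of \<open>G\<^sub>1\<close> and \<open>G\<^sub>2\<close> one choice would suffice.\<close>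

definition amalgam_relators ::
  "nat \<Rightarrow> 'v set \<Rightarrow> 'v free_elem set \<Rightarrow> ('v free_elem \<Rightarrow> 'a)
    \<Rightarrow> 'w set \<Rightarrow> 'w free_elem set \<Rightarrow> ('w free_elem \<Rightarrow> 'b)
    \<Rightarrow> 'h monoid \<Rightarrow> ('h \<Rightarrow> 'a) \<Rightarrow> ('h \<Rightarrow> 'b) \<Rightarrow> ('v + 'w) free_elem set" where
  "amalgam_relators p V\<^sub>1 R\<^sub>1 \<pi>\<^sub>1 V\<^sub>2 R\<^sub>2 \<pi>\<^sub>2 H f\<^sub>1 f\<^sub>2 =
     (let W = V\<^sub>1 <+> V\<^sub>2; F = free_pro_p p W;
          j\<^sub>1 = free_map p V\<^sub>1 W Inl; j\<^sub>2 = free_map p V\<^sub>2 W Inr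
      in j\<^sub>1 ` R\<^sub>1 \<union> j\<^sub>2 ` R\<^sub>2 \<union>
         {j\<^sub>1 x \<otimes>\<^bsub>F\<^esub> inv\<^bsub>F\<^esub> j\<^sub>2 y | x y h.
            x \<in> carrier (free_pro_p p V\<^sub>1) \<and> y \<in> carrier (free_pro_p p V\<^sub>2) \<and>
            h \<in> carrier H \<and> \<pi>\<^sub>1 x = f\<^sub>1 h \<and> \<pi>\<^sub>2 y = f\<^sub>2 h})"

definition amalgamated_product ::
  "nat \<Rightarrow> 'v set \<Rightarrow> 'v free_elem set \<Rightarrow> 'a monoid \<Rightarrow> 'a topology \<Rightarrow> ('v free_elem \<Rightarrow> 'a)
    \<Rightarrow> 'w set \<Rightarrow> 'w free_elem set \<Rightarrow> 'b monoid \<Rightarrow> 'b topology \<Rightarrow> ('w free_elem \<Rightarrow> 'b)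
    \<Rightarrow> 'h monoid \<Rightarrow> 'h topology \<Rightarrow> ('h \<Rightarrow> 'a) \<Rightarrow> ('h \<Rightarrow> 'b)
    \<Rightarrow> 'g monoid \<Rightarrow> 'g topology \<Rightarrow> (('v + 'w) free_elem \<Rightarrow> 'g) \<Rightarrow> bool" where
  "amalgamated_product p V\<^sub>1 R\<^sub>1 G\<^sub>1 T\<^sub>1 \<pi>\<^sub>1 V\<^sub>2 R\<^sub>2 G\<^sub>2 T\<^sub>2 \<pi>\<^sub>2 H TH f\<^sub>1 f\<^sub>2 G T \<pi> \<longleftrightarrow>
     pro_p_presentation p V\<^sub>1 R\<^sub>1 G\<^sub>1 T\<^sub>1 \<pi>\<^sub>1 \<and> pro_p_presentation p V\<^sub>2 R\<^sub>2 G\<^sub>2 T\<^sub>2 \<pi>\<^sub>2 \<and>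
     pro_p_group p H TH \<and>
     f\<^sub>1 \<in> continuous_hom H TH G\<^sub>1 T\<^sub>1 \<and> inj_on f\<^sub>1 (carrier H) \<and>
     f\<^sub>2 \<in> continuous_hom H TH G\<^sub>2 T\<^sub>2 \<and> inj_on f\<^sub>2 (carrier H) \<and>
     pro_p_presentation p (V\<^sub>1 <+> V\<^sub>2) (amalgam_relators p V\<^sub>1 R\<^sub>1 \<pi>\<^sub>1 V\<^sub>2 R\<^sub>2 \<pi>\<^sub>2 H f\<^sub>1 f\<^sub>2) G T \<pi>"

definition proper_amalgamated_product ::
  "nat \<Rightarrow> 'v set \<Rightarrow> 'v free_elem set \<Rightarrow> 'a monoid \<Rightarrow> 'a topology \<Rightarrow> ('v free_elem \<Rightarrow> 'a)
    \<Rightarrow> 'w set \<Rightarrow> 'w free_elem set \<Rightarrow> 'b monoid \<Rightarrow> 'b topology \<Rightarrow> ('w free_elem \<Rightarrow> 'b)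
    \<Rightarrow> 'h monoid \<Rightarrow> 'h topology \<Rightarrow> ('h \<Rightarrow> 'a) \<Rightarrow> ('h \<Rightarrow> 'b)
    \<Rightarrow> 'g monoid \<Rightarrow> 'g topology \<Rightarrow> (('v + 'w) free_elem \<Rightarrow> 'g) \<Rightarrow> bool" where
  "proper_amalgamated_product p V\<^sub>1 R\<^sub>1 G\<^sub>1 T\<^sub>1 \<pi>\<^sub>1 V\<^sub>2 R\<^sub>2 G\<^sub>2 T\<^sub>2 \<pi>\<^sub>2 H TH f\<^sub>1 f\<^sub>2 G T \<pi> \<longleftrightarrow>
     amalgamated_product p V\<^sub>1 R\<^sub>1 G\<^sub>1 T\<^sub>1 \<pi>\<^sub>1 V\<^sub>2 R\<^sub>2 G\<^sub>2 T\<^sub>2 \<pi>\<^sub>2 H TH f\<^sub>1 f\<^sub>2 G T \<pi> \<and>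
     inj_on (canonical_map p V\<^sub>1 \<pi>\<^sub>1 (V\<^sub>1 <+> V\<^sub>2) \<pi> Inl) (carrier G\<^sub>1) \<and>
     inj_on (canonical_map p V\<^sub>2 \<pi>\<^sub>2 (V\<^sub>1 <+> V\<^sub>2) \<pi> Inr) (carrier G\<^sub>2)"


section \<open>Pro-p HNN-extensions\<close>

text \<open>The generators are those of \<open>G\<^sub>0\<close>, embedded by \<^const>\<open>Some\<close>, and the stable letter
  \<open>t\<close>, which is \<^const>\<open>None\<close>. The definition allows \<open>H = 1\<close>; then the extension is the
  free pro-p product of \<open>G\<^sub>0\<close> and \<open>\<langle>t\<rangle> \<cong> Z\<^sub>p\<close>, and the nonzero class \<open>\<tau>\<close> in \<open>H\<^sup>1\<close> with
  \<open>\<tau>(t) = 1\<close> and \<open>\<tau> = 0\<close> on \<open>G\<^sub>0\<close> always lies in the cup radical. Statements asserting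
  that the radical vanishes must therefore exclude \<open>H = 1\<close>.\<close>

definition hnn_gens :: "'v set \<Rightarrow> 'v option set" where
  "hnn_gens V = insert None (Some ` V)"

definition hnn_relators ::
  "nat \<Rightarrow> 'v set \<Rightarrow> 'v free_elem set \<Rightarrow> ('v free_elem \<Rightarrow> 'a)
    \<Rightarrow> 'a set \<Rightarrow> ('a \<Rightarrow> 'a) \<Rightarrow> 'v option free_elem set" where
  "hnn_relators p V R \<pi>\<^sub>0 H f =
     (let W = hnn_gens V; F = free_pro_p p W; j = free_map p V W Some; t = free_gen p W None
      in j ` R \<union>
         {t \<otimes>\<^bsub>F\<^esub> j x \<otimes>\<^bsub>F\<^esub> inv\<^bsub>F\<^esub> t \<otimes>\<^bsub>F\<^esub> inv\<^bsub>F\<^esub> j y | x y h.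
            x \<in> carrier (free_pro_p p V) \<and> y \<in> carrier (free_pro_p p V) \<and>
            h \<in> H \<and> \<pi>\<^sub>0 x = h \<and> \<pi>\<^sub>0 y = f h})"

definition hnn_extension ::
  "nat \<Rightarrow> 'v set \<Rightarrow> 'v free_elem set \<Rightarrow> 'a monoid \<Rightarrow> 'a topology \<Rightarrow> ('v free_elem \<Rightarrow> 'a)
    \<Rightarrow> 'a set \<Rightarrow> ('a \<Rightarrow> 'a) \<Rightarrow> 'g monoid \<Rightarrow> 'g topology \<Rightarrow> ('v option free_elem \<Rightarrow> 'g) \<Rightarrow> bool" where
  "hnn_extension p V R G\<^sub>0 T\<^sub>0 \<pi>\<^sub>0 H f G T \<pi> \<longleftrightarrow>
     pro_p_presentation p V R G\<^sub>0 T\<^sub>0 \<pi>\<^sub>0 \<and>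
     subgroup H G\<^sub>0 \<and> closedin T\<^sub>0 H \<and>
     f \<in> continuous_hom (G\<^sub>0\<lparr>carrier := H\<rparr>) (subtopology T\<^sub>0 H) G\<^sub>0 T\<^sub>0 \<and> inj_on f H \<and>
     pro_p_presentation p (hnn_gens V) (hnn_relators p V R \<pi>\<^sub>0 H f) G T \<pi>"

definition proper_hnn_extension ::
  "nat \<Rightarrow> 'v set \<Rightarrow> 'v free_elem set \<Rightarrow> 'a monoid \<Rightarrow> 'a topology \<Rightarrow> ('v free_elem \<Rightarrow> 'a)
    \<Rightarrow> 'a set \<Rightarrow> ('a \<Rightarrow> 'a) \<Rightarrow> 'g monoid \<Rightarrow> 'g topology \<Rightarrow> ('v option free_elem \<Rightarrow> 'g) \<Rightarrow> bool" where
  "proper_hnn_extension p V R G\<^sub>0 T\<^sub>0 \<pi>\<^sub>0 H f G T \<pi> \<longleftrightarrow>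
     hnn_extension p V R G\<^sub>0 T\<^sub>0 \<pi>\<^sub>0 H f G T \<pi> \<and>
     inj_on (canonical_map p V \<pi>\<^sub>0 (hnn_gens V) \<pi> Some) (carrier G\<^sub>0)"

end

theory Submission
  imports Defs "HOL-Algebra.Sylow" "HOL-Algebra.Multiplicative_Group"
begin

text \<open>A class in \<open>H\<^sup>1\<close> is a single cocycle, that is, a character \<open>G \<rightarrow> Z/p\<close>, and
  \<open>\<xi> \<union> \<beta> = 0\<close> means that \<open>\<xi> x * \<beta> y = s x + s y - s (x y)\<close> for some continuous \<open>s\<close>. In both
  cases every character of a factor \<open>G\<^sub>i\<close> extends to \<open>G\<close>: it prescribes values on the
  generators, and surjectivity of the restriction (respectively the equality of the two
  restrictions) makes these compatible with the relators. So a character \<open>\<xi>\<close> in the radical of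
  \<open>G\<close> restricts to the radical of each factor, which is zero. In the amalgamated case \<open>\<xi>\<close> vanishes
  on all generators. In the HNN case only \<open>\<xi> t = 0\<close> remains, which follows by evaluating \<open>s\<close> on
  \<open>t h = f h t\<close> for a character \<open>\<beta>\<close> with \<open>\<beta> h \<noteq> 0\<close>. Once the radical of \<open>G\<close> is zero, the
  Kijima--Nishi property asks only for a preimage of \<open>0\<close>.\<close>

text \<open>The generating sets may be infinite and only converge to 1, so prescribed values on the
  generators of a free pro-\<open>p\<close> group extend to a character exactly when almost all of
  them are zero. The values used for \<open>G\<close> are glued from characters of the factors,
  whose finite support comes from continuity. A glued character descends to \<open>G\<close> because
  the kernel of a presentation is the least closed normal subgroup containing the relators. The
  character \<open>\<beta>\<close> with \<open>\<beta> h \<noteq> 0\<close> of the HNN case is the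
  place where the theory of \<open>p\<close>-groups enters. In a finite quotient of the base group
  in which \<open>H\<close> has nontrivial image, that image has a normal subgroup of index
  \<open>p\<close>, and this gives a nonzero character of \<open>H\<close>. Surjectivity of the
  restriction extends it to the base group, and the equality of the two maps extends it to
  \<open>G\<close>, with value 0 at the stable letter.\<close>

declare One_nat_def [simp del]

section \<open>Cohomology in degrees one and two\<close>

text \<open>Characters are not extensional: two of them may agree on the carrier and differ outside,
  so every uniqueness statement below is made for elements of the carrier.\<close>

definition characters :: "nat \<Rightarrow> 'a monoid \<Rightarrow> 'a topology \<Rightarrow> ('a \<Rightarrow> int) set" where
  "characters p G T = continuous_hom G T (integer_mod_group p) (discrete_topology {0..<int p})"

text \<open>A 1-cochain is a function on one-element tuples. This is the cochain of a function on
  the group; being extensional, it forgets the values outside \<open>topspace T\<close>.\<close>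

definition lift1 :: "'a topology \<Rightarrow> ('a \<Rightarrow> int) \<Rightarrow> (nat \<Rightarrow> 'a) \<Rightarrow> int" where
  "lift1 T s = (\<lambda>x\<in>topspace (power_top T 1). s (x 0))"

text \<open>The witness \<open>s\<close> is a 1-cochain whose inhomogeneous coboundary is the cup
  product cocycle, with the terms in the order of that coboundary.\<close>

definition cup_vanishes :: "nat \<Rightarrow> 'a monoid \<Rightarrow> 'a topology \<Rightarrow> ('a \<Rightarrow> int) \<Rightarrow> ('a \<Rightarrow> int) \<Rightarrow> bool" where
  "cup_vanishes p G T \<xi> \<beta> \<longleftrightarrow>
     (\<exists>s. continuous_map T (discrete_topology {0..<int p}) s \<and>
       (\<forall>x\<in>carrier G. \<forall>y\<in>carrier G.
          (\<xi> x * \<beta> y) mod int p = (s y - s (x \<otimes>\<^bsub>G\<^esub> y) + s x) mod int p))"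

lemma continuous_map_discreteD:
  "continuous_map T (discrete_topology A) f \<Longrightarrow> x \<in> topspace T \<Longrightarrow> f x \<in> A"
  by (auto simp: continuous_map_def)

lemma topspace_power_top: "topspace (power_top T n) = (\<Pi>\<^sub>E i\<in>{..<n}. topspace T)"
  by (simp add: power_top_def)

text \<open>The restricted tuple is the form in which 1-cochains are evaluated by the coboundary,
  the cup product, induced maps and corestriction.\<close>

lemma lift1_eval: "g 0 \<in> topspace T \<Longrightarrow> lift1 T s (\<lambda>i\<in>{..<1}. g i) = s (g 0)"
  by (auto simp: lift1_def topspace_power_top PiE_iff)

lemma lift1_cong: "(\<And>x. x \<in> topspace T \<Longrightarrow> s x = s' x) \<Longrightarrow> lift1 T s = lift1 T s'"
  by (auto simp: lift1_def topspace_power_top PiE_iff intro!: restrict_ext)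

lemma lift1_eqD: "lift1 T s = lift1 T s' \<Longrightarrow> x \<in> topspace T \<Longrightarrow> s x = s' x"
  by (metis lift1_eval[of "\<lambda>_. x"])

lemma lift1_in_cochains:
  assumes "continuous_map T (discrete_topology {0..<int p}) s"
  shows "lift1 T s \<in> carrier (cochain_group p T 1)"
proof -
  have "continuous_map (power_top T 1) T (\<lambda>x. x 0)"
    unfolding power_top_def by (rule continuous_map_product_projection) simp
  then have "continuous_map (power_top T 1) (discrete_topology {0..<int p}) (s \<circ> (\<lambda>x. x 0))"
    using assms continuous_map_compose by blast
  then have "continuous_map (power_top T 1) (discrete_topology {0..<int p}) (lift1 T s)"
    by (rule continuous_map_eq) (simp add: lift1_def)
  then show ?thesis
    by (simp add: cochain_group_def lift1_def)
qed

lemma cochain1_is_lift1: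
  assumes "f \<in> carrier (cochain_group p T 1)"
  obtains s where "continuous_map T (discrete_topology {0..<int p}) s" "f = lift1 T s"
proof
  have c: "continuous_map T (power_top T 1) (\<lambda>a. \<lambda>i\<in>{..<1}. a)"
    unfolding power_top_def continuous_map_componentwise by (auto simp: extensional_def)
  show "continuous_map T (discrete_topology {0..<int p}) (\<lambda>a. f (\<lambda>i\<in>{..<1}. a))"
    using continuous_map_compose[OF c, of "discrete_topology {0..<int p}" f] assms
    by (simp add: cochain_group_def o_def)
  show "f = lift1 T (\<lambda>a. f (\<lambda>i\<in>{..<1}. a))"
  proof
    fix x
    have "x = (\<lambda>i\<in>{..<1}. x 0)" if "x \<in> topspace (power_top T 1)"
      using that by (auto simp: topspace_power_top PiE_iff extensional_def fun_eq_iff)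
    then show "f x = lift1 T (\<lambda>a. f (\<lambda>i\<in>{..<1}. a)) x"
      using assms by (cases "x \<in> topspace (power_top T 1)")
        (auto simp: cochain_group_def lift1_def extensional_def)
  qed
qed

text \<open>The action is trivial: in degree 0 the two outer terms of the differential are the same
  value with opposite signs.\<close>

lemma coboundaries_1:
  assumes "p > 0"
  shows "coboundaries p G T 1 = {lift1 T (\<lambda>_. 0)}"
proof -
  have *: "coboundary_map p G T 0 f = lift1 T (\<lambda>_. 0)" for f
    by (auto simp: coboundary_map_def lift1_def fun_eq_iff restrict_def One_nat_def)
  have "(\<lambda>x\<in>topspace (power_top T 0). 0) \<in> carrier (cochain_group p T 0)"
  proof -
    have "continuous_map (power_top T 0) (discrete_topology {0..<int p}) (\<lambda>x. 0)"
      using assms by simp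
    then have "continuous_map (power_top T 0) (discrete_topology {0..<int p})
        (\<lambda>x\<in>topspace (power_top T 0). 0)"
      by (rule continuous_map_eq) simp
    then show ?thesis
      by (simp add: cochain_group_def)
  qed
  then show ?thesis
    unfolding coboundaries_def One_nat_def by (auto simp: * image_def)
qed

text \<open>Adding the zero coboundary reduces values modulo \<open>p\<close>, which changes nothing
  because \<open>s\<close> already takes least residues as values.\<close>

lemma cohomology_class_1:
  assumes "p > 0" "\<And>x. x \<in> topspace T \<Longrightarrow> s x \<in> {0..<int p}"
  shows "cohomology_class p G T 1 (lift1 T s) = {lift1 T s}"
proof -
  have "(\<lambda>x\<in>topspace (power_top T 1). (lift1 T (\<lambda>_. 0) x + lift1 T s x) mod int p) = lift1 T s"
  proof (unfold lift1_def, intro restrict_ext)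
    fix x assume x: "x \<in> topspace (power_top T 1)"
    then have "s (x 0) \<in> {0..<int p}"
      using assms(2) by (simp add: topspace_power_top PiE_iff)
    with x show "((\<lambda>x\<in>topspace (power_top T 1). 0) x +
        (\<lambda>x\<in>topspace (power_top T 1). s (x 0)) x) mod int p = s (x 0)"
      by (simp add: mod_pos_pos_trivial)
  qed
  then show ?thesis
    by (simp add: cohomology_class_def coboundaries_1 assms r_coset_def cochain_group_def)
qed

lemma characters_continuous:
  "\<xi> \<in> characters p G T \<Longrightarrow> continuous_map T (discrete_topology {0..<int p}) \<xi>"
  by (simp add: characters_def continuous_hom_def)

lemma characters_range:
  "\<xi> \<in> characters p G T \<Longrightarrow> x \<in> topspace T \<Longrightarrow> \<xi> x \<in> {0..<int p}"
  using characters_continuous continuous_map_discreteD by fast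

lemma characters_mult:
  "\<xi> \<in> characters p G T \<Longrightarrow> x \<in> carrier G \<Longrightarrow> y \<in> carrier G \<Longrightarrow>
    \<xi> (x \<otimes>\<^bsub>G\<^esub> y) = (\<xi> x + \<xi> y) mod int p"
  by (simp add: characters_def continuous_hom_def hom_def)

lemma characters_iff:
  assumes "p > 0" "topspace T = carrier G"
  shows "\<xi> \<in> characters p G T \<longleftrightarrow>
    continuous_map T (discrete_topology {0..<int p}) \<xi> \<and>
    (\<forall>x\<in>carrier G. \<forall>y\<in>carrier G. \<xi> (x \<otimes>\<^bsub>G\<^esub> y) = (\<xi> x + \<xi> y) mod int p)"
proof -
  have "\<xi> \<in> carrier G \<rightarrow> {0..<int p}" if "continuous_map T (discrete_topology {0..<int p}) \<xi>"
    using that assms(2) continuous_map_discreteD by fast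
  then show ?thesis
    using assms by (auto simp: characters_def continuous_hom_def hom_def carrier_integer_mod_group)
qed

section \<open>Degree one: cocycles as characters\<close>

text \<open>The common ground of pro-\<open>p\<close> groups, their subgroups and the free
  pro-\<open>p\<close> groups, at all of which it is instantiated.\<close>

locale cohomology_setting = group G for G :: "'a monoid" (structure) +
  fixes T :: "'a topology" and p :: nat
  assumes topspace_eq: "topspace T = carrier G" and p_pos: "p > 0"
begin

lemma zero_character: "(\<lambda>_. 0) \<in> characters p G T"
  using p_pos by (simp add: characters_iff topspace_eq)

lemma coboundary_lift1:
  "coboundary_map p G T 1 (lift1 T s) =
     (\<lambda>x\<in>topspace (power_top T 2). (s (x 1) - s (x 0 \<otimes> x 1) + s (x 0)) mod int p)"
proof -
  have "(lift1 T s (\<lambda>i\<in>{..<1}. x (Suc i)) +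
      (\<Sum>j<1. (- 1) ^ Suc j * lift1 T s (\<lambda>i\<in>{..<1}. if i < j then x i
                            else if i = j then x j \<otimes> x (Suc j) else x (Suc i))) +
      (- 1) ^ Suc 1 * lift1 T s (\<lambda>i\<in>{..<1}. x i)) mod int p =
      (s (x 1) - s (x 0 \<otimes> x 1) + s (x 0)) mod int p"
    if "x \<in> topspace (power_top T 2)" for x
  proof -
    have x: "x 0 \<in> carrier G" "x 1 \<in> carrier G"
      using that by (auto simp: topspace_power_top PiE_iff topspace_eq)
    have a: "lift1 T s (\<lambda>i\<in>{..<1}. x (Suc i)) = s (x 1)"
      "lift1 T s (\<lambda>i\<in>{..<1}. if i < 0 then x i
                            else if i = 0 then x 0 \<otimes> x (Suc 0) else x (Suc i)) = s (x 0 \<otimes> x 1)"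
      "lift1 T s (\<lambda>i\<in>{..<1}. x i) = s (x 0)"
      using x lift1_eval[of "\<lambda>i. x (Suc i)" T s]
        lift1_eval[of "\<lambda>i. if i < 0 then x i else if i = 0 then x 0 \<otimes> x (Suc 0) else x (Suc i)" T s]
        lift1_eval[of x T s]
      by (simp_all add: topspace_eq One_nat_def)
    have sum1: "(\<Sum>j<1::nat. F j) = F 0" for F :: "nat \<Rightarrow> int"
      by (simp add: One_nat_def)
    show ?thesis
      unfolding sum1 a by simp

  qed
  then show ?thesis
    unfolding coboundary_map_def Suc_1 by (intro restrict_ext)
qed

lemma cochain_cup_lift1:
  "cochain_cup p T 1 1 (lift1 T \<xi>) (lift1 T \<beta>) =
     (\<lambda>x\<in>topspace (power_top T 2). (\<xi> (x 0) * \<beta> (x 1)) mod int p)"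
proof -
  have "lift1 T \<xi> (\<lambda>i\<in>{..<1}. x i) = \<xi> (x 0)" "lift1 T \<beta> (\<lambda>i\<in>{..<1}. x (1 + i)) = \<beta> (x 1)"
    if "x \<in> topspace (power_top T 2)" for x
    using that by (subst lift1_eval; simp add: topspace_power_top PiE_iff)+
  then show ?thesis
    unfolding cochain_cup_def one_add_one by (intro restrict_ext) simp
qed

text \<open>Every pair of group elements is \<open>(x 0, x 1)\<close> for some 2-tuple, so equations
  between extensional 2-cochains can be tested on pairs.\<close>

lemma restrict_pairs_eq_iff:
  "(\<lambda>x\<in>topspace (power_top T 2). F (x 0) (x 1)) = (\<lambda>x\<in>topspace (power_top T 2). F' (x 0) (x 1))
    \<longleftrightarrow> (\<forall>a\<in>carrier G. \<forall>b\<in>carrier G. F a b = F' a b)"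
proof
  assume L: "(\<lambda>x\<in>topspace (power_top T 2). F (x 0) (x 1)) =
    (\<lambda>x\<in>topspace (power_top T 2). F' (x 0) (x 1))"
  show "\<forall>a\<in>carrier G. \<forall>b\<in>carrier G. F a b = F' a b"
  proof (intro ballI)
    fix a b assume "a \<in> carrier G" "b \<in> carrier G"
    then have "(\<lambda>i\<in>{..<2::nat}. if i = 0 then a else b) \<in> topspace (power_top T 2)"
      by (auto simp: topspace_power_top topspace_eq)
    then show "F a b = F' a b"
      using fun_cong[OF L, of "\<lambda>i\<in>{..<2::nat}. if i = 0 then a else b"] by simp
  qed
qed (auto simp: topspace_power_top PiE_iff topspace_eq intro!: restrict_ext)

lemma lift1_cocycle_iff:
  assumes "continuous_map T (discrete_topology {0..<int p}) s"
  shows "lift1 T s \<in> cocycles p G T 1 \<longleftrightarrow> s \<in> characters p G T"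
proof -
  have r: "s x \<in> {0..<int p}" if "x \<in> carrier G" for x
    using assms that topspace_eq continuous_map_discreteD by fast
  have "lift1 T s \<in> cocycles p G T 1 \<longleftrightarrow>
     (\<lambda>x\<in>topspace (power_top T 2). (s (x 1) - s (x 0 \<otimes> x 1) + s (x 0)) mod int p) =
     (\<lambda>x\<in>topspace (power_top T 2). 0)"
    using lift1_in_cochains[OF assms]
    by (simp add: cocycles_def kernel_def coboundary_lift1 Suc_1)
      (simp add: cochain_group_def)
  also have "\<dots> \<longleftrightarrow> (\<forall>a\<in>carrier G. \<forall>b\<in>carrier G. (s b - s (a \<otimes> b) + s a) mod int p = 0)"
    by (rule restrict_pairs_eq_iff)
  also have "\<dots> \<longleftrightarrow> (\<forall>a\<in>carrier G. \<forall>b\<in>carrier G. s (a \<otimes> b) = (s a + s b) mod int p)"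
  proof (intro ball_cong refl)
    fix a b assume "a \<in> carrier G" "b \<in> carrier G"
    \<comment> \<open>Values are least residues, so the congruence expressed by the cocycle
      condition is an equation for \<open>s (a \<otimes> b)\<close>.\<close>
    then have m: "s (a \<otimes> b) mod int p = s (a \<otimes> b)"
      using r by (intro mod_pos_pos_trivial) auto
    have "(s b - s (a \<otimes> b) + s a) mod int p = 0 \<longleftrightarrow> int p dvd (s a + s b) - s (a \<otimes> b)"
      by (simp add: algebra_simps dvd_eq_mod_eq_0)
    also have "\<dots> \<longleftrightarrow> (s a + s b) mod int p = s (a \<otimes> b) mod int p"
      by (simp add: mod_eq_dvd_iff)
    finally show "(s b - s (a \<otimes> b) + s a) mod int p = 0 \<longleftrightarrow> s (a \<otimes> b) = (s a + s b) mod int p"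
      using m by auto
  qed
  finally show ?thesis
    using assms by (simp add: characters_iff p_pos topspace_eq)
qed

lemma cocycles_1: "cocycles p G T 1 = lift1 T ` characters p G T"
proof -
  have "f \<in> lift1 T ` characters p G T" if "f \<in> cocycles p G T 1" for f
  proof -
    have "f \<in> carrier (cochain_group p T 1)"
      using that by (simp add: cocycles_def kernel_def)
    then show ?thesis
      by (metis cochain1_is_lift1 image_eqI lift1_cocycle_iff that)
  qed
  then show ?thesis
    using lift1_cocycle_iff characters_continuous by blast
qed

lemma carrier_cohomology_1:
  "carrier (cohomology p G T 1) = (\<lambda>\<xi>. {lift1 T \<xi>}) ` characters p G T"
proof -
  have "carrier (cohomology p G T 1) =
      cohomology_class p G T 1 ` cocycles p G T 1"
    by (auto simp: cohomology_def FactGroup_def RCOSETS_def cohomology_class_def r_coset_def)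
  also have "\<dots> = (\<lambda>\<xi>. cohomology_class p G T 1 (lift1 T \<xi>)) ` characters p G T"
    by (simp add: cocycles_1 image_image)
  also have "\<dots> = (\<lambda>\<xi>. {lift1 T \<xi>}) ` characters p G T"
    by (intro image_cong refl cohomology_class_1 p_pos) (rule characters_range)
  finally show ?thesis .
qed

lemma one_cohomology_1: "\<one>\<^bsub>cohomology p G T 1\<^esub> = {lift1 T (\<lambda>_. 0)}"
  using p_pos by (simp add: cohomology_def coboundaries_1)

section \<open>Degree two: coboundaries and the cup radical\<close>

lemma coboundaries_2:
  "c \<in> coboundaries p G T 2 \<longleftrightarrow>
    (\<exists>s. continuous_map T (discrete_topology {0..<int p}) s \<and>
      c = (\<lambda>x\<in>topspace (power_top T 2). (s (x 1) - s (x 0 \<otimes> x 1) + s (x 0)) mod int p))"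
proof -
  have "coboundaries p G T 2 = coboundary_map p G T 1 ` carrier (cochain_group p T 1)"
    by (simp add: coboundaries_def One_nat_def numeral_2_eq_2)
  moreover have "carrier (cochain_group p T 1) =
      lift1 T ` {s. continuous_map T (discrete_topology {0..<int p}) s}"
    using lift1_in_cochains by (auto elim!: cochain1_is_lift1 simp del: One_nat_def)
  ultimately show ?thesis
    by (simp only: image_image coboundary_lift1) (simp add: image_iff Bex_def)
qed

text \<open>The factor \<open>k\<close> treats the sum (\<open>k = 1\<close>) and the difference
  (\<open>k = -1\<close>) of two cochains together.\<close>

lemma continuous_map_mod_add_mult:
  assumes s: "continuous_map T (discrete_topology {0..<int p}) s"
    and u: "continuous_map T (discrete_topology {0..<int p}) u"
  shows "continuous_map T (discrete_topology {0..<int p}) (\<lambda>x. (s x + k * u x) mod int p)"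
proof -
  have "continuous_map T (discrete_topology ({0..<int p} \<times> {0..<int p})) (\<lambda>x. (s x, u x))"
    using s u by (simp add: prod_topology_discrete_topology continuous_map_pairwise o_def)
  moreover have "continuous_map (discrete_topology ({0..<int p} \<times> {0..<int p}))
     (discrete_topology {0..<int p}) (\<lambda>(a, b). (a + k * b) mod int p)"
    using p_pos by (auto simp: continuous_map_from_discrete_topology)
  ultimately have "continuous_map T (discrete_topology {0..<int p})
      ((\<lambda>(a, b). (a + k * b) mod int p) \<circ> (\<lambda>x. (s x, u x)))"
    by (rule continuous_map_compose)
  then show ?thesis
    by (simp add: o_def)
qed

text \<open>Translation by \<open>c\<close> preserves the set of coboundaries exactly when
  \<open>c\<close> is one: 0 is translated to \<open>c\<close>, and translation by a coboundary is
  undone by translation by its negative. The form required of \<open>c\<close> makes its values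
  reduced, so that adding 0 gives back \<open>c\<close> itself.\<close>

lemma cohomology_class_2_trivial_iff:
  assumes c: "c = (\<lambda>x\<in>topspace (power_top T 2). F (x 0) (x 1) mod int p)"
  shows "cohomology_class p G T 2 c = \<one>\<^bsub>cohomology p G T 2\<^esub> \<longleftrightarrow>
    c \<in> coboundaries p G T 2"
proof -
  let ?X = "topspace (power_top T 2)"
  let ?d = "\<lambda>s. \<lambda>x\<in>?X. (s (x 1) - s (x 0 \<otimes> x 1) + s (x 0)) mod int p"
  let ?C = "continuous_map T (discrete_topology {0..<int p})"
  let ?B = "coboundaries p G T 2"
  have cl: "cohomology_class p G T 2 c = (\<lambda>b. \<lambda>x\<in>?X. (b x + c x) mod int p) ` ?B"
    by (auto simp: cohomology_class_def r_coset_def cochain_group_def)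
  have one: "\<one>\<^bsub>cohomology p G T 2\<^esub> = ?B"
    by (simp add: cohomology_def)
  have zero: "?d (\<lambda>_. 0) \<in> ?B"
    using p_pos by (subst coboundaries_2) (force intro!: exI[of _ "\<lambda>_. 0"])
  \<comment> \<open>Linearity of the coboundary, with a reduction modulo \<open>p\<close> after
    every operation since cochains take least residues as values.\<close>
  have add: "(\<lambda>x\<in>?X. (?d s x + k * ?d u x) mod int p) = ?d (\<lambda>x. (s x + k * u x) mod int p)" 
    for s u k
  proof (intro restrict_ext)
    fix x assume "x \<in> ?X"
    have "((a - b + c) mod int p + k * ((a' - b' + c') mod int p)) mod int p =
      ((a + k * a') mod int p - (b + k * b') mod int p + (c + k * c') mod int p) mod int p" 
      for a b c a' b' c' :: int
    proof -
      have r: "(x + k * (y mod int p)) mod int p = (x + k * y) mod int p" for x y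
        by (metis mod_add_right_eq mod_mult_right_eq)
      have "((a - b + c) mod int p + k * ((a' - b' + c') mod int p)) mod int p =
          ((a - b + c) + k * (a' - b' + c')) mod int p"
        by (simp only: r mod_add_left_eq)
      also have "(a - b + c) + k * (a' - b' + c') = (a + k * a') - (b + k * b') + (c + k * c')"
        by (simp add: algebra_simps)
      also have "\<dots> mod int p = ((a + k * a') mod int p - (b + k * b') mod int p +
          (c + k * c') mod int p) mod int p"
      proof -
        have "(X - Y + Z) mod n = (X mod n - Y mod n + Z mod n) mod n" for X Y Z n :: int
        proof -
          have "(X - Y + Z) mod n = ((X - Y) mod n + Z mod n) mod n"
            by (simp only: mod_add_eq)
          also have "(X - Y) mod n = (X mod n - Y mod n) mod n"
            by (simp only: mod_diff_eq)
          finally show ?thesis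
            by (simp only: mod_add_left_eq)
        qed
        then show ?thesis .
      qed
      finally show ?thesis .
    qed
    with \<open>x \<in> ?X\<close> show "(?d s x + k * ?d u x) mod int p =
        ((s (x 1) + k * u (x 1)) mod int p - (s (x 0 \<otimes> x 1) + k * u (x 0 \<otimes> x 1)) mod int p +
          (s (x 0) + k * u (x 0)) mod int p) mod int p"
      by simp
  qed
  show ?thesis
  proof
    assume "cohomology_class p G T 2 c = \<one>\<^bsub>cohomology p G T 2\<^esub>"
    then have "(\<lambda>x\<in>?X. (?d (\<lambda>_. 0) x + c x) mod int p) \<in> ?B"
      using zero cl one by blast
    also have "(\<lambda>x\<in>?X. (?d (\<lambda>_. 0) x + c x) mod int p) = c"
      unfolding c by (intro restrict_ext) simp
    finally show "c \<in> ?B" .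
  next
    assume "c \<in> ?B"
    then obtain u where u: "?C u" and cu: "c = ?d u"
      using coboundaries_2 by blast
    have "(\<lambda>x\<in>?X. (b x + c x) mod int p) \<in> ?B" if b: "b \<in> ?B" for b
    proof -
      obtain s where s: "?C s" "b = ?d s"
        using b coboundaries_2 by blast
      have "(\<lambda>x\<in>?X. (b x + c x) mod int p) = ?d (\<lambda>x. (s x + 1 * u x) mod int p)"
        using add[of s 1 u] unfolding cu s(2) by (simp only: mult_1)
      then show ?thesis
        using continuous_map_mod_add_mult[OF s(1) u, of 1] coboundaries_2 by blast
    qed
    moreover have "b \<in> (\<lambda>b. \<lambda>x\<in>?X. (b x + c x) mod int p) ` ?B" if b: "b \<in> ?B" for b
    proof -
      obtain s where s: "?C s" "b = ?d s"
        using b coboundaries_2 by blast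
      \<comment> \<open>Translation by \<open>c = ?d u\<close> reaches \<open>?d s\<close> from the
        coboundary of \<open>s - u\<close>.\<close>
      let ?s = "\<lambda>x. (s x + (-1) * u x) mod int p"
      have "?d ?s \<in> ?B"
        using continuous_map_mod_add_mult[OF s(1) u, of "-1"] coboundaries_2 by blast
      moreover have "b = (\<lambda>x\<in>?X. (?d ?s x + c x) mod int p)"
      proof
        fix x
        show "b x = (\<lambda>x\<in>?X. (?d ?s x + c x) mod int p) x"
        proof (cases "x \<in> ?X")
          case True
          have "?d ?s x = (?d s x + (-1) * ?d u x) mod int p"
            using fun_cong[OF add[of s "-1" u], of x] True by simp
          then have "(?d ?s x + c x) mod int p = (?d s x + (-1) * ?d u x + ?d u x) mod int p"
            unfolding cu by (simp only: mod_add_left_eq)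
          with True show ?thesis
            unfolding s(2) by simp
        qed (simp add: s(2))
      qed
      ultimately show ?thesis by blast
    qed
    ultimately have "(\<lambda>b. \<lambda>x\<in>?X. (b x + c x) mod int p) ` ?B = ?B"
      by blast
    then show "cohomology_class p G T 2 c = \<one>\<^bsub>cohomology p G T 2\<^esub>"
      by (simp add: cl one)
  qed
qed

lemma cup_eq_one_iff:
  "cup p G T 1 1 {lift1 T \<xi>} {lift1 T \<beta>} = \<one>\<^bsub>cohomology p G T 2\<^esub> \<longleftrightarrow> cup_vanishes p G T \<xi> \<beta>"
proof -
  have "cup p G T 1 1 {lift1 T \<xi>} {lift1 T \<beta>} = \<one>\<^bsub>cohomology p G T 2\<^esub> \<longleftrightarrow>
    (\<lambda>x\<in>topspace (power_top T 2). (\<xi> (x 0) * \<beta> (x 1)) mod int p) \<in> coboundaries p G T 2"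
    unfolding cup_def using cochain_cup_lift1[of \<xi> \<beta>] 
    by (simp add: cohomology_class_2_trivial_iff[OF refl, of "\<lambda>a b. \<xi> a * \<beta> b"] one_add_one del: One_nat_def)
  also have "\<dots> \<longleftrightarrow> cup_vanishes p G T \<xi> \<beta>"
    unfolding coboundaries_2 cup_vanishes_def
    by (simp only: restrict_pairs_eq_iff[of "\<lambda>a b. (\<xi> a * \<beta> b) mod int p"
          "\<lambda>a b. (_ b - _ (a \<otimes> b) + _ a) mod int p"])
  finally show ?thesis .
qed

lemma cup_radical_eq:
  "cup_radical p G T =
    (\<lambda>\<xi>. {lift1 T \<xi>}) ` {\<xi> \<in> characters p G T. \<forall>\<beta>\<in>characters p G T. cup_vanishes p G T \<xi> \<beta>}"
  unfolding cup_radical_def carrier_cohomology_1 using cup_eq_one_iff by auto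

lemma cup_vanishes_zero: "cup_vanishes p G T (\<lambda>_. 0) \<beta>"
  unfolding cup_vanishes_def using p_pos by (intro exI[of _ "\<lambda>_. 0"]) auto

text \<open>Both the hypothesis on the factors and the goal for \<open>G\<close> are used in this
  form, which mentions only functions on groups.\<close>

lemma cup_radical_trivial_iff:
  "cup_radical p G T = {\<one>\<^bsub>cohomology p G T 1\<^esub>} \<longleftrightarrow>
    (\<forall>\<xi>\<in>characters p G T. (\<forall>\<beta>\<in>characters p G T. cup_vanishes p G T \<xi> \<beta>) \<longrightarrow>
       (\<forall>x\<in>carrier G. \<xi> x = 0))"
proof -
  let ?S = "{\<xi> \<in> characters p G T. \<forall>\<beta>\<in>characters p G T. cup_vanishes p G T \<xi> \<beta>}"
  have *: "{lift1 T \<xi>} = {lift1 T (\<lambda>_. 0)} \<longleftrightarrow> (\<forall>x\<in>carrier G. \<xi> x = 0)" for \<xi>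
    using lift1_eqD[where T = T and s = \<xi> and s' = "\<lambda>_. 0"] lift1_cong[of T \<xi> "\<lambda>_. 0"]
    unfolding topspace_eq by blast
  \<comment> \<open>Zero always lies in the radical, so equality with the singleton reduces to an
    inclusion.\<close>
  have "{lift1 T (\<lambda>_. 0)} \<in> cup_radical p G T"
    unfolding cup_radical_eq using zero_character cup_vanishes_zero by blast
  then have "cup_radical p G T = {{lift1 T (\<lambda>_. 0)}} \<longleftrightarrow>
      (\<forall>\<xi>\<in>?S. {lift1 T \<xi>} = {lift1 T (\<lambda>_. 0)})"
    unfolding cup_radical_eq by (intro iffI ballI subset_antisym) (blast, auto)
  then show ?thesis
    unfolding one_cohomology_1 * by blast
qed

end

section \<open>Induced maps and corestriction of characters\<close>

lemma induced_lift1: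
  assumes "p > 0" "\<And>x. x \<in> topspace T \<Longrightarrow> \<phi> x \<in> topspace T'"
    and "\<And>y. y \<in> topspace T' \<Longrightarrow> s y \<in> {0..<int p}"
  shows "induced p G T 1 \<phi> {lift1 T' s} = {lift1 T (s \<circ> \<phi>)}"
proof -
  have "(\<lambda>x\<in>topspace (power_top T 1). lift1 T' s (\<lambda>i\<in>{..<1}. \<phi> (x i))) = lift1 T (s \<circ> \<phi>)"
    unfolding lift1_def[of T]
    using assms(2) by (intro restrict_ext, subst lift1_eval) (auto simp: topspace_power_top PiE_iff)
  then show ?thesis
    unfolding induced_def using assms by (simp add: cohomology_class_1 del: One_nat_def)
qed

text \<open>The zero class of \<open>U\<close> corestricts to zero. The zero cochain of
  \<open>U\<close> is known to vanish only on \<open>U\<close>, so the work is to show that the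
  arguments at which the transfer formula evaluates it lie in \<open>U\<close>.\<close>

lemma (in cohomology_setting) Kijima_Nishi_if_cup_radical_trivial:
  assumes "cup_radical p G T = {\<one>\<^bsub>cohomology p G T 1\<^esub>}"
  shows "Kijima_Nishi p G T"
  unfolding Kijima_Nishi_def
proof (intro allI impI ballI)
  fix U \<alpha> assume U: "U \<lhd> G \<and> openin T U \<and> card (rcosets U) = p" and "\<alpha> \<in> cup_radical p G T"
  then have \<alpha>: "\<alpha> = {lift1 T (\<lambda>_. 0)}"
    using assms one_cohomology_1 by auto
  have sub: "subgroup U G"
    using U normal_imp_subgroup by blast
  let ?GU = "G\<lparr>carrier := U\<rparr>" and ?TU = "subtopology T U"
  interpret U: cohomology_setting ?GU ?TU p
    using sub p_pos topspace_eq
    by (auto simp: cohomology_setting_def cohomology_setting_axioms_def subgroup.subgroup_is_group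
        is_group topspace_subtopology dest: subgroup.subset)
  have "{lift1 ?TU (\<lambda>_. 0)} \<in> cup_radical p ?GU ?TU"
    unfolding U.cup_radical_eq using U.zero_character U.cup_vanishes_zero by blast
  moreover have "corestriction p G T U 1 {lift1 ?TU (\<lambda>_. 0)} = \<alpha>"
  proof -
    have 0: "lift1 ?TU (\<lambda>_. 0) (\<lambda>i\<in>{..<1}. coset_rep (c #> partial_prod G x i) \<otimes> x i
                \<otimes> inv coset_rep (c #> partial_prod G x (Suc i))) = 0"
      if c: "c \<in> rcosets U" and x: "x \<in> topspace (power_top T 1)" for c x
    proof -
      have x0: "x 0 \<in> carrier G"
        using x by (auto simp: topspace_power_top PiE_iff topspace_eq)
      obtain a where a: "a \<in> carrier G" "c = U #> a"
        using c unfolding RCOSETS_def by blast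
      have rep: "coset_rep (U #> g) \<in> U #> g" if "g \<in> carrier G" for g
        unfolding coset_rep_def using rcos_self[OF that sub] by (rule someI)
      have "c #> \<one> = U #> a" "c #> (\<one> \<otimes> x 0) = U #> (a \<otimes> x 0)"
        unfolding a(2) using coset_mult_assoc[OF subgroup.subset[OF sub] a(1), of \<one>]
          coset_mult_assoc[OF subgroup.subset[OF sub] a(1), of "\<one> \<otimes> x 0"] a(1) x0
        by auto
      then have "coset_rep (c #> \<one>) \<in> U #> a" "coset_rep (c #> (\<one> \<otimes> x 0)) \<in> U #> (a \<otimes> x 0)"
        using rep a x0 by simp_all
      \<comment> \<open>Whatever \<open>coset_rep\<close> chooses in the cosets of \<open>a\<close>
        and \<open>a \<otimes> x 0\<close>, the argument of the cochain becomes
        \<open>u \<otimes> inv v\<close>.\<close>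
      then obtain u v where uv: "u \<in> U" "v \<in> U" "coset_rep (c #> \<one>) = u \<otimes> a"
          "coset_rep (c #> (\<one> \<otimes> x 0)) = v \<otimes> (a \<otimes> x 0)"
        unfolding r_coset_def by blast
      have uvG: "u \<in> carrier G" "v \<in> carrier G"
        using uv sub subgroup.mem_carrier by fast+
      have "u \<otimes> a \<otimes> x 0 \<otimes> inv (v \<otimes> (a \<otimes> x 0)) = u \<otimes> inv v"
        using uvG a(1) x0 inv_solve_right'[of "u \<otimes> inv v" "u \<otimes> a \<otimes> x 0" "v \<otimes> (a \<otimes> x 0)"]
        by (simp add: m_assoc inv_mult_group) (simp flip: m_assoc)
      moreover have "u \<otimes> inv v \<in> U"
        using uv sub by (simp add: subgroup.m_closed subgroup.m_inv_closed)
      ultimately show ?thesis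
        using uv topspace_eq uvG
        by (subst lift1_eval) (auto simp: topspace_subtopology)
    qed
    have "cochain_cor p G T U 1 (lift1 ?TU (\<lambda>_. 0)) = lift1 T (\<lambda>_. 0)"
      unfolding cochain_cor_def lift1_def[of T]
      by (intro restrict_ext) (simp add: 0 cong: sum.cong del: One_nat_def partial_prod.simps)
    then show ?thesis
      unfolding corestriction_def \<alpha> using p_pos 
      by (simp add: cohomology_class_1 del: One_nat_def)
  qed
  ultimately show "\<exists>\<beta>\<in>cup_radical p ?GU ?TU. corestriction p G T U 1 \<beta> = \<alpha>"
    by blast
qed

section \<open>Characters of pro-p groups\<close>

text \<open>If \<open>M' = x M x\<inverse>\<close> differs from \<open>M\<close>, counting shows that \<open>M'\<close> meets every coset of \<open>M\<close>,
  in particular \<open>M x\<inverse>\<close>; but then \<open>x \<in> M\<close>.\<close>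

lemma (in group) prime_index_subgroup_normal:
  assumes p: "prime p" and fin: "finite (carrier G)" and ord: "Coset.order G = p ^ Suc n"
    and M: "subgroup M G" and cardM: "card M = p ^ n"
  shows "M \<lhd> G"
proof -
  have p0: "p > 0" using p prime_gt_0_nat by blast
  have MG: "M \<subseteq> carrier G" using M subgroup.subset by blast
  have index: "card (rcosets M) = p"
    using lagrange[OF M] cardM ord p0 by simp
  have "x \<otimes> h \<otimes> inv x \<in> M" if x: "x \<in> carrier G" and h: "h \<in> M" for x h
  proof (rule ccontr)
    assume notin: "x \<otimes> h \<otimes> inv x \<notin> M"
    define M' where "M' = (\<lambda>h. x \<otimes> h \<otimes> inv x) ` M"
    have M'G: "M' \<subseteq> carrier G" using x MG by (auto simp: M'_def)
    have M': "subgroup M' G"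
    proof (rule subgroupI)
      show "M' \<subseteq> carrier G" "M' \<noteq> {}"
        using M'G h by (auto simp: M'_def)
      fix a assume "a \<in> M'"
      then obtain u where u: "u \<in> M" "a = x \<otimes> u \<otimes> inv x" by (auto simp: M'_def)
      have uG: "u \<in> carrier G" using u MG by blast
      have "inv a = x \<otimes> inv u \<otimes> inv x"
        using u uG x by (simp add: inv_mult_group m_assoc)
      then show "inv a \<in> M'"
        using u M by (auto simp: M'_def subgroup.m_inv_closed)
      fix b assume "b \<in> M'"
      then obtain v where v: "v \<in> M" "b = x \<otimes> v \<otimes> inv x" by (auto simp: M'_def)
      have vG: "v \<in> carrier G" using v MG by blast
      have "a \<otimes> b = x \<otimes> u \<otimes> (inv x \<otimes> x) \<otimes> v \<otimes> inv x"
        unfolding u v using uG vG x by (simp only: m_assoc m_closed inv_closed)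
      also have "\<dots> = x \<otimes> (u \<otimes> v) \<otimes> inv x"
        using uG vG x by (simp add: m_assoc)
      finally show "a \<otimes> b \<in> M'"
        using u v M by (auto simp: M'_def subgroup.m_closed)
    qed
    interpret M': group "G\<lparr>carrier := M'\<rparr>"
      using M' subgroup.subgroup_is_group is_group by blast
    have "inj_on (\<lambda>h. x \<otimes> h \<otimes> inv x) M"
      using x MG by (auto simp: inj_on_def subset_iff)
    then have cardM': "card M' = p ^ n"
      using cardM by (simp add: M'_def card_image)
    define I where "I = M \<inter> M'"
    have IG: "subgroup I G"
      unfolding I_def using M M' by (rule subgroups_Inter_pair)
    then have I: "subgroup I (G\<lparr>carrier := M'\<rparr>)"
      using subgroup_incl[OF IG M'] by (simp add: I_def)
    have prodI: "card (rcosets\<^bsub>G\<lparr>carrier := M'\<rparr>\<^esub> I) * card I = p ^ n"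
      using M'.lagrange[OF I] cardM' by (simp add: Coset.order_def)
    then obtain k where k: "card (rcosets\<^bsub>G\<lparr>carrier := M'\<rparr>\<^esub> I) = p ^ k"
      using p divides_primepow_nat by (metis dvd_triv_left)
    \<comment> \<open>Otherwise \<open>M'\<close> would be contained in \<open>M\<close>, against
      the choice of \<open>x\<close> and \<open>h\<close>.\<close>
    have "k \<noteq> 0"
    proof
      assume "k = 0"
      then have "card I = card M'" using prodI k cardM' by simp
      moreover have "finite M'" using M'G fin finite_subset by blast
      ultimately have "I = M'" unfolding I_def by (intro card_subset_eq) auto
      then show False using notin h by (auto simp: I_def M'_def)
    qed
    then have ge: "p \<le> card (rcosets\<^bsub>G\<lparr>carrier := M'\<rparr>\<^esub> I)"
      using k p0 by (simp add: self_le_power Suc_leI)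
    define C where "C = (\<lambda>a. M #> a) ` M'"
    have finR: "finite (rcosets M)" using fin MG by (simp add: RCOSETS_def)
    have CR: "C \<subseteq> rcosets M" using M'G by (auto simp: C_def RCOSETS_def)
    \<comment> \<open>Each coset of \<open>M \<inter> M'\<close> in \<open>M'\<close> is the trace
      on \<open>M'\<close> of a coset of \<open>M\<close>. So at least \<open>p\<close> cosets of
      \<open>M\<close> meet \<open>M'\<close>, and there are only \<open>p\<close> of them.\<close>
    have "card (rcosets\<^bsub>G\<lparr>carrier := M'\<rparr>\<^esub> I) \<le> card C"
    proof (rule surj_card_le)
      show "finite C" using finR CR finite_subset by blast
      show "rcosets\<^bsub>G\<lparr>carrier := M'\<rparr>\<^esub> I \<subseteq> (\<lambda>K. K \<inter> M') ` C"
      proof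
        fix K assume "K \<in> rcosets\<^bsub>G\<lparr>carrier := M'\<rparr>\<^esub> I"
        then obtain a where a: "a \<in> M'" "K = (\<Union>i\<in>I. {i \<otimes> a})"
          by (auto simp: RCOSETS_def r_coset_def)
        have aG: "a \<in> carrier G" using a M'G by blast
        have "K = (M #> a) \<inter> M'"
        proof (intro subset_antisym subsetI)
          fix z assume "z \<in> K"
          then show "z \<in> (M #> a) \<inter> M'"
            using a M' by (auto simp: I_def r_coset_def subgroup.m_closed)
        next
          fix z assume z: "z \<in> (M #> a) \<inter> M'"
          then obtain m where m: "m \<in> M" "z = m \<otimes> a" by (auto simp: r_coset_def)
          then have "m = z \<otimes> inv a" using aG MG by (auto simp: m_assoc)
          then have "m \<in> M'" using z a M' by (simp add: subgroup.m_closed subgroup.m_inv_closed)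
          then show "z \<in> K" using a m by (auto simp: I_def)
        qed
        then show "K \<in> (\<lambda>K. K \<inter> M') ` C" using a by (auto simp: C_def)
      qed
    qed
    then have "C = rcosets M"
      using ge index finR CR by (metis card_seteq order_trans)
    moreover have "M #> inv x \<in> rcosets M" using x by (auto simp: RCOSETS_def)
    ultimately obtain h' where h': "h' \<in> M" "M #> inv x = M #> (x \<otimes> h' \<otimes> inv x)"
      by (auto simp: C_def M'_def)
    have h'G: "h' \<in> carrier G" using h' MG by blast
    have "inv x \<in> M #> (x \<otimes> h' \<otimes> inv x)"
      using rcos_self[of "inv x" M] x M h' by simp
    then obtain m where m: "m \<in> M" "inv x = m \<otimes> (x \<otimes> h' \<otimes> inv x)"
      by (auto simp: r_coset_def)
    have mG: "m \<in> carrier G" using m MG by blast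
    \<comment> \<open>The factor \<open>\<one>\<close> on the right lets \<open>inv x\<close> be
      cancelled; what remains, \<open>m \<otimes> x \<otimes> h' = \<one>\<close>, puts
      \<open>x\<close> into \<open>M\<close>.\<close>
    have "m \<otimes> x \<otimes> h' \<otimes> inv x = \<one> \<otimes> inv x"
      using m(2) mG h'G x by (simp add: m_assoc)
    then have "m \<otimes> x \<otimes> h' = \<one>"
      using mG h'G x right_cancel by (metis inv_closed m_closed one_closed)
    then have "x = inv m \<otimes> inv h'"
      using mG h'G x by (metis inv_equality inv_inv inv_mult_group inv_closed m_assoc m_closed inv_solve_left' r_one)
    then have "x \<in> M"
      using m h' M by (simp add: subgroup.m_closed subgroup.m_inv_closed)
    then show False using notin h M by (simp add: subgroup.m_closed subgroup.m_inv_closed)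
  qed
  then show ?thesis
    using M normal_inv_iff by blast
qed


text \<open>The quotient by a normal subgroup of index \<open>p\<close> is generated by any of its
  elements \<open>q \<noteq> 1\<close>, since the order of \<open>q\<close> divides
  \<open>p\<close>. The character is the projection followed by the inverse of the isomorphism that
  sends \<open>i\<close> to the \<open>i\<close>-th power of \<open>q\<close>.\<close>

lemma finite_p_group_nontrivial_character:
  assumes p: "prime p" and P: "group P" and fin: "finite (carrier P)"
    and ord: "Coset.order P = p ^ m" and nontriv: "carrier P \<noteq> {\<one>\<^bsub>P\<^esub>}"
  obtains \<psi> where "\<psi> \<in> hom P (integer_mod_group p)" "\<exists>x\<in>carrier P. \<psi> x \<noteq> 0"
proof -
  interpret P: group P by fact
  have p0: "p > 0" using p prime_gt_0_nat by blast
  have "m \<noteq> 0"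
  proof
    assume "m = 0"
    then have "card (carrier P) = 1" using ord by (simp add: Coset.order_def)
    then show False using nontriv P.one_closed by (metis card_1_singletonE singletonD)
  qed
  then obtain n where m: "m = Suc n" using not0_implies_Suc by blast
  \<comment> \<open>Sylow's theorem is applied with the order split as \<open>p ^ n * p\<close>,
    that is, with cofactor \<open>p\<close>; this gives index \<open>p\<close> instead of the whole
    group.\<close>
  obtain M where M: "subgroup M P" "card M = p ^ n"
    using sylow_thm[OF p P _ fin, of n p] ord m by auto
  have "M \<lhd> P"
    using P.prime_index_subgroup_normal[OF p fin _ M] ord m by simp
  interpret M: normal M P by fact
  interpret Q: group "P Mod M" by (rule M.factorgroup_is_group)
  have "card (rcosets\<^bsub>P\<^esub> M) * p ^ n = p * p ^ n"
    using P.lagrange[OF M(1)] M(2) ord m by simp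
  then have ordQ: "Coset.order (P Mod M) = p"
    using p0 by (simp add: Coset.order_def FactGroup_def)
  then have finQ: "finite (carrier (P Mod M))"
    using p0 by (intro card_ge_0_finite) (simp add: Coset.order_def)
  have "carrier (P Mod M) \<noteq> {\<one>\<^bsub>P Mod M\<^esub>}"
    using ordQ p not_prime_1 by (auto simp: Coset.order_def simp del: one_FactGroup)
  then obtain q where q: "q \<in> carrier (P Mod M)" "q \<noteq> \<one>\<^bsub>P Mod M\<^esub>"
    using Q.one_closed by blast
  have "group.ord (P Mod M) q dvd p"
    using Q.ord_dvd_group_order[OF q(1)] ordQ by simp
  moreover have "group.ord (P Mod M) q \<noteq> 1"
    using q Q.ord_eq_1 by blast
  ultimately have ordq: "group.ord (P Mod M) q = p"
    using p prime_nat_iff by blast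
  let ?Z = "integer_mod_group p" and ?pow = "\<lambda>i::int. q [^]\<^bsub>P Mod M\<^esub> i"
  have Z: "carrier ?Z = {0..<int p}"
    using p0 by (simp add: carrier_integer_mod_group)
  have "?pow \<in> iso ?Z (P Mod M)"
  proof (rule isoI)
    show "?pow \<in> hom ?Z (P Mod M)"
    proof (rule homI)
      fix i j :: int
      have "?pow ((i + j) mod int p) = ?pow (i + j)"
        using Q.int_pow_eq[OF q(1)] ordq by (simp add: mod_eq_dvd_iff[symmetric])
      then show "?pow (i \<otimes>\<^bsub>?Z\<^esub> j) = ?pow i \<otimes>\<^bsub>P Mod M\<^esub> ?pow j"
        using q(1) by (simp add: Q.int_pow_mult del: mult_FactGroup)
    qed (use q(1) in simp)
    have "inj_on ?pow (carrier ?Z)"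
    proof (rule inj_onI)
      fix i j assume ij: "i \<in> carrier ?Z" "j \<in> carrier ?Z" "?pow i = ?pow j"
      then have "j mod int p = i mod int p"
        using Q.int_pow_eq[OF q(1)] ordq by (simp add: mod_eq_dvd_iff)
      with ij(1,2) show "i = j" by (simp add: Z)
    qed
    moreover have "?pow ` carrier ?Z \<subseteq> carrier (P Mod M)"
      using q(1) by auto
    ultimately show "bij_betw ?pow (carrier ?Z) (carrier (P Mod M))"
      using finQ ordQ Z by (simp add: bij_betw_def Coset.order_def card_image card_subset_eq)
  qed
  then obtain \<theta> where \<theta>: "\<theta> \<in> iso (P Mod M) ?Z"
    using group.iso_set_sym[OF group_integer_mod_group] by blast
  define \<psi> where "\<psi> = \<theta> \<circ> (\<lambda>x. M #>\<^bsub>P\<^esub> x)"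
  have \<psi>: "\<psi> \<in> hom P (integer_mod_group p)"
    unfolding \<psi>_def using M.r_coset_hom_Mod \<theta> by (auto intro: hom_compose iso_imp_homomorphism)
  have "\<psi> ` carrier P = carrier (integer_mod_group p)"
    using \<theta> unfolding \<psi>_def image_comp[symmetric] carrier_FactGroup[symmetric]
    by (simp add: iso_def bij_betw_def)
  moreover have "1 \<in> carrier (integer_mod_group p)"
    using p prime_gt_1_nat by (auto simp: carrier_integer_mod_group)
  ultimately have "\<exists>x\<in>carrier P. \<psi> x \<noteq> 0"
    by (metis imageE zero_neq_one)
  with \<psi> that show thesis by blast
qed


section \<open>Open normal subgroups and characters of subgroups of pro-p groups\<close>

lemma continuous_map_to_discreteI:
  assumes "\<And>x. x \<in> topspace X \<Longrightarrow> f x \<in> A"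
    and "\<And>x. x \<in> topspace X \<Longrightarrow> \<exists>N. openin X N \<and> x \<in> N \<and> (\<forall>y\<in>N. f y = f x)"
  shows "continuous_map X (discrete_topology A) f"
  unfolding continuous_map_def
proof (intro conjI allI impI)
  fix B
  show "openin X {x \<in> topspace X. f x \<in> B}"
  proof (subst openin_subopen, clarify)
    fix x assume "x \<in> topspace X" "f x \<in> B"
    then obtain N where N: "openin X N" "x \<in> N" "\<forall>y\<in>N. f y = f x"
      using assms(2) by blast
    have "N \<subseteq> topspace X" using N(1) by (rule openin_subset)
    then have "N \<subseteq> {x \<in> topspace X. f x \<in> B}"
      using N(3) \<open>f x \<in> B\<close> by auto
    then show "\<exists>N. openin X N \<and> x \<in> N \<and> N \<subseteq> {x \<in> topspace X. f x \<in> B}"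
      using N(1,2) by blast
  qed
qed (use assms(1) in auto)

text \<open>\<open>N\<close> is the normal core of \<open>U\<close>. Its complement is the second
  projection of the closed set of pairs \<open>(x, g)\<close> whose conjugate of \<open>g\<close> by
  \<open>x\<close> lies outside \<open>U\<close>, and projecting along a compact factor is a closed
  map.\<close>

lemma open_subgroup_contains_open_normal:
  assumes G: "topological_group G T" and comp: "compact_space T"
    and U: "subgroup U G" "openin T U"
  obtains N where "N \<lhd> G" "openin T N" "N \<subseteq> U"
proof -
  interpret group G using G by (simp add: topological_group_def)
  have top: "topspace T = carrier G"
    and mult: "continuous_map (prod_topology T T) T (\<lambda>(x, y). x \<otimes>\<^bsub>G\<^esub> y)"
    and inv: "continuous_map T T (\<lambda>x. inv\<^bsub>G\<^esub> x)"
    using G by (auto simp: topological_group_def)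
  define N where "N = {g \<in> carrier G. \<forall>x\<in>carrier G. x \<otimes>\<^bsub>G\<^esub> g \<otimes>\<^bsub>G\<^esub> inv\<^bsub>G\<^esub> x \<in> U}"
  let ?c = "\<lambda>(x, g). x \<otimes>\<^bsub>G\<^esub> g \<otimes>\<^bsub>G\<^esub> inv\<^bsub>G\<^esub> x"
  have "continuous_map (prod_topology T T) T ((\<lambda>x. inv\<^bsub>G\<^esub> x) \<circ> fst)"
    using continuous_map_fst inv by (rule continuous_map_compose)
  then have "continuous_map (prod_topology T T) (prod_topology T T)
      (\<lambda>z. ((\<lambda>(x, y). x \<otimes>\<^bsub>G\<^esub> y) z, ((\<lambda>x. inv\<^bsub>G\<^esub> x) \<circ> fst) z))"
    by (intro continuous_map_pairedI mult)
  from continuous_map_compose[OF this mult]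
  have "continuous_map (prod_topology T T) T ?c"
    by (simp add: o_def case_prod_unfold)
  then have "openin (prod_topology T T) {z \<in> topspace (prod_topology T T). ?c z \<in> U}"
    using U(2) by (rule openin_continuous_map_preimage)
  then have "closedin (prod_topology T T)
      (topspace (prod_topology T T) - {z \<in> topspace (prod_topology T T). ?c z \<in> U})"
    by blast
  then have "closedin T (snd ` (topspace (prod_topology T T) -
      {z \<in> topspace (prod_topology T T). ?c z \<in> U}))"
    using Abstract_Topological_Spaces.closed_map_snd[OF comp] closed_map_def by blast
  moreover have "snd ` (topspace (prod_topology T T) -
      {z \<in> topspace (prod_topology T T). ?c z \<in> U}) = topspace T - N"
  proof (intro subset_antisym subsetI)
    fix g assume g: "g \<in> topspace T - N"
    then obtain x where "x \<in> carrier G" "x \<otimes>\<^bsub>G\<^esub> g \<otimes>\<^bsub>G\<^esub> inv\<^bsub>G\<^esub> x \<notin> U"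
      by (auto simp: N_def top)
    then have "(x, g) \<in> topspace (prod_topology T T) - {z \<in> topspace (prod_topology T T). ?c z \<in> U}"
      using g by (auto simp: top)
    then show "g \<in> snd ` (topspace (prod_topology T T) - {z \<in> topspace (prod_topology T T). ?c z \<in> U})"
      by (rule rev_image_eqI) simp
  qed (auto simp: N_def top)
  moreover have "N \<subseteq> topspace T" by (auto simp: N_def top)
  ultimately have "openin T N"
    by (simp add: openin_closedin_eq)
  moreover have "N \<subseteq> U"
  proof
    fix g assume "g \<in> N"
    then have "g \<in> carrier G" "\<one>\<^bsub>G\<^esub> \<otimes>\<^bsub>G\<^esub> g \<otimes>\<^bsub>G\<^esub> inv\<^bsub>G\<^esub> \<one>\<^bsub>G\<^esub> \<in> U"
      unfolding N_def using one_closed by blast+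
    then show "g \<in> U" by simp
  qed
  moreover have "N \<lhd> G"
    unfolding normal_inv_iff
  proof (intro conjI ballI)
    show "subgroup N G"
    proof (rule subgroupI)
      show "N \<subseteq> carrier G" by (auto simp: N_def)
      show "N \<noteq> {}" using U(1) subgroup.one_closed by (fastforce simp: N_def)
      fix a assume a: "a \<in> N"
      then have aG: "a \<in> carrier G" by (simp add: N_def)
      have "x \<otimes>\<^bsub>G\<^esub> inv\<^bsub>G\<^esub> a \<otimes>\<^bsub>G\<^esub> inv\<^bsub>G\<^esub> x \<in> U" if "x \<in> carrier G" for x
      proof -
        have "x \<otimes>\<^bsub>G\<^esub> inv\<^bsub>G\<^esub> a \<otimes>\<^bsub>G\<^esub> inv\<^bsub>G\<^esub> x = inv\<^bsub>G\<^esub> (x \<otimes>\<^bsub>G\<^esub> a \<otimes>\<^bsub>G\<^esub> inv\<^bsub>G\<^esub> x)"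
          using that aG by (simp add: inv_mult_group m_assoc)
        moreover have "x \<otimes>\<^bsub>G\<^esub> a \<otimes>\<^bsub>G\<^esub> inv\<^bsub>G\<^esub> x \<in> U" using a that by (simp add: N_def)
        ultimately show ?thesis using U(1) by (simp add: subgroup.m_inv_closed)
      qed
      then show "inv\<^bsub>G\<^esub> a \<in> N" using aG by (simp add: N_def)
      fix b assume b: "b \<in> N"
      then have bG: "b \<in> carrier G" by (simp add: N_def)
      have "x \<otimes>\<^bsub>G\<^esub> (a \<otimes>\<^bsub>G\<^esub> b) \<otimes>\<^bsub>G\<^esub> inv\<^bsub>G\<^esub> x \<in> U" if "x \<in> carrier G" for x
      proof -
        have "(x \<otimes>\<^bsub>G\<^esub> a \<otimes>\<^bsub>G\<^esub> inv\<^bsub>G\<^esub> x) \<otimes>\<^bsub>G\<^esub> (x \<otimes>\<^bsub>G\<^esub> b \<otimes>\<^bsub>G\<^esub> inv\<^bsub>G\<^esub> x) =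
            x \<otimes>\<^bsub>G\<^esub> a \<otimes>\<^bsub>G\<^esub> (inv\<^bsub>G\<^esub> x \<otimes>\<^bsub>G\<^esub> x) \<otimes>\<^bsub>G\<^esub> b \<otimes>\<^bsub>G\<^esub> inv\<^bsub>G\<^esub> x"
          using that aG bG by (simp only: m_assoc m_closed inv_closed)
        also have "\<dots> = x \<otimes>\<^bsub>G\<^esub> (a \<otimes>\<^bsub>G\<^esub> b) \<otimes>\<^bsub>G\<^esub> inv\<^bsub>G\<^esub> x"
          using that aG bG by (simp add: m_assoc)
        finally have "x \<otimes>\<^bsub>G\<^esub> (a \<otimes>\<^bsub>G\<^esub> b) \<otimes>\<^bsub>G\<^esub> inv\<^bsub>G\<^esub> x =
            (x \<otimes>\<^bsub>G\<^esub> a \<otimes>\<^bsub>G\<^esub> inv\<^bsub>G\<^esub> x) \<otimes>\<^bsub>G\<^esub> (x \<otimes>\<^bsub>G\<^esub> b \<otimes>\<^bsub>G\<^esub> inv\<^bsub>G\<^esub> x)" ..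
        moreover have "\<dots> \<in> U"
          using a b that by (simp add: N_def subgroup.m_closed[OF U(1)] del: m_assoc)
        ultimately show ?thesis by simp
      qed
      then show "a \<otimes>\<^bsub>G\<^esub> b \<in> N" using aG bG by (simp add: N_def)
    qed
    fix y g assume y: "y \<in> carrier G" and g: "g \<in> N"
    then have gG: "g \<in> carrier G" by (simp add: N_def)
    have "x \<otimes>\<^bsub>G\<^esub> (y \<otimes>\<^bsub>G\<^esub> g \<otimes>\<^bsub>G\<^esub> inv\<^bsub>G\<^esub> y) \<otimes>\<^bsub>G\<^esub> inv\<^bsub>G\<^esub> x \<in> U" if x: "x \<in> carrier G" for x
    proof -
      have "x \<otimes>\<^bsub>G\<^esub> (y \<otimes>\<^bsub>G\<^esub> g \<otimes>\<^bsub>G\<^esub> inv\<^bsub>G\<^esub> y) \<otimes>\<^bsub>G\<^esub> inv\<^bsub>G\<^esub> x =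
          (x \<otimes>\<^bsub>G\<^esub> y) \<otimes>\<^bsub>G\<^esub> g \<otimes>\<^bsub>G\<^esub> inv\<^bsub>G\<^esub> (x \<otimes>\<^bsub>G\<^esub> y)"
        using x y gG by (simp add: inv_mult_group m_assoc)
      moreover have "(x \<otimes>\<^bsub>G\<^esub> y) \<otimes>\<^bsub>G\<^esub> g \<otimes>\<^bsub>G\<^esub> inv\<^bsub>G\<^esub> (x \<otimes>\<^bsub>G\<^esub> y) \<in> U"
        using g x y by (simp add: N_def)
      ultimately show ?thesis by simp
    qed
    then show "y \<otimes>\<^bsub>G\<^esub> g \<otimes>\<^bsub>G\<^esub> inv\<^bsub>G\<^esub> y \<in> N"
      using y gG by (simp add: N_def)
  qed
  ultimately show thesis using that by blast
qed

lemma openin_r_coset: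
  assumes G: "topological_group G T" and N: "openin T N" and x: "x \<in> carrier G"
  shows "openin T (N #>\<^bsub>G\<^esub> x)"
proof -
  interpret group G using G by (simp add: topological_group_def)
  have top: "topspace T = carrier G"
    and mult: "continuous_map (prod_topology T T) T (\<lambda>(x, y). x \<otimes>\<^bsub>G\<^esub> y)"
    using G by (auto simp: topological_group_def)
  have NG: "N \<subseteq> carrier G" using N openin_subset top by blast
  have "continuous_map T (prod_topology T T) (\<lambda>y. (y, inv\<^bsub>G\<^esub> x))"
    using x by (simp add: continuous_map_pairedI top)
  from continuous_map_compose[OF this mult]
  have "continuous_map T T (\<lambda>y. y \<otimes>\<^bsub>G\<^esub> inv\<^bsub>G\<^esub> x)" by (simp add: o_def)
  then have "openin T {y \<in> topspace T. y \<otimes>\<^bsub>G\<^esub> inv\<^bsub>G\<^esub> x \<in> N}"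
    using N by (rule openin_continuous_map_preimage)
  moreover have "{y \<in> topspace T. y \<otimes>\<^bsub>G\<^esub> inv\<^bsub>G\<^esub> x \<in> N} = N #>\<^bsub>G\<^esub> x"
  proof (intro subset_antisym subsetI)
    fix y assume y: "y \<in> {y \<in> topspace T. y \<otimes>\<^bsub>G\<^esub> inv\<^bsub>G\<^esub> x \<in> N}"
    then have "y = (y \<otimes>\<^bsub>G\<^esub> inv\<^bsub>G\<^esub> x) \<otimes>\<^bsub>G\<^esub> x" using x top by (simp add: m_assoc)
    then show "y \<in> N #>\<^bsub>G\<^esub> x" using y unfolding r_coset_def by blast
  next
    fix y assume "y \<in> N #>\<^bsub>G\<^esub> x"
    then obtain n where n: "n \<in> N" "y = n \<otimes>\<^bsub>G\<^esub> x" by (auto simp: r_coset_def)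
    then have nG: "n \<in> carrier G" using NG by blast
    then show "y \<in> {y \<in> topspace T. y \<otimes>\<^bsub>G\<^esub> inv\<^bsub>G\<^esub> x \<in> N}"
      using n x by (simp add: top m_assoc)
  qed
  ultimately show ?thesis by simp
qed

text \<open>An open normal \<open>N\<close> that misses some \<open>h \<noteq> 1\<close> of
  \<open>H\<close> gives \<open>H\<close> a nontrivial image in the finite \<open>p\<close>-group
  \<open>G Mod N\<close>, and a nonzero character of that image pulls back to \<open>H\<close>.
  Taking quotients of \<open>G\<close> avoids a separate proof that \<open>H\<close> is
  pro-\<open>p\<close>.\<close>

lemma pro_p_subgroup_nontrivial_character:
  assumes p: "prime p" and G: "pro_p_group p G T" and H: "subgroup H G" and "H \<noteq> {\<one>\<^bsub>G\<^esub>}"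
  obtains \<xi> x where "\<xi> \<in> characters p (G\<lparr>carrier := H\<rparr>) (subtopology T H)" "x \<in> H" "\<xi> x \<noteq> 0"
proof -
  have tg: "topological_group G T" and comp: "compact_space T" and haus: "Hausdorff_space T"
    and loc: "\<And>W. openin T W \<Longrightarrow> \<one>\<^bsub>G\<^esub> \<in> W \<Longrightarrow> \<exists>U. subgroup U G \<and> openin T U \<and> U \<subseteq> W"
    and idx: "\<And>U. U \<lhd> G \<Longrightarrow> openin T U \<Longrightarrow> \<exists>n. card (rcosets\<^bsub>G\<^esub> U) = p ^ n"
    using G by (auto simp: pro_p_group_def profinite_group_def)
  interpret group G using tg by (simp add: topological_group_def)
  have top: "topspace T = carrier G" using tg by (simp add: topological_group_def)
  have p0: "p > 0" using p prime_gt_0_nat by blast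
  have HG: "H \<subseteq> carrier G" using H subgroup.subset by blast
  obtain h where h: "h \<in> H" "h \<noteq> \<one>\<^bsub>G\<^esub>"
    using assms(4) H subgroup.one_closed by blast
  have "closedin T {h}"
    using haus h HG top by (intro closedin_Hausdorff_singleton) auto
  then have "openin T (topspace T - {h})" by blast
  moreover have "\<one>\<^bsub>G\<^esub> \<in> topspace T - {h}" using h top by auto
  ultimately obtain U where U: "subgroup U G" "openin T U" "U \<subseteq> topspace T - {h}"
    using loc by blast
  obtain N where N: "N \<lhd> G" "openin T N" "N \<subseteq> U"
    using open_subgroup_contains_open_normal[OF tg comp U(1,2)] .
  interpret N: normal N G by fact
  interpret Q: group "G Mod N" by (rule N.factorgroup_is_group)
  obtain n where n: "card (rcosets\<^bsub>G\<^esub> N) = p ^ n" using idx N by blast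
  then have ordQ: "Coset.order (G Mod N) = p ^ n"
    by (simp add: Coset.order_def FactGroup_def)
  then have finQ: "finite (carrier (G Mod N))"
    using p0 by (intro card_ge_0_finite) (simp add: Coset.order_def)
  define HQ where "HQ = (\<lambda>x. N #>\<^bsub>G\<^esub> x) ` H"
  have HQ: "subgroup HQ (G Mod N)"
    unfolding HQ_def
    using group_hom.subgroup_img_is_subgroup[of G "G Mod N" "\<lambda>x. N #>\<^bsub>G\<^esub> x" H]
      N.r_coset_hom_Mod H by (simp add: group_hom_def group_hom_axioms_def is_group Q.is_group)
  let ?P = "(G Mod N)\<lparr>carrier := HQ\<rparr>"
  have "card HQ dvd p ^ n"
    using Q.lagrange[OF HQ] ordQ by (metis dvd_triv_right)
  then obtain m where "Coset.order ?P = p ^ m"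
    using p by (auto simp: Coset.order_def divides_primepow_nat)
  moreover have "group ?P"
    using HQ Q.is_group subgroup.subgroup_is_group by blast
  moreover have "finite (carrier ?P)"
    using finQ HQ subgroup.subset finite_subset by fastforce
  moreover have "carrier ?P \<noteq> {\<one>\<^bsub>?P\<^esub>}"
  proof -
    have "h \<in> N #>\<^bsub>G\<^esub> h" using h HG rcos_self N.subgroup_axioms by blast
    moreover have "h \<notin> N" using U(3) N(3) by blast
    ultimately show ?thesis using h by (auto simp: HQ_def)
  qed
  ultimately obtain \<psi> where \<psi>: "\<psi> \<in> hom ?P (integer_mod_group p)" "\<exists>x\<in>carrier ?P. \<psi> x \<noteq> 0"
    using finite_p_group_nontrivial_character[OF p] by metis
  define \<xi> where "\<xi> = (\<lambda>x. \<psi> (N #>\<^bsub>G\<^esub> x))"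
  have topH: "topspace (subtopology T H) = H"
    using HG top by (auto simp: topspace_subtopology)
  have range: "\<xi> x \<in> {0..<int p}" if "x \<in> H" for x
    using hom_in_carrier[OF \<psi>(1)] that p0 by (auto simp: \<xi>_def HQ_def carrier_integer_mod_group)
  have "continuous_map (subtopology T H) (discrete_topology {0..<int p}) \<xi>"
  proof (rule continuous_map_to_discreteI)
    fix x assume "x \<in> topspace (subtopology T H)"
    then have x: "x \<in> H" "x \<in> carrier G" using topH HG by auto
    then show "\<xi> x \<in> {0..<int p}" using range by blast
    have "\<xi> y = \<xi> x" if "y \<in> N #>\<^bsub>G\<^esub> x" for y
      unfolding \<xi>_def using repr_independence[OF that x(2) N.subgroup_axioms] by simp
    moreover have "openin (subtopology T H) (H \<inter> (N #>\<^bsub>G\<^esub> x))"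
      using openin_r_coset[OF tg N(2) x(2)] by (simp add: openin_subtopology_Int2)
    moreover have "x \<in> N #>\<^bsub>G\<^esub> x"
      using rcos_self[OF x(2) N.subgroup_axioms] .
    ultimately show "\<exists>N. openin (subtopology T H) N \<and> x \<in> N \<and> (\<forall>y\<in>N. \<xi> y = \<xi> x)"
      using x by blast
  qed
  moreover have "\<xi> (x \<otimes>\<^bsub>G\<^esub> y) = (\<xi> x + \<xi> y) mod int p" if "x \<in> H" "y \<in> H" for x y
  proof -
    have "N #>\<^bsub>G\<^esub> (x \<otimes>\<^bsub>G\<^esub> y) = (N #>\<^bsub>G\<^esub> x) <#>\<^bsub>G\<^esub> (N #>\<^bsub>G\<^esub> y)"
      using that HG N.rcos_sum by (simp add: subset_iff)
    then show ?thesis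
      using hom_mult[OF \<psi>(1), of "N #>\<^bsub>G\<^esub> x" "N #>\<^bsub>G\<^esub> y"] that by (simp add: \<xi>_def HQ_def)
  qed
  ultimately have "\<xi> \<in> characters p (G\<lparr>carrier := H\<rparr>) (subtopology T H)"
    using p0 topH by (simp add: characters_iff)
  moreover obtain x where "x \<in> H" "\<xi> x \<noteq> 0"
    using \<psi>(2) by (auto simp: \<xi>_def HQ_def)
  ultimately show thesis using that by blast
qed

section \<open>Free pro-p groups\<close>

text \<open>Basic open sets constrain finitely many coordinates, and points are open in each factor.
  Membership in a free pro-\<open>p\<close> group thereby becomes approximability by words on every
  finite set of coordinates.\<close>

lemma in_closure_of_product_discrete:
  assumes S: "S \<subseteq> PiE I D"
  shows "x \<in> product_topology (\<lambda>i. discrete_topology (D i)) I closure_of S \<longleftrightarrow>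
    x \<in> PiE I D \<and> (\<forall>J. finite J \<and> J \<subseteq> I \<longrightarrow> (\<exists>s\<in>S. \<forall>j\<in>J. s j = x j))"
    (is "?L \<longleftrightarrow> ?R")
proof
  let ?X = "product_topology (\<lambda>i. discrete_topology (D i)) I"
  assume L: ?L
  then have x: "x \<in> PiE I D"
    using closure_of_subset_topspace[of ?X S] by auto
  have "\<exists>s\<in>S. \<forall>j\<in>J. s j = x j" if J: "finite J" "J \<subseteq> I" for J
  proof -
    let ?W = "PiE I (\<lambda>i. if i \<in> J then {x i} else D i)"
    have "openin ?X ?W"
      unfolding openin_product_topology_alt
    proof (intro ballI exI conjI)
      fix y assume "y \<in> ?W" then show "y \<in> ?W" .
      show "finite {i \<in> I. (if i \<in> J then {x i} else D i) \<noteq> topspace (discrete_topology (D i))}"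
        by (rule finite_subset[OF _ J(1)]) auto
    qed (use x in \<open>auto simp: PiE_iff\<close>)
    moreover have "x \<in> ?W" using x by (auto simp: PiE_iff)
    ultimately obtain s where s: "s \<in> S" "s \<in> ?W"
      using L unfolding in_closure_of by blast
    have "s j = x j" if j: "j \<in> J" for j
      using PiE_mem[OF s(2), of j] j J(2) by auto
    then show ?thesis using s by blast
  qed
  with x show ?R by blast
next
  assume R: ?R
  show ?L
    unfolding in_closure_of
  proof (intro conjI allI impI)
    show "x \<in> topspace (product_topology (\<lambda>i. discrete_topology (D i)) I)" using R by simp
    fix W assume W: "x \<in> W \<and> openin (product_topology (\<lambda>i. discrete_topology (D i)) I) W"
    then obtain U where U: "finite {i \<in> I. U i \<noteq> D i}" "x \<in> Pi\<^sub>E I U" "Pi\<^sub>E I U \<subseteq> W"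
      unfolding openin_product_topology_alt topspace_discrete_topology by blast
    then obtain s where s: "s \<in> S" "\<forall>j\<in>{i \<in> I. U i \<noteq> D i}. s j = x j"
      using R by (metis (lifting) mem_Collect_eq subsetI)
    have "s \<in> PiE I D" using s S by blast
    have "s i \<in> U i" if "i \<in> I" for i
      using s(2) that PiE_mem[OF U(2) that] PiE_mem[OF \<open>s \<in> PiE I D\<close> that] by (cases "U i = D i") auto
    with \<open>s \<in> PiE I D\<close> have "s \<in> PiE I U" by (auto simp: PiE_iff)
    then show "\<exists>y. y \<in> S \<and> y \<in> W" using s U(3) by blast
  qed
qed

text \<open>The fibre of \<open>g\<close> through \<open>x\<close> is open in \<open>F\<close>, so
  it contains the trace of a basic neighbourhood of \<open>x\<close>, which constrains finitely many
  coordinates.\<close>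

lemma continuous_to_discrete_depends_on_finitely_many:
  assumes g: "continuous_map (subtopology (product_topology (\<lambda>i. discrete_topology (D i)) I) F)
      (discrete_topology A) g"
    and F: "F \<subseteq> PiE I D" and x: "x \<in> F"
  obtains J where "finite J" "J \<subseteq> I" "\<forall>y\<in>F. (\<forall>j\<in>J. y j = x j) \<longrightarrow> g y = g x"
proof -
  let ?X = "product_topology (\<lambda>i. discrete_topology (D i)) I"
  have top: "topspace (subtopology ?X F) = F" using F by auto
  have "openin (discrete_topology A) {g x}"
    using continuous_map_discreteD[OF g] x unfolding top by simp
  then have "openin (subtopology ?X F) {y \<in> F. g y \<in> {g x}}"
    using openin_continuous_map_preimage[OF g] top by metis
  then obtain W where W: "openin ?X W" "{y \<in> F. g y \<in> {g x}} = W \<inter> F"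
    unfolding openin_subtopology by blast
  then have "x \<in> W" using x by blast
  then obtain U where U: "finite {i \<in> I. U i \<noteq> D i}" "x \<in> Pi\<^sub>E I U" "Pi\<^sub>E I U \<subseteq> W"
    using W(1) unfolding openin_product_topology_alt topspace_discrete_topology by blast
  show thesis
  proof (rule that[of "{i \<in> I. U i \<noteq> D i}"]; (intro ballI impI)?)
    fix y assume y: "y \<in> F" "\<forall>j\<in>{i \<in> I. U i \<noteq> D i}. y j = x j"
    have yD: "y \<in> PiE I D" using y F by blast
    have "y i \<in> U i" if "i \<in> I" for i
      using y(2) that PiE_mem[OF U(2) that] PiE_mem[OF yD that] by (cases "U i = D i") auto
    with yD have "y \<in> PiE I U" by (auto simp: PiE_iff)
    then show "g y = g x" using U(3) W(2) y(1) by blast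
  qed (use U in auto)
qed

lemma continuous_hom_compose:
  assumes "\<phi> \<in> continuous_hom G T G' T'" "\<psi> \<in> continuous_hom G' T' G'' T''"
  shows "\<psi> \<circ> \<phi> \<in> continuous_hom G T G'' T''"
  using assms continuous_map_compose[of T T' \<phi> T'' \<psi>] hom_compose[of \<phi> G G' \<psi> G'']
  by (auto simp: continuous_hom_def)

section \<open>The free pro-p group inside its ambient product\<close>

lemma finite_p_mapsD:
  assumes "k \<in> finite_p_maps p V"
  shows "group (fst k)" "finite (carrier (fst k))" "\<exists>n. Coset.order (fst k) = p ^ n"
    "snd k \<in> V \<rightarrow>\<^sub>E carrier (fst k)" "finite {v \<in> V. snd k v \<noteq> \<one>\<^bsub>fst k\<^esub>}"
  using assms by (auto simp: finite_p_maps_def)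

lemma group_ambient: "group (ambient_group p V)"
  unfolding ambient_group_def using finite_p_mapsD by (intro product_group) blast

lemma carrier_ambient: "carrier (ambient_group p V) = (\<Pi>\<^sub>E k\<in>finite_p_maps p V. carrier (fst k))"
  by (simp add: ambient_group_def)

lemma free_gen_ambient: "v \<in> V \<Longrightarrow> free_gen p V v \<in> carrier (ambient_group p V)"
  unfolding carrier_ambient free_gen_def using PiE_mem[OF finite_p_mapsD(4)] by auto

lemma generate_gens_subset:
  "generate (ambient_group p V) (free_gen p V ` V) \<subseteq> (\<Pi>\<^sub>E k\<in>finite_p_maps p V. carrier (fst k))"
  using group.generate_incl[OF group_ambient] free_gen_ambient carrier_ambient by (metis image_subsetI)

lemma in_free_pro_p:
  "x \<in> carrier (free_pro_p p V) \<longleftrightarrow> x \<in> carrier (ambient_group p V) \<and>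
    (\<forall>J. finite J \<and> J \<subseteq> finite_p_maps p V \<longrightarrow>
       (\<exists>s\<in>generate (ambient_group p V) (free_gen p V ` V). \<forall>j\<in>J. s j = x j))"
  unfolding free_pro_p_def ambient_top_def carrier_ambient
  by (simp add: in_closure_of_product_discrete[OF generate_gens_subset])

lemma free_pro_p_approx:
  assumes "x \<in> carrier (free_pro_p p V)" "finite J" "J \<subseteq> finite_p_maps p V"
  obtains s where "s \<in> generate (ambient_group p V) (free_gen p V ` V)" "\<forall>j\<in>J. s j = x j"
proof -
  have "\<forall>J. finite J \<and> J \<subseteq> finite_p_maps p V \<longrightarrow>
      (\<exists>s\<in>generate (ambient_group p V) (free_gen p V ` V). \<forall>j\<in>J. s j = x j)"
    using assms(1) unfolding in_free_pro_p by (rule conjunct2)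
  then have "\<exists>s\<in>generate (ambient_group p V) (free_gen p V ` V). \<forall>j\<in>J. s j = x j"
    using assms(2,3) by simp
  then obtain s where s: "s \<in> generate (ambient_group p V) (free_gen p V ` V)" "\<forall>j\<in>J. s j = x j"
    by (elim bexE)
  then show thesis
    by (rule that)
qed

text \<open>The operations are coordinatewise, so products and inverses of approximations on
  \<open>J\<close> are approximations on \<open>J\<close>.\<close>

lemma subgroup_free_pro_p: "subgroup (carrier (free_pro_p p V)) (ambient_group p V)"
proof -
  interpret A: group "ambient_group p V" by (rule group_ambient)
  let ?S = "generate (ambient_group p V) (free_gen p V ` V)"
  have S: "subgroup ?S (ambient_group p V)"
    by (intro A.generate_is_subgroup image_subsetI free_gen_ambient)
  have SA: "s \<in> carrier (ambient_group p V)" if "s \<in> ?S" for s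
    using that S subgroup.subset by blast
  show ?thesis
  proof (rule A.subgroupI)
    show "carrier (free_pro_p p V) \<subseteq> carrier (ambient_group p V)"
      by (auto simp: in_free_pro_p)
    have "\<one>\<^bsub>ambient_group p V\<^esub> \<in> carrier (free_pro_p p V)"
      unfolding in_free_pro_p using generate.one by (metis A.one_closed)
    then show "carrier (free_pro_p p V) \<noteq> {}" by blast
  next
    fix x assume x: "x \<in> carrier (free_pro_p p V)"
    then have xA: "x \<in> carrier (ambient_group p V)" by (simp add: in_free_pro_p)
    have inv: "(inv\<^bsub>ambient_group p V\<^esub> z) j = inv\<^bsub>fst j\<^esub> z j"
      if "z \<in> carrier (ambient_group p V)" "j \<in> finite_p_maps p V" for z j
      using that unfolding carrier_ambient ambient_group_def
      by (subst inv_product_group) (auto simp: finite_p_mapsD(1))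
    have "\<exists>s\<in>?S. \<forall>j\<in>J. s j = (inv\<^bsub>ambient_group p V\<^esub> x) j"
      if J: "finite J" "J \<subseteq> finite_p_maps p V" for J
    proof -
      obtain s where s: "s \<in> ?S" "\<forall>j\<in>J. s j = x j"
        using free_pro_p_approx[OF x J] .
      have "\<forall>j\<in>J. (inv\<^bsub>ambient_group p V\<^esub> s) j = (inv\<^bsub>ambient_group p V\<^esub> x) j"
        using s(2) inv[OF SA[OF s(1)] subsetD[OF J(2)]] inv[OF xA subsetD[OF J(2)]]
        by (metis (no_types, lifting))
      moreover have "inv\<^bsub>ambient_group p V\<^esub> s \<in> ?S"
        using S s(1) by (rule subgroup.m_inv_closed)
      ultimately show ?thesis by blast
    qed
    then show "inv\<^bsub>ambient_group p V\<^esub> x \<in> carrier (free_pro_p p V)"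
      using xA by (simp add: in_free_pro_p)
    fix y assume y: "y \<in> carrier (free_pro_p p V)"
    then have yA: "y \<in> carrier (ambient_group p V)" by (simp add: in_free_pro_p)
    have "\<exists>s\<in>?S. \<forall>j\<in>J. s j = (x \<otimes>\<^bsub>ambient_group p V\<^esub> y) j"
      if J: "finite J" "J \<subseteq> finite_p_maps p V" for J
    proof -
      obtain s where s: "s \<in> ?S" "\<forall>j\<in>J. s j = x j"
        using free_pro_p_approx[OF x J] .
      obtain t where t: "t \<in> ?S" "\<forall>j\<in>J. t j = y j"
        using free_pro_p_approx[OF y J] .
      have "\<forall>j\<in>J. (s \<otimes>\<^bsub>ambient_group p V\<^esub> t) j = (x \<otimes>\<^bsub>ambient_group p V\<^esub> y) j"
        using s(2) t(2) J by (auto simp: ambient_group_def)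
      moreover have "s \<otimes>\<^bsub>ambient_group p V\<^esub> t \<in> ?S"
        using s(1) t(1) by (rule generate.eng)
      ultimately show ?thesis by blast
    qed
    then show "x \<otimes>\<^bsub>ambient_group p V\<^esub> y \<in> carrier (free_pro_p p V)"
      using xA yA unfolding in_free_pro_p by blast
  qed
qed

lemma free_pro_p_simps [simp]:
  "monoid.mult (free_pro_p p V) = monoid.mult (ambient_group p V)" "one (free_pro_p p V) = one (ambient_group p V)"
  by (simp_all add: free_pro_p_def)

lemma free_pro_p_update:
  "free_pro_p p V = (ambient_group p V)\<lparr>carrier := carrier (free_pro_p p V)\<rparr>"
  by (simp add: free_pro_p_def)

lemma group_free_pro_p: "group (free_pro_p p V)"
  using subgroup.subgroup_is_group[OF subgroup_free_pro_p group_ambient] free_pro_p_update by metis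

lemma free_gen_in: "v \<in> V \<Longrightarrow> free_gen p V v \<in> carrier (free_pro_p p V)"
  unfolding in_free_pro_p using free_gen_ambient generate.incl by (metis imageI)

lemma carrier_free_pro_p_subset:
  "carrier (free_pro_p p V) \<subseteq> (\<Pi>\<^sub>E k\<in>finite_p_maps p V. carrier (fst k))"
  using subgroup.subset[OF subgroup_free_pro_p] carrier_ambient by metis

lemma topspace_free_pro_p: "topspace (free_pro_p_top p V) = carrier (free_pro_p p V)"
  using carrier_free_pro_p_subset by (auto simp: free_pro_p_top_def ambient_top_def)

text \<open>The factors of the ambient product are finite, so Tychonoff applies. Compactness later
  makes the projection of a presentation a quotient map.\<close>

lemma compact_space_free_pro_p: "compact_space (free_pro_p_top p V)"
proof -
  have "compact_space (ambient_top p V)"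
    unfolding ambient_top_def compact_space_product_topology
    using finite_p_mapsD(2) by (auto simp: compact_space_discrete_topology)
  moreover have "closedin (ambient_top p V) (carrier (free_pro_p p V))"
    by (simp add: free_pro_p_def)
  ultimately show ?thesis
    unfolding free_pro_p_top_def compact_space_subtopology
    using closedin_compact_space compact_space_subtopology by blast
qed

lemma free_pro_p_projection:
  assumes "k \<in> finite_p_maps p V"
  shows "(\<lambda>x. x k) \<in> continuous_hom (free_pro_p p V) (free_pro_p_top p V)
    (fst k) (discrete_topology (carrier (fst k)))"
proof -
  have "continuous_map (free_pro_p_top p V) (discrete_topology (carrier (fst k))) (\<lambda>x. x k)"
    unfolding free_pro_p_top_def ambient_top_def
    by (intro continuous_map_from_subtopology continuous_map_product_projection assms)
  moreover have "x k \<in> carrier (fst k)" if "x \<in> carrier (free_pro_p p V)" for x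
    using PiE_mem[OF subsetD[OF carrier_free_pro_p_subset that] assms] .
  then have "(\<lambda>x. x k) \<in> hom (free_pro_p p V) (fst k)"
    using assms by (auto simp: hom_def ambient_group_def)
  ultimately show ?thesis by (simp add: continuous_hom_def)
qed

lemma free_pro_p_depends_on_finitely_many:
  assumes "continuous_map (free_pro_p_top p V) (discrete_topology A) g"
    and "x \<in> carrier (free_pro_p p V)"
  obtains J where "finite J" "J \<subseteq> finite_p_maps p V"
    "\<forall>y\<in>carrier (free_pro_p p V). (\<forall>j\<in>J. y j = x j) \<longrightarrow> g y = g x"
  using continuous_to_discrete_depends_on_finitely_many[OF _ carrier_free_pro_p_subset assms(2)]
    assms(1) unfolding free_pro_p_top_def ambient_top_def by metis

lemma cohomology_setting_free:
  "p > 0 \<Longrightarrow> cohomology_setting (free_pro_p p V) (free_pro_p_top p V) p"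
  by (simp add: cohomology_setting_def cohomology_setting_axioms_def group_free_pro_p topspace_free_pro_p)

section \<open>Characters of free pro-p groups\<close>

lemma characters_compose:
  "\<phi> \<in> continuous_hom G T G' T' \<Longrightarrow> \<xi> \<in> characters p G' T' \<Longrightarrow> \<xi> \<circ> \<phi> \<in> characters p G T"
  unfolding characters_def by (rule continuous_hom_compose)

lemma characters_group_hom:
  "\<xi> \<in> characters p G T \<Longrightarrow> group G \<Longrightarrow> group_hom G (integer_mod_group p) \<xi>"
  by (simp add: characters_def continuous_hom_def group_hom_def group_hom_axioms_def)

lemma characters_one: "\<xi> \<in> characters p G T \<Longrightarrow> group G \<Longrightarrow> \<xi> \<one>\<^bsub>G\<^esub> = 0"
  using group_hom.hom_one[OF characters_group_hom] by force

text \<open>Induction over words gives equality on a dense subgroup. Near \<open>x\<close> both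
  characters depend on finitely many coordinates, so a word that agrees with \<open>x\<close> on the
  union of the two sets carries the equality to \<open>x\<close>.\<close>

lemma free_characters_eqI:
  assumes \<xi>: "\<xi> \<in> characters p (free_pro_p p V) (free_pro_p_top p V)"
    and \<xi>': "\<xi>' \<in> characters p (free_pro_p p V) (free_pro_p_top p V)"
    and eq: "\<And>v. v \<in> V \<Longrightarrow> \<xi> (free_gen p V v) = \<xi>' (free_gen p V v)"
    and x: "x \<in> carrier (free_pro_p p V)"
  shows "\<xi> x = \<xi>' x"
proof -
  let ?F = "free_pro_p p V" and ?S = "generate (ambient_group p V) (free_gen p V ` V)"
  interpret h: group_hom ?F "integer_mod_group p" \<xi>
    by (rule characters_group_hom[OF \<xi> group_free_pro_p])
  interpret h': group_hom ?F "integer_mod_group p" \<xi>'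
    by (rule characters_group_hom[OF \<xi>' group_free_pro_p])
  \<comment> \<open>The closure was taken of a subgroup generated in the ambient product; generating
    inside the free group makes the inverses in the induction those of the domain of the
    characters.\<close>
  have gen: "?S = generate ?F (free_gen p V ` V)"
    using group.generate_consistent[OF group_ambient image_subsetI[of V "free_gen p V", OF free_gen_in]
        subgroup_free_pro_p] by (simp flip: free_pro_p_update)
  have SF: "?S \<subseteq> carrier ?F"
    unfolding gen by (intro h.G.generate_incl image_subsetI free_gen_in)
  have S: "\<xi> s = \<xi>' s" if "s \<in> ?S" for s
    using that unfolding gen
  proof (induction rule: generate.induct)
    case one
    show ?case using h.hom_one h'.hom_one by metis
  next
    case (incl h)
    then show ?case using eq by blast
  next
    case (inv h)
    then show ?case using eq free_gen_in h.hom_inv h'.hom_inv by (metis imageE)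
  next
    case (eng h1 h2)
    have "h1 \<in> carrier ?F" "h2 \<in> carrier ?F"
      using SF eng.hyps unfolding gen by (simp_all add: subsetD)
    then show ?case
      using eng.IH by (simp only: characters_mult[OF \<xi>] characters_mult[OF \<xi>'])
  qed
  obtain J where J: "finite J" "J \<subseteq> finite_p_maps p V"
    "\<forall>y\<in>carrier ?F. (\<forall>j\<in>J. y j = x j) \<longrightarrow> \<xi> y = \<xi> x"
    using free_pro_p_depends_on_finitely_many[OF characters_continuous[OF \<xi>] x] .
  obtain J' where J': "finite J'" "J' \<subseteq> finite_p_maps p V"
    "\<forall>y\<in>carrier ?F. (\<forall>j\<in>J'. y j = x j) \<longrightarrow> \<xi>' y = \<xi>' x"
    using free_pro_p_depends_on_finitely_many[OF characters_continuous[OF \<xi>'] x] .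
  have "finite (J \<union> J')" "J \<union> J' \<subseteq> finite_p_maps p V"
    using J(1,2) J'(1,2) by blast+
  from free_pro_p_approx[OF x this]
  obtain s where s: "s \<in> ?S" "\<forall>j\<in>J \<union> J'. s j = x j" .
  then have "\<xi> s = \<xi> x" "\<xi>' s = \<xi>' x"
    using J(3) J'(3) SF by blast+
  then show ?thesis using S s(1) by simp
qed

text \<open>Around the identity the character depends on finitely many coordinates
  \<open>(K, \<phi>)\<close>, and each \<open>\<phi>\<close> is trivial at almost all generators.
  This supplies the finiteness needed to prescribe a character on a larger set of
  generators.\<close>

lemma free_character_finite_support:
  assumes \<xi>: "\<xi> \<in> characters p (free_pro_p p V) (free_pro_p_top p V)"
  shows "finite {v \<in> V. \<xi> (free_gen p V v) \<noteq> 0}"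
proof -
  let ?F = "free_pro_p p V"
  have one: "\<one>\<^bsub>?F\<^esub> \<in> carrier ?F"
    using group_free_pro_p group.is_monoid monoid.one_closed by blast
  obtain J where J: "finite J" "J \<subseteq> finite_p_maps p V"
    "\<forall>y\<in>carrier ?F. (\<forall>j\<in>J. y j = \<one>\<^bsub>?F\<^esub> j) \<longrightarrow> \<xi> y = \<xi> \<one>\<^bsub>?F\<^esub>"
    using free_pro_p_depends_on_finitely_many[OF characters_continuous[OF \<xi>] one] .
  have "{v \<in> V. \<xi> (free_gen p V v) \<noteq> 0} \<subseteq> (\<Union>k\<in>J. {v \<in> V. snd k v \<noteq> \<one>\<^bsub>fst k\<^esub>})"
  proof (rule subsetI, rule ccontr)
    fix v assume v: "v \<in> {v \<in> V. \<xi> (free_gen p V v) \<noteq> 0}"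
      "v \<notin> (\<Union>k\<in>J. {v \<in> V. snd k v \<noteq> \<one>\<^bsub>fst k\<^esub>})"
    then have "free_gen p V v j = \<one>\<^bsub>?F\<^esub> j" if "j \<in> J" for j
      using that J(2) by (auto simp: free_gen_def ambient_group_def)
    then have "\<xi> (free_gen p V v) = \<xi> \<one>\<^bsub>?F\<^esub>"
      using v(1) by (intro J(3)[rule_format] free_gen_in) auto
    then show False
      using v(1) characters_one[OF \<xi> group_free_pro_p] by simp
  qed
  moreover have "finite (\<Union>k\<in>J. {v \<in> V. snd k v \<noteq> \<one>\<^bsub>fst k\<^esub>})"
    using J(1,2) finite_p_mapsD(5) by blast
  ultimately show ?thesis by (rule finite_subset)
qed

text \<open>The cyclic group of order \<open>p\<close> together with the map \<open>c\<close> is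
  itself one of the indices of the ambient product, and the projection to this coordinate is the
  character sought.\<close>

lemma free_character_exists:
  assumes p: "p > 0" and c: "\<And>v. v \<in> V \<Longrightarrow> c v \<in> {0..<int p}" and fin: "finite {v \<in> V. c v \<noteq> 0}"
  obtains \<xi> where "\<xi> \<in> characters p (free_pro_p p V) (free_pro_p_top p V)"
    "\<And>v. v \<in> V \<Longrightarrow> \<xi> (free_gen p V v) = c v"
proof -
  \<comment> \<open>A copy of \<open>integer_mod_group p\<close> on natural numbers, because the
    indices of the ambient product are groups on \<open>nat\<close>.\<close>
  define K :: "nat monoid" where "K = \<lparr>carrier = {0..<p}, monoid.mult = (\<lambda>x y. (x + y) mod p), one = 0\<rparr>"
  have K: "group K"
  proof (rule groupI)
    fix x assume x: "x \<in> carrier K"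
    then show "\<exists>y\<in>carrier K. y \<otimes>\<^bsub>K\<^esub> x = \<one>\<^bsub>K\<^esub>"
      using p by (intro bexI[of _ "(p - x) mod p"]) (auto simp: K_def mod_simps)
  qed (use p in \<open>auto simp: K_def mod_simps add.assoc\<close>)
  let ?k = "(K, \<lambda>v\<in>V. nat (c v))"
  have k: "?k \<in> finite_p_maps p V"
  proof -
    have "nat (c v) < p" if "v \<in> V" for v
      using c[OF that] by auto
    moreover have "{v \<in> V. (\<lambda>v\<in>V. nat (c v)) v \<noteq> 0} \<subseteq> {v \<in> V. c v \<noteq> 0}" by auto
    then have "finite {v \<in> V. (\<lambda>v\<in>V. nat (c v)) v \<noteq> 0}"
      using fin finite_subset by blast
    moreover have "Coset.order K = p ^ 1" by (simp add: K_def Coset.order_def)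
    then have "\<exists>n. Coset.order K = p ^ n" ..
    ultimately show ?thesis
      using K unfolding finite_p_maps_def by (simp add: K_def)
  qed
  have "int \<in> continuous_hom K (discrete_topology (carrier K)) (integer_mod_group p)
      (discrete_topology {0..<int p})"
    using p by (auto simp: continuous_hom_def hom_def K_def carrier_integer_mod_group
        continuous_map_from_discrete_topology of_nat_mod)
  then have "int \<circ> (\<lambda>x. x ?k) \<in> characters p (free_pro_p p V) (free_pro_p_top p V)"
    unfolding characters_def using continuous_hom_compose free_pro_p_projection[OF k] by fastforce
  moreover have "(int \<circ> (\<lambda>x. x ?k)) (free_gen p V v) = c v" if "v \<in> V" for v
    using k that c[OF that] by (simp add: free_gen_def)
  ultimately show thesis using that by blast
qed

section \<open>Maps between free pro-p groups and descent along presentations\<close>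

text \<open>The map only reindexes coordinates: \<open>(K, \<phi>)\<close> over \<open>W\<close> is
  read off at \<open>(K, \<phi> \<circ> e)\<close> over \<open>V\<close>. Injectivity of
  \<open>e\<close> keeps the support of \<open>\<phi> \<circ> e\<close> finite, so that this is
  again an index.\<close>

lemma free_map_continuous_hom:
  assumes e: "inj_on e V" "e ` V \<subseteq> W"
  shows "free_map p V W e \<in> continuous_hom (free_pro_p p V) (free_pro_p_top p V)
      (free_pro_p p W) (free_pro_p_top p W)"
    and "v \<in> V \<Longrightarrow> free_map p V W e (free_gen p V v) = free_gen p W (e v)"
proof -
  let ?r = "\<lambda>k. (fst k, restrict (snd k \<circ> e) V)" and ?j = "free_map p V W e"
  let ?A = "ambient_group p V" and ?B = "ambient_group p W"
  have r: "?r k \<in> finite_p_maps p V" if k: "k \<in> finite_p_maps p W" for k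
  proof -
    have "e ` {v \<in> V. restrict (snd k \<circ> e) V v \<noteq> \<one>\<^bsub>fst k\<^esub>} \<subseteq> {w \<in> W. snd k w \<noteq> \<one>\<^bsub>fst k\<^esub>}"
      using e(2) by auto
    then have "finite (e ` {v \<in> V. restrict (snd k \<circ> e) V v \<noteq> \<one>\<^bsub>fst k\<^esub>})"
      using finite_p_mapsD(5)[OF k] finite_subset by blast
    moreover have "inj_on e {v \<in> V. restrict (snd k \<circ> e) V v \<noteq> \<one>\<^bsub>fst k\<^esub>}"
      using e(1) by (rule inj_on_subset) auto
    ultimately have "finite {v \<in> V. restrict (snd k \<circ> e) V v \<noteq> \<one>\<^bsub>fst k\<^esub>}"
      by (rule finite_imageD)
    moreover have "restrict (snd k \<circ> e) V \<in> V \<rightarrow>\<^sub>E carrier (fst k)"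
      using PiE_mem[OF finite_p_mapsD(4)[OF k]] e(2) by auto
    ultimately show ?thesis
      using finite_p_mapsD(1-3)[OF k] by (simp add: finite_p_maps_def)
  qed
  show gen: "?j (free_gen p V v) = free_gen p W (e v)" if "v \<in> V" for v
    unfolding free_map_def free_gen_def by (intro restrict_ext) (use r that in auto)
  have jA: "?j x \<in> carrier ?B" if "x \<in> carrier ?A" for x
    using that r unfolding carrier_ambient free_map_def by (auto simp: PiE_iff dest!: bspec)
  have mult: "?j (x \<otimes>\<^bsub>?A\<^esub> y) = ?j x \<otimes>\<^bsub>?B\<^esub> ?j y" for x y
    using r by (auto simp: free_map_def ambient_group_def intro!: restrict_ext)
  interpret j: group_hom ?A ?B ?j
    using jA mult by (auto simp: group_hom_def group_hom_axioms_def group_ambient hom_def)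
  have S: "?j s \<in> generate ?B (free_gen p W ` W)" if "s \<in> generate ?A (free_gen p V ` V)" for s
    using that
  proof (induction rule: generate.induct)
    case one
    show ?case using generate.one j.hom_one by metis
  next
    case (incl h)
    then obtain v where "v \<in> V" "h = free_gen p V v" by blast
    then show ?case using gen e(2) by (auto intro!: generate.incl)
  next
    case (inv h)
    then obtain v where v: "v \<in> V" "h = free_gen p V v" by blast
    have "?j (inv\<^bsub>?A\<^esub> h) = inv\<^bsub>?B\<^esub> free_gen p W (e v)"
      unfolding v(2) gen[OF v(1), symmetric] by (rule j.hom_inv[OF free_gen_ambient[OF v(1)]])
    then show ?case
      using e(2) v(1) by (auto intro!: generate.inv)
  next
    case (eng h1 h2)
    then show ?case using mult generate.eng by metis
  qed
  have jF: "?j x \<in> carrier (free_pro_p p W)" if x: "x \<in> carrier (free_pro_p p V)" for x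
    unfolding in_free_pro_p
  proof (intro conjI allI impI)
    show "?j x \<in> carrier ?B" using x jA by (simp add: in_free_pro_p)
    \<comment> \<open>An approximation of \<open>x\<close> on the coordinates pulled back from
      \<open>J\<close> is mapped to an approximation of \<open>?j x\<close> on
      \<open>J\<close>.\<close>
    fix J assume J: "finite J \<and> J \<subseteq> finite_p_maps p W"
    have "finite (?r ` J)"
      using J by simp
    moreover have "?r ` J \<subseteq> finite_p_maps p V"
    proof (rule image_subsetI)
      fix k assume "k \<in> J"
      then have "k \<in> finite_p_maps p W" using J by blast
      then show "?r k \<in> finite_p_maps p V" by (rule r)
    qed
    ultimately
    obtain s where s: "s \<in> generate ?A (free_gen p V ` V)" "\<forall>i\<in>?r ` J. s i = x i"
      by (rule free_pro_p_approx[OF x])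
    have "?j s j = ?j x j" if "j \<in> J" for j
      using that J s(2) by (auto simp: free_map_def)
    then show "\<exists>s\<in>generate ?B (free_gen p W ` W). \<forall>j\<in>J. s j = ?j x j"
      using S s(1) by blast
  qed
  have "continuous_map (free_pro_p_top p V) (ambient_top p W) ?j"
    unfolding ambient_top_def continuous_map_componentwise
  proof (intro conjI ballI)
    show "?j ` topspace (free_pro_p_top p V) \<subseteq> extensional (finite_p_maps p W)"
      by (auto simp: free_map_def)
    fix k assume k: "k \<in> finite_p_maps p W"
    then show "continuous_map (free_pro_p_top p V) (discrete_topology (carrier (fst k))) (\<lambda>x. ?j x k)"
      using free_pro_p_projection[OF r[OF k]] by (simp add: continuous_hom_def free_map_def)
  qed
  then have "continuous_map (free_pro_p_top p V) (free_pro_p_top p W) ?j"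
    using jF unfolding free_pro_p_top_def[of p W] continuous_map_in_subtopology topspace_free_pro_p
    by auto
  then show "?j \<in> continuous_hom (free_pro_p p V) (free_pro_p_top p V)
      (free_pro_p p W) (free_pro_p_top p W)"
    using jF mult by (auto simp: continuous_hom_def hom_def)
qed

text \<open>The universal property of a presentation. The kernel of \<open>q\<close> is normal,
  contains \<open>R\<close>, and is closed because the identity of \<open>Q\<close> is a closed
  point; hence it contains the kernel of \<open>\<pi>\<close>, and the preimage chosen by
  \<open>inv_into\<close> does not matter. The explicit \<open>q'\<close> has the shape of
  \<open>canonical_map\<close>.\<close>

lemma presentation_lift:
  assumes pres: "pro_p_presentation p V R G T \<pi>"
    and q: "q \<in> continuous_hom (free_pro_p p V) (free_pro_p_top p V) Q S"
    and Q: "group Q" "closedin S {\<one>\<^bsub>Q\<^esub>}"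
    and rel: "\<And>r. r \<in> R \<Longrightarrow> q r = \<one>\<^bsub>Q\<^esub>"
  defines "q' \<equiv> \<lambda>g. q (inv_into (carrier (free_pro_p p V)) \<pi> g)"
  shows "q' \<in> continuous_hom G T Q S"
    and "\<And>x. x \<in> carrier (free_pro_p p V) \<Longrightarrow> q' (\<pi> x) = q x"
proof -
  let ?F = "free_pro_p p V" and ?T = "free_pro_p_top p V"
  have R: "R \<subseteq> carrier ?F" and \<pi>: "\<pi> \<in> continuous_hom ?F ?T G T"
    and surj: "\<pi> ` carrier ?F = carrier G"
    and ker: "kernel ?F G \<pi> = closed_normal_closure ?F ?T R"
    and G: "group G" "Hausdorff_space T" "topspace T = carrier G"
    using pres by (auto simp: pro_p_presentation_def pro_p_group_def profinite_group_def topological_group_def)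
  interpret F: group ?F by (rule group_free_pro_p)
  interpret q: group_hom ?F Q q
    using q Q by (simp add: continuous_hom_def group_hom_def group_hom_axioms_def F.is_group)
  interpret pi: group_hom ?F G \<pi>
    using \<pi> G by (simp add: continuous_hom_def group_hom_def group_hom_axioms_def F.is_group)
  have "closedin ?T {x \<in> topspace ?T. q x \<in> {\<one>\<^bsub>Q\<^esub>}}"
    using q Q(2) by (intro closedin_continuous_map_preimage) (auto simp: continuous_hom_def)
  then have "closedin ?T (kernel ?F Q q)"
    by (simp add: kernel_def topspace_free_pro_p)
  moreover have "kernel ?F Q q \<lhd> ?F" by (rule q.normal_kernel)
  moreover have "R \<subseteq> kernel ?F Q q"
    using R rel by (auto simp: kernel_def)
  ultimately have sub: "kernel ?F G \<pi> \<subseteq> kernel ?F Q q"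
    unfolding ker closed_normal_closure_def by blast
  have eq: "q x = q y" if x: "x \<in> carrier ?F" and y: "y \<in> carrier ?F" and xy: "\<pi> x = \<pi> y" for x y
  proof -
    let ?z = "x \<otimes>\<^bsub>?F\<^esub> inv\<^bsub>?F\<^esub> y"
    have "?z \<in> kernel ?F G \<pi>"
      using x y xy by (simp add: kernel_def del: free_pro_p_simps)
    then have "q ?z = \<one>\<^bsub>Q\<^esub>" using sub by (auto simp: kernel_def)
    then have "q x \<otimes>\<^bsub>Q\<^esub> inv\<^bsub>Q\<^esub> q y = \<one>\<^bsub>Q\<^esub>"
      using x y by (simp del: free_pro_p_simps)
    then show ?thesis
      using x y by (metis q.H.inv_closed q.H.inv_equality q.H.inv_inv q.hom_closed)
  qed
  show q': "q' (\<pi> x) = q x" if x: "x \<in> carrier ?F" for x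
    unfolding q'_def
  proof (rule eq)
    show "inv_into (carrier ?F) \<pi> (\<pi> x) \<in> carrier ?F" using x by (intro inv_into_into imageI)
    show "\<pi> (inv_into (carrier ?F) \<pi> (\<pi> x)) = \<pi> x" using x by (simp add: f_inv_into_f)
  qed fact
  \<comment> \<open>A continuous surjection from a compact onto a Hausdorff space is a quotient map,
    so continuity of \<open>q'\<close> can be tested on \<open>q' \<circ> \<pi>\<close>, which is
    \<open>q\<close>.\<close>
  have "quotient_map ?T T \<pi>"
    using \<pi> G surj by (intro T1_Spaces.continuous_imp_quotient_map compact_space_free_pro_p)
      (auto simp: continuous_hom_def topspace_free_pro_p)
  moreover have "continuous_map ?T S (q' \<circ> \<pi>)"
    by (rule continuous_map_eq[of _ _ q]) (use q q' in \<open>auto simp: continuous_hom_def topspace_free_pro_p\<close>)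
  ultimately have "continuous_map T S q'"
    by (rule continuous_compose_quotient_map)
  moreover have "q' \<in> hom G Q"
  proof (rule homI)
    fix g assume "g \<in> carrier G"
    then obtain x where x: "x \<in> carrier ?F" "g = \<pi> x" using surj by blast
    then show "q' g \<in> carrier Q" using q' by simp
    fix h assume "h \<in> carrier G"
    then obtain y where y: "y \<in> carrier ?F" "h = \<pi> y" using surj by blast
    have "q' (g \<otimes>\<^bsub>G\<^esub> h) = q' (\<pi> (x \<otimes>\<^bsub>?F\<^esub> y))"
      using x y by (simp del: free_pro_p_simps)
    also have "\<dots> = q (x \<otimes>\<^bsub>?F\<^esub> y)"
      using x y by (intro q' F.m_closed)
    finally show "q' (g \<otimes>\<^bsub>G\<^esub> h) = q' g \<otimes>\<^bsub>Q\<^esub> q' h"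
      using x y q' by (simp del: free_pro_p_simps)
  qed
  ultimately show "q' \<in> continuous_hom G T Q S" by (simp add: continuous_hom_def)
qed

section \<open>Amalgamated products and HNN-extensions\<close>

lemma characters_agree:
  assumes p: "p > 0" and pres: "pro_p_presentation p V R G T \<pi>" and \<xi>: "\<xi> \<in> characters p G T"
    and 0: "\<And>v. v \<in> V \<Longrightarrow> \<xi> (\<pi> (free_gen p V v)) = 0" and g: "g \<in> carrier G"
  shows "\<xi> g = 0"
proof -
  interpret F: cohomology_setting "free_pro_p p V" "free_pro_p_top p V" p
    using p by (rule cohomology_setting_free)
  have \<pi>: "\<pi> \<in> continuous_hom (free_pro_p p V) (free_pro_p_top p V) G T"
    and surj: "\<pi> ` carrier (free_pro_p p V) = carrier G"
    using pres by (auto simp: pro_p_presentation_def)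
  obtain x where x: "x \<in> carrier (free_pro_p p V)" "g = \<pi> x"
    using surj g by blast
  have "(\<xi> \<circ> \<pi>) x = (\<lambda>_. 0) x"
    using free_characters_eqI[OF characters_compose[OF \<pi> \<xi>] F.zero_character _ x(1)] 0 by simp
  then show ?thesis using x by simp
qed

lemma presentation_lift_character:
  assumes p: "p > 0" and pres: "pro_p_presentation p V R G T \<pi>"
    and \<xi>: "\<xi> \<in> characters p (free_pro_p p V) (free_pro_p_top p V)"
    and rel: "\<And>r. r \<in> R \<Longrightarrow> \<xi> r = 0"
  obtains \<xi>' where "\<xi>' \<in> characters p G T" "\<And>x. x \<in> carrier (free_pro_p p V) \<Longrightarrow> \<xi>' (\<pi> x) = \<xi> x"
proof -
  have "closedin (discrete_topology {0..<int p}) {\<one>\<^bsub>integer_mod_group p\<^esub>}"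
    using p by simp
  from presentation_lift[OF pres \<xi>[unfolded characters_def] group_integer_mod_group this] rel that
  show thesis unfolding characters_def by simp
qed

text \<open>The canonical map is literally the lift of \<open>\<pi> \<circ> free_map p V W e\<close>
  along \<open>\<pi>0\<close>. Relators in \<open>R\<close> go to relators in \<open>S\<close> and
  so to 1 in \<open>G\<close>.\<close>

lemma canonical_map_lift:
  assumes presG: "pro_p_presentation p W S G T \<pi>" and pres0: "pro_p_presentation p V R G0 T0 \<pi>0"
    and e: "inj_on e V" "e ` V \<subseteq> W" and rel: "free_map p V W e ` R \<subseteq> S"
  shows "canonical_map p V \<pi>0 W \<pi> e \<in> continuous_hom G0 T0 G T"
    and "\<And>x. x \<in> carrier (free_pro_p p V) \<Longrightarrow>
      canonical_map p V \<pi>0 W \<pi> e (\<pi>0 x) = \<pi> (free_map p V W e x)"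
proof -
  let ?F = "free_pro_p p W"
  have S: "S \<subseteq> carrier ?F" and \<pi>: "\<pi> \<in> continuous_hom ?F (free_pro_p_top p W) G T"
    and ker: "kernel ?F G \<pi> = closed_normal_closure ?F (free_pro_p_top p W) S"
    and G: "group G" "Hausdorff_space T" "topspace T = carrier G"
    using presG by (auto simp: pro_p_presentation_def pro_p_group_def profinite_group_def topological_group_def)
  have q: "\<pi> \<circ> free_map p V W e \<in> continuous_hom (free_pro_p p V) (free_pro_p_top p V) G T"
    using continuous_hom_compose[OF free_map_continuous_hom(1)[OF e] \<pi>] .
  have "S \<subseteq> kernel ?F G \<pi>"
    unfolding ker closed_normal_closure_def by blast
  then have rel': "(\<pi> \<circ> free_map p V W e) r = \<one>\<^bsub>G\<^esub>" if "r \<in> R" for r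
    using rel that by (auto simp: kernel_def)
  have cl: "closedin T {\<one>\<^bsub>G\<^esub>}"
    using G by (intro closedin_Hausdorff_singleton) (auto intro: group.is_monoid monoid.one_closed)
  have eq: "canonical_map p V \<pi>0 W \<pi> e =
      (\<lambda>g. (\<pi> \<circ> free_map p V W e) (inv_into (carrier (free_pro_p p V)) \<pi>0 g))"
    by (simp add: canonical_map_def fun_eq_iff)
  show "canonical_map p V \<pi>0 W \<pi> e \<in> continuous_hom G0 T0 G T"
    unfolding eq using presentation_lift(1)[OF pres0 q G(1) cl rel'] .
  show "canonical_map p V \<pi>0 W \<pi> e (\<pi>0 x) = \<pi> (free_map p V W e x)"
    if "x \<in> carrier (free_pro_p p V)" for x
    using presentation_lift(2)[OF pres0 q G(1) cl rel' that] unfolding eq by simp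
qed

section \<open>Passing from the radical of G to a factor\<close>

text \<open>Naturality of the cup product on the level of cochains: a primitive \<open>s\<close>
  pulls back to the primitive \<open>s \<circ> c\<close>.\<close>

lemma cup_vanishes_pullback:
  assumes "p > 0" and c: "c \<in> continuous_hom G0 T0 G T" and v: "cup_vanishes p G T \<xi> \<beta>"
  shows "cup_vanishes p G0 T0 (\<xi> \<circ> c) (\<beta> \<circ> c)"
proof -
  obtain s where s: "continuous_map T (discrete_topology {0..<int p}) s"
    "\<forall>x\<in>carrier G. \<forall>y\<in>carrier G. (\<xi> x * \<beta> y) mod int p = (s y - s (x \<otimes>\<^bsub>G\<^esub> y) + s x) mod int p"
    using v unfolding cup_vanishes_def by blast
  have hom: "c \<in> hom G0 G" "continuous_map T0 T c" using c by (auto simp: continuous_hom_def)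
  show ?thesis
    unfolding cup_vanishes_def
  proof (intro exI[of _ "s \<circ> c"] conjI ballI)
    show "continuous_map T0 (discrete_topology {0..<int p}) (s \<circ> c)"
      using hom(2) s(1) by (rule continuous_map_compose)
    fix x y assume "x \<in> carrier G0" "y \<in> carrier G0"
    then show "((\<xi> \<circ> c) x * (\<beta> \<circ> c) y) mod int p =
        ((s \<circ> c) y - (s \<circ> c) (x \<otimes>\<^bsub>G0\<^esub> y) + (s \<circ> c) x) mod int p"
      using s(2) hom_in_carrier[OF hom(1)] hom_mult[OF hom(1)] by simp
  qed
qed

text \<open>An extension to \<open>G\<close> pulls back to the given character only on the carrier,
  which is all that the cup product sees.\<close>

lemma cup_vanishes_cong:
  assumes "\<And>x. x \<in> carrier G \<Longrightarrow> \<beta> x = \<beta>' x"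
  shows "cup_vanishes p G T \<xi> \<beta> \<longleftrightarrow> cup_vanishes p G T \<xi> \<beta>'"
  unfolding cup_vanishes_def using assms by simp

lemma cohomology_setting_pro_p: "p > 0 \<Longrightarrow> pro_p_group p G T \<Longrightarrow> cohomology_setting G T p"
  by (auto simp: pro_p_group_def profinite_group_def topological_group_def cohomology_setting_def
      cohomology_setting_axioms_def)

text \<open>Shared by both constructions, which differ only in how \<open>ext\<close> is obtained.
  It turns every test character of \<open>G0\<close> into a pullback from \<open>G\<close>, so
  \<open>\<xi> \<circ> c\<close> lies in the radical of \<open>G0\<close>.\<close>

lemma radical_character_vanishes_on_subgroup:
  assumes p: "p > 0" and G0: "pro_p_group p G0 T0"
    and rad: "cup_radical p G0 T0 = {\<one>\<^bsub>cohomology p G0 T0 1\<^esub>}"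
    and c: "c \<in> continuous_hom G0 T0 G T"
    and ext: "\<And>\<beta>. \<beta> \<in> characters p G0 T0 \<Longrightarrow>
      \<exists>\<beta>'\<in>characters p G T. \<forall>x\<in>carrier G0. \<beta>' (c x) = \<beta> x"
    and \<xi>: "\<xi> \<in> characters p G T" "\<forall>\<beta>\<in>characters p G T. cup_vanishes p G T \<xi> \<beta>"
    and x: "x \<in> carrier G0"
  shows "\<xi> (c x) = 0"
proof -
  interpret cohomology_setting G0 T0 p using p G0 by (rule cohomology_setting_pro_p)
  have "cup_vanishes p G0 T0 (\<xi> \<circ> c) \<beta>" if \<beta>: "\<beta> \<in> characters p G0 T0" for \<beta>
  proof -
    obtain \<beta>' where \<beta>': "\<beta>' \<in> characters p G T" "\<forall>x\<in>carrier G0. \<beta>' (c x) = \<beta> x"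
      using ext[OF \<beta>] by blast
    then have "cup_vanishes p G0 T0 (\<xi> \<circ> c) (\<beta>' \<circ> c)"
      using cup_vanishes_pullback[OF p c] \<xi>(2) by blast
    then show ?thesis
      using \<beta>'(2) cup_vanishes_cong[of G0 "\<beta>' \<circ> c" \<beta>] by simp
  qed
  moreover have "\<xi> \<circ> c \<in> characters p G0 T0" using c \<xi>(1) by (rule characters_compose)
  ultimately have "(\<xi> \<circ> c) x = 0"
    using rad x unfolding cup_radical_trivial_iff by blast
  then show ?thesis by simp
qed

text \<open>Classes in degree one are singletons, so equality of classes is equality of functions on
  the carrier of \<open>H\<close>. A general map \<open>f\<close> covers the embeddings of an
  amalgam as well as the inclusion of a subgroup.\<close>

lemma surjective_on_characters:
  assumes p: "p > 0" and set: "cohomology_setting G T p" "cohomology_setting H TH p"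
    and f: "f \<in> carrier H \<rightarrow> carrier G"
    and surj: "induced p H TH 1 f ` carrier (cohomology p G T 1) = carrier (cohomology p H TH 1)"
    and \<gamma>: "\<gamma> \<in> characters p H TH"
  obtains \<beta> where "\<beta> \<in> characters p G T" "\<And>h. h \<in> carrier H \<Longrightarrow> \<beta> (f h) = \<gamma> h"
proof -
  have top: "topspace T = carrier G" "topspace TH = carrier H"
    using set by (simp_all add: cohomology_setting.topspace_eq)
  have "{lift1 TH \<gamma>} \<in> induced p H TH 1 f ` carrier (cohomology p G T 1)"
    unfolding surj cohomology_setting.carrier_cohomology_1[OF set(2)] using \<gamma> by blast
  then obtain \<beta> where \<beta>: "\<beta> \<in> characters p G T" "{lift1 TH \<gamma>} = induced p H TH 1 f {lift1 T \<beta>}"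
    unfolding cohomology_setting.carrier_cohomology_1[OF set(1)] by blast
  have "induced p H TH 1 f {lift1 T \<beta>} = {lift1 TH (\<beta> \<circ> f)}"
    using p f top characters_range[OF \<beta>(1)] by (intro induced_lift1) auto
  then have "lift1 TH \<gamma> = lift1 TH (\<beta> \<circ> f)" using \<beta>(2) by simp
  then have "\<beta> (f h) = \<gamma> h" if "h \<in> carrier H" for h
    using lift1_eqD[of TH \<gamma> "\<beta> \<circ> f" h] that top by simp
  with \<beta>(1) that show thesis by blast
qed

section \<open>Amalgamated products\<close>

lemma amalgamated_product_relator_subsets:
  "free_map p V1 (V1 <+> V2) Inl ` R1 \<subseteq> amalgam_relators p V1 R1 \<pi>1 V2 R2 \<pi>2 H f1 f2"
  "free_map p V2 (V1 <+> V2) Inr ` R2 \<subseteq> amalgam_relators p V1 R1 \<pi>1 V2 R2 \<pi>2 H f1 f2"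
  by (auto simp: amalgam_relators_def Let_def)

lemma pro_p_presentation_kernel:
  assumes "pro_p_presentation p V R G T \<pi>" "r \<in> R"
  shows "r \<in> carrier (free_pro_p p V)" "\<pi> r = \<one>\<^bsub>G\<^esub>"
proof -
  have "R \<subseteq> kernel (free_pro_p p V) G \<pi>"
    using assms(1) unfolding pro_p_presentation_def closed_normal_closure_def by blast
  then show "r \<in> carrier (free_pro_p p V)" "\<pi> r = \<one>\<^bsub>G\<^esub>"
    using assms(2) by (auto simp: kernel_def)
qed

lemma pro_p_presentation_character:
  assumes "pro_p_presentation p V R G T \<pi>" "\<alpha> \<in> characters p G T"
  shows "\<alpha> \<circ> \<pi> \<in> characters p (free_pro_p p V) (free_pro_p_top p V)"
    and "\<And>r. r \<in> R \<Longrightarrow> \<alpha> (\<pi> r) = 0"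
proof -
  show "\<alpha> \<circ> \<pi> \<in> characters p (free_pro_p p V) (free_pro_p_top p V)"
    using assms by (auto simp: pro_p_presentation_def intro: characters_compose)
  have "group G"
    using assms(1) by (simp add: pro_p_presentation_def pro_p_group_def profinite_group_def topological_group_def)
  then show "\<alpha> (\<pi> r) = 0" if "r \<in> R" for r
    using pro_p_presentation_kernel[OF assms(1) that] characters_one[OF assms(2)] by simp
qed

text \<open>The values of the two characters on the generators define a character of the free group
  on \<open>V1 <+> V2\<close>. It kills the relators of the factors because it restricts to the
  given characters, and the amalgamation relators because of \<open>agree\<close>.\<close>

lemma amalgamated_product_character:
  assumes p: "p > 0"
    and A: "amalgamated_product p V1 R1 G1 T1 \<pi>1 V2 R2 G2 T2 \<pi>2 H TH f1 f2 G T \<pi>"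
    and \<alpha>1: "\<alpha>1 \<in> characters p G1 T1" and \<alpha>2: "\<alpha>2 \<in> characters p G2 T2"
    and agree: "\<And>h. h \<in> carrier H \<Longrightarrow> \<alpha>1 (f1 h) = \<alpha>2 (f2 h)"
  obtains \<alpha> where "\<alpha> \<in> characters p G T"
    "\<And>g. g \<in> carrier G1 \<Longrightarrow> \<alpha> (canonical_map p V1 \<pi>1 (V1 <+> V2) \<pi> Inl g) = \<alpha>1 g"
    "\<And>g. g \<in> carrier G2 \<Longrightarrow> \<alpha> (canonical_map p V2 \<pi>2 (V1 <+> V2) \<pi> Inr g) = \<alpha>2 g"
proof -
  let ?W = "V1 <+> V2" and ?R = "amalgam_relators p V1 R1 \<pi>1 V2 R2 \<pi>2 H f1 f2"
  let ?j1 = "free_map p V1 ?W Inl" and ?j2 = "free_map p V2 ?W Inr" and ?F = "free_pro_p p ?W"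
  have P1: "pro_p_presentation p V1 R1 G1 T1 \<pi>1" and P2: "pro_p_presentation p V2 R2 G2 T2 \<pi>2"
    and P: "pro_p_presentation p ?W ?R G T \<pi>"
    using A by (auto simp: amalgamated_product_def)
  note c1 = pro_p_presentation_character[OF P1 \<alpha>1] and c2 = pro_p_presentation_character[OF P2 \<alpha>2]
  define c where "c = (\<lambda>w. case w of Inl v \<Rightarrow> \<alpha>1 (\<pi>1 (free_gen p V1 v))
    | Inr v \<Rightarrow> \<alpha>2 (\<pi>2 (free_gen p V2 v)))"
  have "c w \<in> {0..<int p}" if "w \<in> ?W" for w
    using that characters_range[OF c1(1)] characters_range[OF c2(1)]
    by (auto simp: c_def topspace_free_pro_p free_gen_in)
  moreover have "finite {w \<in> ?W. c w \<noteq> 0}"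
  proof -
    have "{w \<in> ?W. c w \<noteq> 0} \<subseteq> Inl ` {v \<in> V1. (\<alpha>1 \<circ> \<pi>1) (free_gen p V1 v) \<noteq> 0} \<union>
        Inr ` {v \<in> V2. (\<alpha>2 \<circ> \<pi>2) (free_gen p V2 v) \<noteq> 0}"
      by (auto simp: c_def)
    then show ?thesis
      using free_character_finite_support[OF c1(1)] free_character_finite_support[OF c2(1)]
      by (meson finite_UnI finite_imageI finite_subset)
  qed
  ultimately obtain \<xi> where \<xi>: "\<xi> \<in> characters p ?F (free_pro_p_top p ?W)"
    "\<And>w. w \<in> ?W \<Longrightarrow> \<xi> (free_gen p ?W w) = c w"
    using free_character_exists[OF p] by blast
  have inj: "inj_on Inl V1" "Inl ` V1 \<subseteq> ?W" "inj_on Inr V2" "Inr ` V2 \<subseteq> ?W" by auto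
  note j1 = free_map_continuous_hom[OF inj(1,2), where p = p] and j2 = free_map_continuous_hom[OF inj(3,4), where p = p]
  \<comment> \<open>Both sides are characters of the free group on \<open>V1\<close> that agree on
    its generators by the choice of \<open>c\<close>.\<close>
  have \<xi>j1: "\<xi> (?j1 x) = \<alpha>1 (\<pi>1 x)" if "x \<in> carrier (free_pro_p p V1)" for x
    using free_characters_eqI[OF characters_compose[OF j1(1) \<xi>(1)] c1(1) _ that] j1(2) \<xi>(2)
    by (simp add: c_def InlI)
  have \<xi>j2: "\<xi> (?j2 x) = \<alpha>2 (\<pi>2 x)" if "x \<in> carrier (free_pro_p p V2)" for x
    using free_characters_eqI[OF characters_compose[OF j2(1) \<xi>(1)] c2(1) _ that] j2(2) \<xi>(2)
    by (simp add: c_def InrI)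
  interpret \<xi>: group_hom ?F "integer_mod_group p" \<xi>
    by (rule characters_group_hom[OF \<xi>(1) group_free_pro_p])
  have j1F: "?j1 x \<in> carrier ?F" if "x \<in> carrier (free_pro_p p V1)" for x
    using j1(1) that by (auto simp: continuous_hom_def hom_def)
  have j2F: "?j2 x \<in> carrier ?F" if "x \<in> carrier (free_pro_p p V2)" for x
    using j2(1) that by (auto simp: continuous_hom_def hom_def)
  have "\<xi> r = 0" if r: "r \<in> ?R" for r
  proof -
    consider (1) x where "x \<in> R1" "r = ?j1 x" | (2) x where "x \<in> R2" "r = ?j2 x"
      | (3) x y h where "x \<in> carrier (free_pro_p p V1)" "y \<in> carrier (free_pro_p p V2)"
        "h \<in> carrier H" "\<pi>1 x = f1 h" "\<pi>2 y = f2 h" "r = ?j1 x \<otimes>\<^bsub>?F\<^esub> inv\<^bsub>?F\<^esub> ?j2 y"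
      using r unfolding amalgam_relators_def Let_def by blast
    then show ?thesis
    proof cases
      case 1
      then show ?thesis using \<xi>j1 c1(2) pro_p_presentation_kernel(1)[OF P1] by simp
    next
      case 2
      then show ?thesis using \<xi>j2 c2(2) pro_p_presentation_kernel(1)[OF P2] by simp
    next
      case 3
      have "\<xi> (?j1 x) = \<xi> (?j2 y)"
        using 3 \<xi>j1 \<xi>j2 agree by simp
      then have "\<xi> r = \<xi> (?j2 y) \<otimes>\<^bsub>integer_mod_group p\<^esub> inv\<^bsub>integer_mod_group p\<^esub> \<xi> (?j2 y)"
        unfolding 3(6) using \<xi>.hom_mult[OF j1F[OF 3(1)] \<xi>.G.inv_closed[OF j2F[OF 3(2)]]]
          \<xi>.hom_inv[OF j2F[OF 3(2)]] by metis
      also have "\<dots> = 0"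
        using \<xi>.H.r_inv[OF \<xi>.hom_closed[OF j2F[OF 3(2)]]] by (metis one_integer_mod_group)
      finally show ?thesis .
    qed
  qed
  then obtain \<alpha> where \<alpha>: "\<alpha> \<in> characters p G T" "\<And>x. x \<in> carrier ?F \<Longrightarrow> \<alpha> (\<pi> x) = \<xi> x"
    using presentation_lift_character[OF p P \<xi>(1)] by blast
  show thesis
  proof (rule that[OF \<alpha>(1)])
    fix g assume "g \<in> carrier G1"
    then obtain x where x: "x \<in> carrier (free_pro_p p V1)" "g = \<pi>1 x"
      using P1 unfolding pro_p_presentation_def by blast
    then show "\<alpha> (canonical_map p V1 \<pi>1 ?W \<pi> Inl g) = \<alpha>1 g"
      using canonical_map_lift(2)[OF P P1 inj(1,2) amalgamated_product_relator_subsets(1)]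
        \<alpha>(2) j1F \<xi>j1 by simp
  next
    fix g assume "g \<in> carrier G2"
    then obtain x where x: "x \<in> carrier (free_pro_p p V2)" "g = \<pi>2 x"
      using P2 unfolding pro_p_presentation_def by blast
    then show "\<alpha> (canonical_map p V2 \<pi>2 ?W \<pi> Inr g) = \<alpha>2 g"
      using canonical_map_lift(2)[OF P P2 inj(3,4) amalgamated_product_relator_subsets(2)]
        \<alpha>(2) j2F \<xi>j2 by simp
  qed
qed

text \<open>The two surjectivity assumptions are used crosswise: a character of \<open>G1\<close> is
  pulled back to \<open>H\<close>, and surjectivity for \<open>G2\<close> gives a partner on
  \<open>G2\<close> with the same values on \<open>H\<close>, so that the pair can be glued;
  likewise with the factors exchanged.\<close>

lemma amalgamated_product_cup_radical:
  assumes p: "p > 0"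
    and A: "amalgamated_product p V1 R1 G1 T1 \<pi>1 V2 R2 G2 T2 \<pi>2 H TH f1 f2 G T \<pi>"
    and rad: "cup_radical p G1 T1 = {\<one>\<^bsub>cohomology p G1 T1 1\<^esub>}"
      "cup_radical p G2 T2 = {\<one>\<^bsub>cohomology p G2 T2 1\<^esub>}"
    and surj: "induced p H TH 1 f1 ` carrier (cohomology p G1 T1 1) = carrier (cohomology p H TH 1)"
      "induced p H TH 1 f2 ` carrier (cohomology p G2 T2 1) = carrier (cohomology p H TH 1)"
  shows "cup_radical p G T = {\<one>\<^bsub>cohomology p G T 1\<^esub>}"
proof -
  let ?W = "V1 <+> V2" and ?R = "amalgam_relators p V1 R1 \<pi>1 V2 R2 \<pi>2 H f1 f2"
  let ?c1 = "canonical_map p V1 \<pi>1 ?W \<pi> Inl" and ?c2 = "canonical_map p V2 \<pi>2 ?W \<pi> Inr"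
  have P1: "pro_p_presentation p V1 R1 G1 T1 \<pi>1" and P2: "pro_p_presentation p V2 R2 G2 T2 \<pi>2"
    and P: "pro_p_presentation p ?W ?R G T \<pi>"
    and pro: "pro_p_group p G1 T1" "pro_p_group p G2 T2" "pro_p_group p H TH" "pro_p_group p G T"
    and f: "f1 \<in> continuous_hom H TH G1 T1" "f2 \<in> continuous_hom H TH G2 T2"
    using A by (auto simp: amalgamated_product_def pro_p_presentation_def)
  note set = pro[THEN cohomology_setting_pro_p[OF p]]
  interpret cohomology_setting G T p by (rule set(4))
  have inj: "inj_on Inl V1" "Inl ` V1 \<subseteq> ?W" "inj_on Inr V2" "Inr ` V2 \<subseteq> ?W" by auto
  note c1 = canonical_map_lift[OF P P1 inj(1,2) amalgamated_product_relator_subsets(1)]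
    and c2 = canonical_map_lift[OF P P2 inj(3,4) amalgamated_product_relator_subsets(2)]
  have fc: "f1 \<in> carrier H \<rightarrow> carrier G1" "f2 \<in> carrier H \<rightarrow> carrier G2"
    using f by (auto simp: continuous_hom_def hom_def)
  have ext1: "\<exists>\<beta>'\<in>characters p G T. \<forall>x\<in>carrier G1. \<beta>' (?c1 x) = \<beta> x"
    if \<beta>: "\<beta> \<in> characters p G1 T1" for \<beta>
  proof -
    have "\<beta> \<circ> f1 \<in> characters p H TH" using f(1) \<beta> by (rule characters_compose)
    then obtain \<beta>2 where "\<beta>2 \<in> characters p G2 T2" "\<And>h. h \<in> carrier H \<Longrightarrow> \<beta>2 (f2 h) = (\<beta> \<circ> f1) h"
      using surjective_on_characters[OF p set(2,3) fc(2) surj(2)] by blast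
    then obtain \<beta>' where "\<beta>' \<in> characters p G T" "\<And>x. x \<in> carrier G1 \<Longrightarrow> \<beta>' (?c1 x) = \<beta> x"
      using amalgamated_product_character[OF p A \<beta>, of \<beta>2] by (metis comp_apply)
    then show ?thesis by blast
  qed
  have ext2: "\<exists>\<beta>'\<in>characters p G T. \<forall>x\<in>carrier G2. \<beta>' (?c2 x) = \<beta> x"
    if \<beta>: "\<beta> \<in> characters p G2 T2" for \<beta>
  proof -
    have "\<beta> \<circ> f2 \<in> characters p H TH" using f(2) \<beta> by (rule characters_compose)
    then obtain \<beta>1 where "\<beta>1 \<in> characters p G1 T1" "\<And>h. h \<in> carrier H \<Longrightarrow> \<beta>1 (f1 h) = (\<beta> \<circ> f2) h"
      using surjective_on_characters[OF p set(1,3) fc(1) surj(1)] by blast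
    then obtain \<beta>' where "\<beta>' \<in> characters p G T" "\<And>x. x \<in> carrier G2 \<Longrightarrow> \<beta>' (?c2 x) = \<beta> x"
      using amalgamated_product_character[OF p A _ \<beta>, of \<beta>1] by (metis comp_apply)
    then show ?thesis by blast
  qed
  show ?thesis
    unfolding cup_radical_trivial_iff
  proof (intro ballI impI)
    fix \<xi> g assume \<xi>: "\<xi> \<in> characters p G T" "\<forall>\<beta>\<in>characters p G T. cup_vanishes p G T \<xi> \<beta>"
      and g: "g \<in> carrier G"
    show "\<xi> g = 0"
    proof (rule characters_agree[OF p P \<xi>(1) _ g])
      fix w assume "w \<in> ?W"
      then consider (1) v where "v \<in> V1" "w = Inl v" | (2) v where "v \<in> V2" "w = Inr v" by blast
      then show "\<xi> (\<pi> (free_gen p ?W w)) = 0"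
      proof cases
        case 1
        have "\<pi>1 (free_gen p V1 v) \<in> carrier G1"
          using P1 free_gen_in[OF 1(1)] unfolding pro_p_presentation_def by blast
        then have "\<xi> (?c1 (\<pi>1 (free_gen p V1 v))) = 0"
          using radical_character_vanishes_on_subgroup[OF p pro(1) rad(1) c1(1) ext1 \<xi>] by blast
        then show ?thesis
          using 1 c1(2)[OF free_gen_in[OF 1(1)]] free_map_continuous_hom(2)[OF inj(1,2) 1(1)] by simp
      next
        case 2
        have "\<pi>2 (free_gen p V2 v) \<in> carrier G2"
          using P2 free_gen_in[OF 2(1)] unfolding pro_p_presentation_def by blast
        then have "\<xi> (?c2 (\<pi>2 (free_gen p V2 v))) = 0"
          using radical_character_vanishes_on_subgroup[OF p pro(2) rad(2) c2(1) ext2 \<xi>] by blast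
        then show ?thesis
          using 2 c2(2)[OF free_gen_in[OF 2(1)]] free_map_continuous_hom(2)[OF inj(3,4) 2(1)] by simp
      qed
    qed
  qed
qed

section \<open>HNN-extensions\<close>

lemma hnn_relator_subset: "free_map p V (hnn_gens V) Some ` R \<subseteq> hnn_relators p V R \<pi>0 H f"
  by (auto simp: hnn_relators_def Let_def)

text \<open>A character sends the relator of \<open>h\<close> to the difference of
  \<open>\<alpha>0 h\<close> and \<open>\<alpha>0 (f h)\<close>, whatever its value at the stable
  letter.\<close>

lemma hnn_extension_character:
  assumes p: "p > 0"
    and A: "hnn_extension p V R G0 T0 \<pi>0 H f G T \<pi>"
    and \<alpha>0: "\<alpha>0 \<in> characters p G0 T0"
    and agree: "\<And>h. h \<in> H \<Longrightarrow> \<alpha>0 (f h) = \<alpha>0 h"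
  obtains \<alpha> where "\<alpha> \<in> characters p G T"
    "\<And>g. g \<in> carrier G0 \<Longrightarrow> \<alpha> (canonical_map p V \<pi>0 (hnn_gens V) \<pi> Some g) = \<alpha>0 g"
proof -
  let ?W = "hnn_gens V" and ?R = "hnn_relators p V R \<pi>0 H f"
  let ?j = "free_map p V ?W Some" and ?F = "free_pro_p p ?W" and ?t = "free_gen p (hnn_gens V) None"
  have P0: "pro_p_presentation p V R G0 T0 \<pi>0" and P: "pro_p_presentation p ?W ?R G T \<pi>"
    using A by (auto simp: hnn_extension_def)
  note c0 = pro_p_presentation_character[OF P0 \<alpha>0]
  \<comment> \<open>The stable letter occurs in the relators only as a conjugating element, so its
    value is free; 0 is taken.\<close>
  define c where "c = (\<lambda>w. case w of None \<Rightarrow> 0 | Some v \<Rightarrow> \<alpha>0 (\<pi>0 (free_gen p V v)))"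
  have "c w \<in> {0..<int p}" if "w \<in> ?W" for w
    using that p characters_range[OF c0(1)] by (auto simp: c_def hnn_gens_def topspace_free_pro_p free_gen_in)
  moreover have "finite {w \<in> ?W. c w \<noteq> 0}"
  proof -
    have "{w \<in> ?W. c w \<noteq> 0} \<subseteq> Some ` {v \<in> V. (\<alpha>0 \<circ> \<pi>0) (free_gen p V v) \<noteq> 0}"
      by (auto simp: c_def hnn_gens_def)
    then show ?thesis
      using free_character_finite_support[OF c0(1)] by (meson finite_imageI finite_subset)
  qed
  ultimately obtain \<xi> where \<xi>: "\<xi> \<in> characters p ?F (free_pro_p_top p ?W)"
    "\<And>w. w \<in> ?W \<Longrightarrow> \<xi> (free_gen p ?W w) = c w"
    using free_character_exists[OF p] by blast
  have inj: "inj_on Some V" "Some ` V \<subseteq> ?W" by (auto simp: hnn_gens_def)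
  note j = free_map_continuous_hom[OF inj, where p = p]
  have \<xi>j: "\<xi> (?j x) = \<alpha>0 (\<pi>0 x)" if "x \<in> carrier (free_pro_p p V)" for x
    using free_characters_eqI[OF characters_compose[OF j(1) \<xi>(1)] c0(1) _ that] j(2) \<xi>(2)
    by (simp add: c_def hnn_gens_def)
  interpret \<xi>: group_hom ?F "integer_mod_group p" \<xi>
    by (rule characters_group_hom[OF \<xi>(1) group_free_pro_p])
  have jF: "?j x \<in> carrier ?F" if "x \<in> carrier (free_pro_p p V)" for x
    using j(1) that by (auto simp: continuous_hom_def hom_def)
  have tF: "?t \<in> carrier ?F" by (intro free_gen_in) (simp add: hnn_gens_def)
  have \<xi>t: "\<xi> ?t = 0" using \<xi>(2)[of None] by (simp add: c_def hnn_gens_def)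
  have "\<xi> r = 0" if r: "r \<in> ?R" for r
  proof -
    consider (1) x where "x \<in> R" "r = ?j x"
      | (2) x y h where "x \<in> carrier (free_pro_p p V)" "y \<in> carrier (free_pro_p p V)"
        "h \<in> H" "\<pi>0 x = h" "\<pi>0 y = f h"
        "r = ?t \<otimes>\<^bsub>?F\<^esub> ?j x \<otimes>\<^bsub>?F\<^esub> inv\<^bsub>?F\<^esub> ?t \<otimes>\<^bsub>?F\<^esub> inv\<^bsub>?F\<^esub> ?j y"
      using r unfolding hnn_relators_def Let_def by blast
    then show ?thesis
    proof cases
      case 1
      then show ?thesis using \<xi>j c0(2) pro_p_presentation_kernel(1)[OF P0] by simp
    next
      case 2
      have xy: "?j x \<in> carrier ?F" "?j y \<in> carrier ?F" "\<xi> (?j x) = \<xi> (?j y)"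
        using 2 \<xi>j jF agree by auto
      \<comment> \<open>The four factors of the relator contribute in turn; the two zeros are
        \<open>\<xi> ?t\<close> and its negative, and \<open>\<xi> (?j x)\<close> has been replaced
        by \<open>\<xi> (?j y)\<close>.\<close>
      have "\<xi> r = (((0 + \<xi> (?j y)) mod int p + (- 0) mod int p) mod int p + (- \<xi> (?j y)) mod int p) mod int p"
        unfolding 2(6) using xy tF \<xi>t \<xi>.hom_closed[OF xy(2)] \<xi>.hom_closed[OF tF]
        by (simp del: free_pro_p_simps)
      then show ?thesis by (simp add: mod_simps)
    qed
  qed
  then obtain \<alpha> where \<alpha>: "\<alpha> \<in> characters p G T" "\<And>x. x \<in> carrier ?F \<Longrightarrow> \<alpha> (\<pi> x) = \<xi> x"
    using presentation_lift_character[OF p P \<xi>(1)] by blast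
  show thesis
  proof (rule that[OF \<alpha>(1)])
    fix g assume "g \<in> carrier G0"
    then obtain x where x: "x \<in> carrier (free_pro_p p V)" "g = \<pi>0 x"
      using P0 unfolding pro_p_presentation_def by blast
    then show "\<alpha> (canonical_map p V \<pi>0 ?W \<pi> Some g) = \<alpha>0 g"
      using canonical_map_lift(2)[OF P P0 inj hnn_relator_subset] \<alpha>(2) jF \<xi>j by simp
  qed
qed

text \<open>The defining relation freed of inverses: a primitive of a cup product is evaluated on
  products of two elements, and both sides are such products.\<close>

lemma hnn_extension_conjugation:
  assumes A: "hnn_extension p V R G0 T0 \<pi>0 H f G T \<pi>" and h: "h \<in> H"
  defines "c \<equiv> canonical_map p V \<pi>0 (hnn_gens V) \<pi> Some" and "t \<equiv> \<pi> (free_gen p (hnn_gens V) None)"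
  shows "t \<otimes>\<^bsub>G\<^esub> c h = c (f h) \<otimes>\<^bsub>G\<^esub> t"
proof -
  let ?W = "hnn_gens V" and ?R = "hnn_relators p V R \<pi>0 H f"
  let ?j = "free_map p V ?W Some" and ?F = "free_pro_p p ?W" and ?t = "free_gen p (hnn_gens V) None"
  have P0: "pro_p_presentation p V R G0 T0 \<pi>0" and P: "pro_p_presentation p ?W ?R G T \<pi>"
    and H: "subgroup H G0"
    and f: "f \<in> continuous_hom (G0\<lparr>carrier := H\<rparr>) (subtopology T0 H) G0 T0"
    using A by (auto simp: hnn_extension_def)
  have "group G"
    using P by (simp add: pro_p_presentation_def pro_p_group_def profinite_group_def topological_group_def)
  then interpret pi: group_hom ?F G \<pi>
    using P by (simp add: pro_p_presentation_def continuous_hom_def group_hom_def group_hom_axioms_def group_free_pro_p)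
  have inj: "inj_on Some V" "Some ` V \<subseteq> ?W" by (auto simp: hnn_gens_def)
  have jF: "?j x \<in> carrier ?F" if "x \<in> carrier (free_pro_p p V)" for x
    using free_map_continuous_hom(1)[OF inj, of p] that by (auto simp: continuous_hom_def hom_def)
  have tF: "?t \<in> carrier ?F" by (intro free_gen_in) (simp add: hnn_gens_def)
  have "h \<in> carrier G0" "f h \<in> carrier G0"
    using H h f subgroup.mem_carrier by (fastforce simp: continuous_hom_def hom_def)+
  moreover have surj: "carrier G0 = \<pi>0 ` carrier (free_pro_p p V)"
    using P0 by (simp add: pro_p_presentation_def)
  ultimately obtain x y where x: "x \<in> carrier (free_pro_p p V)" "\<pi>0 x = h"
    and y: "y \<in> carrier (free_pro_p p V)" "\<pi>0 y = f h"
    unfolding surj by (elim imageE) simp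
  let ?r = "?t \<otimes>\<^bsub>?F\<^esub> ?j x \<otimes>\<^bsub>?F\<^esub> inv\<^bsub>?F\<^esub> ?t \<otimes>\<^bsub>?F\<^esub> inv\<^bsub>?F\<^esub> ?j y"
  have "?r \<in> ?R" using x y h unfolding hnn_relators_def Let_def by blast
  then have "\<pi> ?r = \<one>\<^bsub>G\<^esub>" by (rule pro_p_presentation_kernel(2)[OF P])
  moreover have "\<pi> ?r = t \<otimes>\<^bsub>G\<^esub> \<pi> (?j x) \<otimes>\<^bsub>G\<^esub> inv\<^bsub>G\<^esub> t \<otimes>\<^bsub>G\<^esub> inv\<^bsub>G\<^esub> \<pi> (?j y)"
    using tF jF[OF x(1)] jF[OF y(1)] by (simp add: t_def del: free_pro_p_simps)
  moreover have "c h = \<pi> (?j x)" "c (f h) = \<pi> (?j y)"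
    using canonical_map_lift(2)[OF P P0 inj hnn_relator_subset, OF x(1)]
      canonical_map_lift(2)[OF P P0 inj hnn_relator_subset, OF y(1)]
    unfolding x(2) y(2) c_def by simp_all
  ultimately have 1: "t \<otimes>\<^bsub>G\<^esub> c h \<otimes>\<^bsub>G\<^esub> inv\<^bsub>G\<^esub> t \<otimes>\<^bsub>G\<^esub> inv\<^bsub>G\<^esub> c (f h) = \<one>\<^bsub>G\<^esub>"
    and car: "t \<in> carrier G" "c h \<in> carrier G" "c (f h) \<in> carrier G"
    using tF jF[OF x(1)] jF[OF y(1)] by (simp_all add: t_def)
  have "t \<otimes>\<^bsub>G\<^esub> c h \<otimes>\<^bsub>G\<^esub> inv\<^bsub>G\<^esub> t = c (f h)"
    using 1 car by (metis pi.H.inv_closed pi.H.inv_equality pi.H.inv_inv pi.H.m_closed)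
  then show ?thesis
    using car by (metis pi.H.inv_closed pi.H.inv_solve_right' pi.H.m_closed)
qed

text \<open>A primitive \<open>s\<close> of \<open>\<xi> \<union> \<beta>\<close> restricts to a character of \<open>G0\<close>, since \<open>\<xi>\<close> vanishes there;
  hence \<open>s (f h) = s h\<close>, and evaluating \<open>s\<close> on both sides of \<open>t h = f h t\<close> leaves
  \<open>\<xi> t * \<beta> h = 0\<close>.\<close>

lemma hnn_extension_cup_radical:
  assumes p: "prime p"
    and A: "hnn_extension p V R G0 T0 \<pi>0 H f G T \<pi>"
    and rad: "cup_radical p G0 T0 = {\<one>\<^bsub>cohomology p G0 T0 1\<^esub>}"
    and nontriv: "H \<noteq> {\<one>\<^bsub>G0\<^esub>}"
    and agree: "\<And>\<alpha> h. \<alpha> \<in> characters p G0 T0 \<Longrightarrow> h \<in> H \<Longrightarrow> \<alpha> (f h) = \<alpha> h"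
    and surj: "restriction p G0 T0 H 1 ` carrier (cohomology p G0 T0 1)
            = carrier (cohomology p (G0\<lparr>carrier := H\<rparr>) (subtopology T0 H) 1)"
  shows "cup_radical p G T = {\<one>\<^bsub>cohomology p G T 1\<^esub>}"
proof -
  let ?W = "hnn_gens V" and ?R = "hnn_relators p V R \<pi>0 H f"
  let ?c = "canonical_map p V \<pi>0 ?W \<pi> Some" and ?t = "\<pi> (free_gen p ?W None)"
  have p0: "p > 0" using p prime_gt_0_nat by blast
  have P0: "pro_p_presentation p V R G0 T0 \<pi>0" and P: "pro_p_presentation p ?W ?R G T \<pi>"
    and pro: "pro_p_group p G0 T0" "pro_p_group p G T"
    and H: "subgroup H G0"
    and f: "f \<in> continuous_hom (G0\<lparr>carrier := H\<rparr>) (subtopology T0 H) G0 T0"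
    using A by (auto simp: hnn_extension_def pro_p_presentation_def)
  have fG: "f h \<in> carrier G0" if "h \<in> H" for h
    using f that by (auto simp: continuous_hom_def hom_def)
  have HG: "H \<subseteq> carrier G0" using H subgroup.subset by blast
  interpret G0: cohomology_setting G0 T0 p using p0 pro(1) by (rule cohomology_setting_pro_p)
  interpret cohomology_setting G T p using p0 pro(2) by (rule cohomology_setting_pro_p)
  have setH: "cohomology_setting (G0\<lparr>carrier := H\<rparr>) (subtopology T0 H) p"
    using H HG p0 G0.topspace_eq by (auto simp: cohomology_setting_def cohomology_setting_axioms_def
        subgroup.subgroup_is_group G0.is_group topspace_subtopology)
  have inj: "inj_on Some V" "Some ` V \<subseteq> ?W" by (auto simp: hnn_gens_def)
  note c = canonical_map_lift[OF P P0 inj hnn_relator_subset]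
  have chom: "?c \<in> hom G0 G" using c(1) by (simp add: continuous_hom_def)
  have ext: "\<exists>\<beta>'\<in>characters p G T. \<forall>x\<in>carrier G0. \<beta>' (?c x) = \<beta> x"
    if "\<beta> \<in> characters p G0 T0" for \<beta>
    using hnn_extension_character[OF p0 A that] agree[OF that] by metis
  \<comment> \<open>\<open>\<gamma>\<close> lives on \<open>H\<close> only. Surjectivity of the
    restriction extends it to \<open>\<beta>0\<close> on \<open>G0\<close>, and the agreement of
    characters on \<open>h\<close> and \<open>f h\<close> then extends it to \<open>\<beta>\<close>
    on \<open>G\<close>.\<close>
  obtain \<gamma> h where \<gamma>: "\<gamma> \<in> characters p (G0\<lparr>carrier := H\<rparr>) (subtopology T0 H)" "h \<in> H" "\<gamma> h \<noteq> 0"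
    using pro_p_subgroup_nontrivial_character[OF p pro(1) H nontriv] .
  have "(\<lambda>x. x) \<in> carrier (G0\<lparr>carrier := H\<rparr>) \<rightarrow> carrier G0" using HG by auto
  then obtain \<beta>0 where \<beta>0: "\<beta>0 \<in> characters p G0 T0"
    "\<And>h. h \<in> carrier (G0\<lparr>carrier := H\<rparr>) \<Longrightarrow> \<beta>0 h = \<gamma> h"
    using surjective_on_characters[OF p0 G0.cohomology_setting_axioms setH _ surj[unfolded restriction_def] \<gamma>(1)]
    by blast
  obtain \<beta> where \<beta>: "\<beta> \<in> characters p G T" "\<forall>x\<in>carrier G0. \<beta> (?c x) = \<beta>0 x"
    using ext[OF \<beta>0(1)] by blast
  have hG: "h \<in> carrier G0" using \<gamma>(2) HG by blast
  have "\<gamma> h \<in> {0..<int p}"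
    using characters_range[OF \<gamma>(1), of h] \<gamma>(2) HG G0.topspace_eq by (auto simp: topspace_subtopology)
  \<comment> \<open>A nonzero least residue is not divisible by \<open>p\<close>; since
    \<open>p\<close> is prime, divisibility of the product \<open>\<xi> ?t * \<beta> (?c h)\<close>
    will then pass to \<open>\<xi> ?t\<close>.\<close>
  then have \<beta>h: "\<not> int p dvd \<beta> (?c h)"
    using \<gamma>(2,3) \<beta>(2) \<beta>0(2)[of h] hG by (auto dest: zdvd_imp_le)
  have tF: "free_gen p ?W None \<in> carrier (free_pro_p p ?W)"
    by (intro free_gen_in) (simp add: hnn_gens_def)
  then have tG: "?t \<in> carrier G"
    using P unfolding pro_p_presentation_def by blast
  show ?thesis
    unfolding cup_radical_trivial_iff
  proof (intro ballI impI)
    fix \<xi> g assume \<xi>: "\<xi> \<in> characters p G T" "\<forall>\<beta>\<in>characters p G T. cup_vanishes p G T \<xi> \<beta>"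
      and g: "g \<in> carrier G"
    have \<xi>0: "\<xi> (?c x) = 0" if "x \<in> carrier G0" for x
      using radical_character_vanishes_on_subgroup[OF p0 pro(1) rad c(1) ext \<xi> that] .
    have "\<xi> ?t = 0"
    proof -
      obtain s where s: "continuous_map T (discrete_topology {0..<int p}) s"
        "\<forall>x\<in>carrier G. \<forall>y\<in>carrier G.
          (\<xi> x * \<beta> y) mod int p = (s y - s (x \<otimes>\<^bsub>G\<^esub> y) + s x) mod int p"
        using bspec[OF \<xi>(2) \<beta>(1)] unfolding cup_vanishes_def by (elim exE conjE)
      have cG: "?c x \<in> carrier G" if "x \<in> carrier G0" for x
        using chom that by (rule hom_in_carrier)
      have "s \<circ> ?c \<in> characters p G0 T0"
        unfolding characters_iff[OF p0 G0.topspace_eq]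
      proof (intro conjI ballI)
        show "continuous_map T0 (discrete_topology {0..<int p}) (s \<circ> ?c)"
          using c(1) s(1) by (auto simp: continuous_hom_def intro: continuous_map_compose)
        fix x y assume xy: "x \<in> carrier G0" "y \<in> carrier G0"
        have "s (?c (x \<otimes>\<^bsub>G0\<^esub> y)) \<in> {0..<int p}"
          using continuous_map_discreteD[OF s(1)] cG xy topspace_eq by simp
        moreover have "(s (?c y) - s (?c (x \<otimes>\<^bsub>G0\<^esub> y)) + s (?c x)) mod int p = 0"
          using s(2)[rule_format, OF cG[OF xy(1)] cG[OF xy(2)]] \<xi>0[OF xy(1)] hom_mult[OF chom xy] by simp
        then have "(s (?c x) + s (?c y)) mod int p = s (?c (x \<otimes>\<^bsub>G0\<^esub> y)) mod int p"
          by (simp add: mod_eq_dvd_iff dvd_eq_mod_eq_0 algebra_simps)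
        ultimately show "(s \<circ> ?c) (x \<otimes>\<^bsub>G0\<^esub> y) = ((s \<circ> ?c) x + (s \<circ> ?c) y) mod int p"
          by simp
      qed
      then have sf: "s (?c (f h)) = s (?c h)" using agree[OF _ \<gamma>(2), of "s \<circ> ?c"] by simp
      have "(\<xi> ?t * \<beta> (?c h)) mod int p = (s (?c h) - s (?t \<otimes>\<^bsub>G\<^esub> ?c h) + s ?t) mod int p"
        using s(2)[rule_format, OF tG cG[OF hG]] .
      \<comment> \<open>With \<open>s (?c h)\<close> replaced by \<open>s (?c (f h))\<close>, the
        expression is the coboundary of \<open>s\<close> at the pair of \<open>?c (f h)\<close> and
        \<open>?t\<close>. There the cup product is 0, because its first factor is
        \<open>\<xi>\<close> at an element coming from \<open>G0\<close>.\<close>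
      also have "\<dots> = (s ?t - s (?c (f h) \<otimes>\<^bsub>G\<^esub> ?t) + s (?c (f h))) mod int p"
        unfolding hnn_extension_conjugation[OF A \<gamma>(2)] sf by (simp add: algebra_simps)
      also have "\<dots> = 0"
        using s(2)[rule_format, OF cG[OF fG[OF \<gamma>(2)]] tG] \<xi>0[OF fG[OF \<gamma>(2)]] by simp
      finally have "int p dvd \<xi> ?t * \<beta> (?c h)" by (simp add: dvd_eq_mod_eq_0)
      moreover have "prime (int p)" using p by simp
      ultimately have "int p dvd \<xi> ?t" using \<beta>h prime_dvd_mult_iff by blast
      moreover have "\<xi> ?t \<in> {0..<int p}"
        using characters_range[OF \<xi>(1)] tG topspace_eq by blast
      ultimately show ?thesis by (auto dest: zdvd_imp_le)
    qed
    show "\<xi> g = 0"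
    proof (rule characters_agree[OF p0 P \<xi>(1) _ g])
      fix w assume "w \<in> ?W"
      then consider (1) "w = None" | (2) v where "v \<in> V" "w = Some v" by (auto simp: hnn_gens_def)
      then show "\<xi> (\<pi> (free_gen p ?W w)) = 0"
      proof cases
        case 1
        then show ?thesis using \<open>\<xi> ?t = 0\<close> by simp
      next
        case 2
        have "\<pi>0 (free_gen p V v) \<in> carrier G0"
          using P0 free_gen_in[OF 2(1)] unfolding pro_p_presentation_def by blast
        then have "\<xi> (?c (\<pi>0 (free_gen p V v))) = 0" by (rule \<xi>0)
        then show ?thesis
          using 2 c(2)[OF free_gen_in[OF 2(1)]] free_map_continuous_hom(2)[OF inj 2(1)] by simp
      qed
    qed
  qed
qed

text \<open>Since classes in degree one are singletons, restriction to f(H) followed by pullback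
  along \<open>f\<close> is plain composition with \<open>f\<close>.\<close>

lemma restriction_equality_on_characters:
  assumes p: "p > 0" and set: "cohomology_setting G T p" and H: "H \<subseteq> carrier G"
    and fH: "f ` H \<subseteq> carrier G"
    and eq: "\<forall>\<alpha>\<in>carrier (cohomology p G T 1).
             induced p (G\<lparr>carrier := H\<rparr>) (subtopology T H) 1 f (restriction p G T (f ` H) 1 \<alpha>)
               = restriction p G T H 1 \<alpha>"
    and \<alpha>: "\<alpha> \<in> characters p G T" and h: "h \<in> H"
  shows "\<alpha> (f h) = \<alpha> h"
proof -
  interpret cohomology_setting G T p by fact
  let ?H = "G\<lparr>carrier := H\<rparr>" and ?TH = "subtopology T H" and ?TK = "subtopology T (f ` H)"
  have top: "topspace ?TH = H" "topspace ?TK = f ` H"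
    using H fH topspace_eq by (auto simp: topspace_subtopology)
  have range: "\<alpha> x \<in> {0..<int p}" if "x \<in> carrier G" for x
    using characters_range[OF \<alpha>] that topspace_eq by blast
  have id: "restriction p G T K 1 {lift1 T \<alpha>} = {lift1 (subtopology T K) (\<alpha> \<circ> (\<lambda>x. x))}"
    if "K \<subseteq> carrier G" for K
    unfolding restriction_def using p that topspace_eq characters_range[OF \<alpha>]
    by (intro induced_lift1) (auto simp: topspace_subtopology)
  have "{lift1 ?TH (\<alpha> \<circ> (\<lambda>x. x) \<circ> f)} = induced p ?H ?TH 1 f {lift1 ?TK (\<alpha> \<circ> (\<lambda>x. x))}"
    using p top range fH by (intro induced_lift1[symmetric]) (auto simp: subset_iff)
  also have "\<dots> = {lift1 ?TH (\<alpha> \<circ> (\<lambda>x. x))}"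
    using bspec[OF eq[unfolded carrier_cohomology_1] imageI[OF \<alpha>]] unfolding id[OF H] id[OF fH] .
  finally have "lift1 ?TH (\<alpha> \<circ> f) = lift1 ?TH \<alpha>" by (simp add: o_def)
  then show ?thesis using lift1_eqD[of ?TH "\<alpha> \<circ> f" \<alpha> h] h unfolding top by simp
qed

theorem theorem3:
  fixes p :: nat
    and G\<^sub>0 :: "'a monoid" and T\<^sub>0 :: "'a topology"
    and G\<^sub>1 :: "'b monoid" and T\<^sub>1 :: "'b topology"
    and G\<^sub>2 :: "'c monoid" and T\<^sub>2 :: "'c topology"
    and G :: "'g monoid" and T :: "'g topology"
    and V\<^sub>0 :: "'u set" and R\<^sub>0 :: "'u free_elem set" and \<pi>\<^sub>0 :: "'u free_elem \<Rightarrow> 'a"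
    and V\<^sub>1 :: "'v set" and R\<^sub>1 :: "'v free_elem set" and \<pi>\<^sub>1 :: "'v free_elem \<Rightarrow> 'b"
    and V\<^sub>2 :: "'w set" and R\<^sub>2 :: "'w free_elem set" and \<pi>\<^sub>2 :: "'w free_elem \<Rightarrow> 'c"
    and H :: "'h monoid" and TH :: "'h topology" and f\<^sub>1 :: "'h \<Rightarrow> 'b" and f\<^sub>2 :: "'h \<Rightarrow> 'c"
    and \<pi> :: "('v + 'w) free_elem \<Rightarrow> 'g"
    and H\<^sub>0 :: "'a set" and f :: "'a \<Rightarrow> 'a" and \<rho> :: "'u option free_elem \<Rightarrow> 'g"
  assumes "prime p"
    and "pro_p_group p G\<^sub>0 T\<^sub>0" "pro_p_group p G\<^sub>1 T\<^sub>1" "pro_p_group p G\<^sub>2 T\<^sub>2"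
    and "cup_radical p G\<^sub>0 T\<^sub>0 = {\<one>\<^bsub>cohomology p G\<^sub>0 T\<^sub>0 1\<^esub>}"
    and "cup_radical p G\<^sub>1 T\<^sub>1 = {\<one>\<^bsub>cohomology p G\<^sub>1 T\<^sub>1 1\<^esub>}"
    and "cup_radical p G\<^sub>2 T\<^sub>2 = {\<one>\<^bsub>cohomology p G\<^sub>2 T\<^sub>2 1\<^esub>}"
    and "(proper_amalgamated_product p V\<^sub>1 R\<^sub>1 G\<^sub>1 T\<^sub>1 \<pi>\<^sub>1 V\<^sub>2 R\<^sub>2 G\<^sub>2 T\<^sub>2 \<pi>\<^sub>2 H TH f\<^sub>1 f\<^sub>2 G T \<pi> \<and>
          induced p H TH 1 f\<^sub>1 ` carrier (cohomology p G\<^sub>1 T\<^sub>1 1) = carrier (cohomology p H TH 1) \<and>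
          induced p H TH 1 f\<^sub>2 ` carrier (cohomology p G\<^sub>2 T\<^sub>2 1) = carrier (cohomology p H TH 1))
       \<or> (proper_hnn_extension p V\<^sub>0 R\<^sub>0 G\<^sub>0 T\<^sub>0 \<pi>\<^sub>0 H\<^sub>0 f G T \<rho> \<and>
          H\<^sub>0 \<noteq> {\<one>\<^bsub>G\<^sub>0\<^esub>} \<and>
          (\<forall>\<alpha>\<in>carrier (cohomology p G\<^sub>0 T\<^sub>0 1).
             induced p (G\<^sub>0\<lparr>carrier := H\<^sub>0\<rparr>) (subtopology T\<^sub>0 H\<^sub>0) 1 f (restriction p G\<^sub>0 T\<^sub>0 (f ` H\<^sub>0) 1 \<alpha>)
               = restriction p G\<^sub>0 T\<^sub>0 H\<^sub>0 1 \<alpha>) \<and>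
          restriction p G\<^sub>0 T\<^sub>0 H\<^sub>0 1 ` carrier (cohomology p G\<^sub>0 T\<^sub>0 1)
            = carrier (cohomology p (G\<^sub>0\<lparr>carrier := H\<^sub>0\<rparr>) (subtopology T\<^sub>0 H\<^sub>0) 1))"
  shows "cup_radical p G T = {\<one>\<^bsub>cohomology p G T 1\<^esub>} \<and> Kijima_Nishi p G T"
proof -
  have p0: "p > 0" using \<open>prime p\<close> by (rule prime_gt_0_nat)
  have rad: "cup_radical p G T = {\<one>\<^bsub>cohomology p G T 1\<^esub>}"
    using assms(8)
  proof (elim disjE conjE)
    assume "proper_amalgamated_product p V\<^sub>1 R\<^sub>1 G\<^sub>1 T\<^sub>1 \<pi>\<^sub>1 V\<^sub>2 R\<^sub>2 G\<^sub>2 T\<^sub>2 \<pi>\<^sub>2 H TH f\<^sub>1 f\<^sub>2 G T \<pi>"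
      and "induced p H TH 1 f\<^sub>1 ` carrier (cohomology p G\<^sub>1 T\<^sub>1 1) = carrier (cohomology p H TH 1)"
      and "induced p H TH 1 f\<^sub>2 ` carrier (cohomology p G\<^sub>2 T\<^sub>2 1) = carrier (cohomology p H TH 1)"
    then show ?thesis
      unfolding proper_amalgamated_product_def
      by (intro amalgamated_product_cup_radical[OF p0 _ assms(6,7)]) (elim conjE)
  next
    assume A: "proper_hnn_extension p V\<^sub>0 R\<^sub>0 G\<^sub>0 T\<^sub>0 \<pi>\<^sub>0 H\<^sub>0 f G T \<rho>"
      and nontriv: "H\<^sub>0 \<noteq> {\<one>\<^bsub>G\<^sub>0\<^esub>}"
      and eq: "\<forall>\<alpha>\<in>carrier (cohomology p G\<^sub>0 T\<^sub>0 1).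
             induced p (G\<^sub>0\<lparr>carrier := H\<^sub>0\<rparr>) (subtopology T\<^sub>0 H\<^sub>0) 1 f (restriction p G\<^sub>0 T\<^sub>0 (f ` H\<^sub>0) 1 \<alpha>)
               = restriction p G\<^sub>0 T\<^sub>0 H\<^sub>0 1 \<alpha>"
      and surj: "restriction p G\<^sub>0 T\<^sub>0 H\<^sub>0 1 ` carrier (cohomology p G\<^sub>0 T\<^sub>0 1)
            = carrier (cohomology p (G\<^sub>0\<lparr>carrier := H\<^sub>0\<rparr>) (subtopology T\<^sub>0 H\<^sub>0) 1)"
    have hnn: "hnn_extension p V\<^sub>0 R\<^sub>0 G\<^sub>0 T\<^sub>0 \<pi>\<^sub>0 H\<^sub>0 f G T \<rho>"
      using A by (simp add: proper_hnn_extension_def)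
    have "H\<^sub>0 \<subseteq> carrier G\<^sub>0" "f ` H\<^sub>0 \<subseteq> carrier G\<^sub>0"
      using hnn by (auto simp: hnn_extension_def continuous_hom_def hom_def dest: subgroup.subset)
    note agree = restriction_equality_on_characters[OF p0 cohomology_setting_pro_p[OF p0 assms(2)] this eq]
    show ?thesis
      by (rule hnn_extension_cup_radical[OF assms(1) hnn assms(5) nontriv agree surj])
  qed
  \<comment> \<open>Being pro-\<open>p\<close> is part of having a pro-\<open>p\<close>
    presentation, which both alternatives provide.\<close>
  have "pro_p_group p G T"
    using assms(8) by (auto simp: proper_amalgamated_product_def amalgamated_product_def
        proper_hnn_extension_def hnn_extension_def pro_p_presentation_def)
  then interpret cohomology_setting G T p
    using p0 by (intro cohomology_setting_pro_p)
  show ?thesis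
    using rad Kijima_Nishi_if_cup_radical_trivial by blast
qed

end
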